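(* Let $R=P/(f)$, $P=k[x,y,z]$, be a standard graded hypersurface ring over a field $k$ of characteristic $p>0$ with homogeneous maximal ideal $\mathfrak m$ (where $f\in(x,y,z)^2$ is homogeneous and nonzero). Suppose that $p$ and $d=\deg f$ have opposite parity. Let $q\ge d+3$ be a power of $p$. Assume further that $f$ is $q$-link-compressed. Let $J_q=((x^q,y^q,z^q):_Pf)$ with minimal generators $x^q,y^q,z^q,w_1,\dots,w_m$, and let $\phi$ ($m\times m$) and $\psi$ ($m\times 3$) be the blocks of the middle matrix of its Buchsbaum–Eisenbud resolution, as described in the context. Then the following hold. (a) The matrix $\phi$ in the matrix factorization $(\phi,\phi^\vee)$ is a $2d\times2d$ linear matrix with Pfaffian equal to $vf$ for some unit $v\in k$, and its Pfaffian adjoint $\phi^\vee$ is a $2d\times2d$ matrix with entries of degree $d-1$. The matrix $\psi$ is $2d\times3$ with entries of degree $\frac12(q-d+1)$. In particular, the minimal graded resolution of $R/\mathfrak m^{[q]}$ over $R$ has the following eventually 2-periodic form: $$\cdots\xrightarrow{\phi}R^{2d}(-b-d)\xrightarrow{\phi^\vee}R^{2d}(-b-1)\xrightarrow{\phi}R^{2d}(-b)\xrightarrow{\psi^T\phi^\vee}R^3(-q)\xrightarrow{[x^q\ y^q\ z^q]}R\to0,$$ where $b=\frac32q+\frac12d-\frac12$ (and matrices over $P$ are reduced to $R$). (b) The minimal graded resolution of $R/\mathfrak m^{[q]}=P/(x^q,y^q,z^q,f)$ over $P$ has the form $$0\leftarrow P\leftarrow P^3(-q)\oplus P(-d)\leftarrow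 P^{2d}\bigl(-\tfrac32q-\tfrac12d+\tfrac12\bigr)\oplus P^3(-q-d)\leftarrow P^{2d}\bigl(-\tfrac32q-\tfrac12d-\tfrac12\bigr)\leftarrow0.$$ In particular, the Castelnuovo–Mumford regularity is given by $\operatorname{reg}(R/\mathfrak m^{[q]})=\frac32q+\frac12d-\frac52$.
   Context: $\mathfrak m^{[q]}=(x^q,y^q,z^q)R$. For a graded $k$-algebra $B$, $H_i(B)=\dim_kB_i$. For a homogeneous complete intersection ideal $\mathfrak c\subseteq P$ with $P/\mathfrak c$ Artinian and a homogeneous Gorenstein ideal $J\supseteq\mathfrak c$ with $P/J$ of socle degree $s$, $J$ is $\mathfrak c$-compressed if $H_i(P/J)=\min\{H_i(P/\mathfrak c),H_{s-i}(P/\mathfrak c)\}$ for every $i$. $f$ is $q$-link-compressed if $J_q=((x^q,y^q,z^q):f)$ is $(x^q,y^q,z^q)$-compressed. In this situation, with $q\ge d+3$, the elements $x^q,y^q,z^q$ are part of a minimal homogeneous generating set $x^q,y^q,z^q,w_1,\dots,w_m$ of $J_q$. By the Buchsbaum–Eisenbud structure theorem (graded version) there is a minimal graded $P$-free resolution of the codimension-three Gorenstein ring $P/J_q$ of the form $0\to P\xrightarrow{\partial_3}P^3\oplus P^m\xrightarrow{\partial_2}P^3\oplus P^m\xrightarrow{\partial_1}P\to0$ with $\partial_1=[x^q,y^q,z^q,w_1,\dots,w_m]$, $\partial_3=\partial_1^T$, and $\partial_2$ given by a skew-symmetric matrix $X=\begin{bmatrix}*&-\psi^T\\ \psi&\phi\end{bmatrix}$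 ($*$ a $3\times3$ block, $\psi$ of size $m\times3$, $\phi$ of size $m\times m$) such that the $j$-th entry of $\partial_1$ is $(-1)^{j+1}\operatorname{Pf}_j(X)$. Here $\operatorname{Pf}_{i_1\cdots i_j}(X)$ is the Pfaffian of $X$ with rows and columns $i_1,\dots,i_j$ removed. The Pfaffian adjoint $\phi^\vee$ is the skew-symmetric matrix with entries $(-1)^{i+j}\operatorname{Pf}_{ij}(\phi)$ for $i<j$, $0$ for $i=j$, $(-1)^{i+j+1}\operatorname{Pf}_{ij}(\phi)$ for $i>j$; it satisfies $\phi\phi^\vee=\phi^\vee\phi=\operatorname{Pf}(\phi)\operatorname{I}$. *)

theory Defs
  imports
    "HOL-Library.Poly_Mapping"
    "HOL-Library.Numeral_Type"
    "HOL-Computational_Algebra.Computational_Algebra"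
    "HOL-Algebra.QuotRing"
    "HOL-Algebra.Ideal_Product"
    "Jordan_Normal_Form.VS_Connect"
begin

section \<open>The polynomial ring in three variables and its graded quotients\<close>

text \<open>\<open>'k poly3\<close> is \<open>k[x,y,z]\<close>: the exponent of a monomial is a function on the three-element
  type \<^typ>\<open>3\<close>, so the variables are \<open>Var 0\<close>, \<open>Var 1\<close>, \<open>Var 2\<close>.
  Quotients are taken in HOL-Algebra, with \<open>poly_ring\<close> as the ambient ring record.\<close>

type_synonym 'k poly3 = "(3 \<Rightarrow>\<^sub>0 nat) \<Rightarrow>\<^sub>0 'k"

abbreviation poly_ring :: "'k::field poly3 ring" where
  "poly_ring \<equiv> class_ring"

definition Var :: "3 \<Rightarrow> 'k::field poly3" where
  "Var v = Poly_Mapping.single (Poly_Mapping.single v 1) 1"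

definition const :: "'k::field \<Rightarrow> 'k poly3" where
  "const c = Poly_Mapping.single 0 c"

definition mon_degree :: "(3 \<Rightarrow>\<^sub>0 nat) \<Rightarrow> nat" where
  "mon_degree m = (\<Sum>v\<in>UNIV. Poly_Mapping.lookup m v)"

text \<open>The graded piece \<open>P\<^sub>i\<close>; it contains \<open>0\<close>, and is \<open>{0}\<close> for \<open>i < 0\<close>.\<close>

definition homog :: "int \<Rightarrow> 'k::field poly3 set" where
  "homog i = {a. \<forall>m\<in>Poly_Mapping.keys a. int (mon_degree m) = i}"

definition homogeneous_ideal :: "'k::field poly3 set \<Rightarrow> bool" where
  "homogeneous_ideal I \<longleftrightarrow>
     ideal I poly_ring \<and> (\<exists>S. S \<subseteq> (\<Union>i. homog i) \<and> I = Idl\<^bsub>poly_ring\<^esub> S)"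

definition max_ideal :: "'k::field poly3 set" where
  "max_ideal = Idl\<^bsub>poly_ring\<^esub> {Var 0, Var 1, Var 2}"

definition power_gens :: "nat \<Rightarrow> 'k::field poly3 list" where
  "power_gens q = [Var 0 ^ q, Var 1 ^ q, Var 2 ^ q]"

definition colon :: "'k::field poly3 set \<Rightarrow> 'k poly3 \<Rightarrow> 'k poly3 set" where
  "colon I f = {g. g * f \<in> I}"

definition quot_homog :: "'k::field poly3 set \<Rightarrow> int \<Rightarrow> 'k poly3 set set" where
  "quot_homog I i = (\<lambda>a. I +>\<^bsub>poly_ring\<^esub> a) ` homog i"

text \<open>\<open>(P/I)\<^sub>i\<close> as a vector space over \<open>k\<close>.\<close>

definition quot_piece :: "'k::field poly3 set \<Rightarrow> int \<Rightarrow> ('k, 'k poly3 set) module" where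
  "quot_piece I i =
     \<lparr>carrier = quot_homog I i,
      mult = mult (poly_ring Quot I), one = one (poly_ring Quot I),
      zero = zero (poly_ring Quot I), add = add (poly_ring Quot I),
      smult = (\<lambda>c A. (I +>\<^bsub>poly_ring\<^esub> const c) \<otimes>\<^bsub>poly_ring Quot I\<^esub> A)\<rparr>"

definition hilbert_fun :: "'k::field poly3 set \<Rightarrow> int \<Rightarrow> nat" where
  "hilbert_fun I i = vectorspace.dim class_ring (quot_piece I i)"


section \<open>Complete intersections, Gorenstein ideals, compressedness\<close>

definition artinian_ring :: "('r, 'b) ring_scheme \<Rightarrow> bool" where
  "artinian_ring R \<longleftrightarrow>
     (\<forall>C :: nat \<Rightarrow> 'r set. (\<forall>n. ideal (C n) R \<and> C (Suc n) \<subseteq> C n)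
        \<longrightarrow> (\<exists>N. \<forall>n\<ge>N. C n = C N))"

definition regular_sequence :: "'k::field poly3 list \<Rightarrow> bool" where
  "regular_sequence gs \<longleftrightarrow>
     Idl\<^bsub>poly_ring\<^esub> (set gs) \<noteq> UNIV \<and>
     (\<forall>i<length gs. \<forall>a. gs ! i * a \<in> Idl\<^bsub>poly_ring\<^esub> (set (take i gs))
        \<longrightarrow> a \<in> Idl\<^bsub>poly_ring\<^esub> (set (take i gs)))"

definition homogeneous_complete_intersection :: "'k::field poly3 set \<Rightarrow> bool" where
  "homogeneous_complete_intersection I \<longleftrightarrow>
     (\<exists>gs. set gs \<subseteq> (\<Union>i. homog i) \<and> regular_sequence gs \<and> I = Idl\<^bsub>poly_ring\<^esub> (set gs))"

definition quot_socle :: "'k::field poly3 set \<Rightarrow> 'k poly3 set set" where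
  "quot_socle I = {A \<in> carrier (poly_ring Quot I).
     \<forall>g\<in>max_ideal. (I +>\<^bsub>poly_ring\<^esub> g) \<otimes>\<^bsub>poly_ring Quot I\<^esub> A = \<zero>\<^bsub>poly_ring Quot I\<^esub>}"

text \<open>\<open>P/I\<close> is a graded Artinian Gorenstein ring of socle degree \<open>s\<close>: its socle is a
  one-dimensional \<open>k\<close>-space concentrated in degree \<open>s\<close>.\<close>

definition gorenstein_of_socle_degree :: "'k::field poly3 set \<Rightarrow> int \<Rightarrow> bool" where
  "gorenstein_of_socle_degree I s \<longleftrightarrow>
     homogeneous_ideal I \<and> artinian_ring (poly_ring Quot I) \<and>
     (\<exists>A \<in> quot_homog I s. A \<noteq> \<zero>\<^bsub>poly_ring Quot I\<^esub> \<and>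
        quot_socle I = {(I +>\<^bsub>poly_ring\<^esub> const c) \<otimes>\<^bsub>poly_ring Quot I\<^esub> A | c. True})"

definition compressed :: "'k::field poly3 set \<Rightarrow> 'k poly3 set \<Rightarrow> bool" where
  "compressed c J \<longleftrightarrow>
     homogeneous_complete_intersection c \<and> artinian_ring (poly_ring Quot c) \<and> c \<subseteq> J \<and>
     (\<exists>s. gorenstein_of_socle_degree J s \<and>
        (\<forall>i. hilbert_fun J i = min (hilbert_fun c i) (hilbert_fun c (s - i))))"

definition link_ideal :: "nat \<Rightarrow> 'k::field poly3 \<Rightarrow> 'k poly3 set" where
  "link_ideal q f = colon (Idl\<^bsub>poly_ring\<^esub> (set (power_gens q))) f"

definition link_compressed :: "nat \<Rightarrow> 'k::field poly3 \<Rightarrow> bool" where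
  "link_compressed q f \<longleftrightarrow>
     compressed (Idl\<^bsub>poly_ring\<^esub> (set (power_gens q))) (link_ideal q f)"

definition minimal_homogeneous_generators ::
    "'k::field poly3 list \<Rightarrow> 'k poly3 set \<Rightarrow> bool" where
  "minimal_homogeneous_generators gs I \<longleftrightarrow>
     set gs \<subseteq> (\<Union>i. homog i) \<and> Idl\<^bsub>poly_ring\<^esub> (set gs) = I \<and>
     (\<forall>i<length gs. Idl\<^bsub>poly_ring\<^esub> (set (take i gs @ drop (Suc i) gs)) \<noteq> I)"


section \<open>Minimal graded free resolutions of cyclic modules\<close>

text \<open>Let \<open>R\<close> be a graded ring with graded pieces \<open>G i\<close> and \<open>I\<close> a homogeneous ideal.
  A graded complex of free modules is given by lists of twists \<open>tw i = [a\<^sub>1, \<dots>, a\<^sub>n]\<close>,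
  meaning \<open>F\<^sub>i = R(-a\<^sub>1) \<oplus> \<dots> \<oplus> R(-a\<^sub>n)\<close>, and matrices \<open>D i\<close> of the maps
  \<open>F\<^bsub>i+1\<^esub> \<rightarrow> F\<^sub>i\<close>, acting on column vectors.  The map \<open>D i\<close> has degree \<open>0\<close> iff its \<open>(r,c)\<close>
  entry lies in \<open>G (tw (i+1) ! c - tw i ! r)\<close>.\<close>

definition free_vecs :: "('r, 'b) ring_scheme \<Rightarrow> nat \<Rightarrow> 'r vec set" where
  "free_vecs R n = {v. dim_vec v = n \<and> (\<forall>i<n. v $ i \<in> carrier R)}"

definition mat_app :: "('r, 'b) ring_scheme \<Rightarrow> 'r mat \<Rightarrow> 'r vec \<Rightarrow> 'r vec" where
  "mat_app R A v =
     vec (dim_row A) (\<lambda>i. \<Oplus>\<^bsub>R\<^esub>j\<in>{..<dim_col A}. A $$ (i, j) \<otimes>\<^bsub>R\<^esub> v $ j)"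

definition irrelevant_ideal :: "('r, 'b) ring_scheme \<Rightarrow> (int \<Rightarrow> 'r set) \<Rightarrow> 'r set" where
  "irrelevant_ideal R G = Idl\<^bsub>R\<^esub> (\<Union>i\<in>{1..}. G i)"

definition minimal_graded_resolution ::
    "('r, 'b) ring_scheme \<Rightarrow> (int \<Rightarrow> 'r set) \<Rightarrow> 'r set
      \<Rightarrow> (nat \<Rightarrow> int list) \<Rightarrow> (nat \<Rightarrow> 'r mat) \<Rightarrow> bool" where
  "minimal_graded_resolution R G I tw D \<longleftrightarrow>
     (\<forall>i. D i \<in> carrier_mat (length (tw i)) (length (tw (Suc i)))) \<and>
     (\<forall>i. \<forall>r<length (tw i). \<forall>c<length (tw (Suc i)).
        D i $$ (r, c) \<in> G (tw (Suc i) ! c - tw i ! r)) \<and>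
     \<comment> \<open>\<open>F\<^sub>0 = R\<close> and the cokernel of \<open>D 0\<close> is \<open>R/I\<close>\<close>
     tw 0 = [0] \<and> {mat_app R (D 0) v $ 0 | v. v \<in> free_vecs R (length (tw 1))} = I \<and>
     \<comment> \<open>exactness at \<open>F\<^bsub>i+1\<^esub>\<close>\<close>
     (\<forall>i. {v \<in> free_vecs R (length (tw (Suc i))).
             mat_app R (D i) v = vec (length (tw i)) (\<lambda>_. \<zero>\<^bsub>R\<^esub>)}
          = mat_app R (D (Suc i)) ` free_vecs R (length (tw (Suc (Suc i))))) \<and>
     \<comment> \<open>minimality\<close>
     (\<forall>i. elements_mat (D i) \<subseteq> irrelevant_ideal R G)"

text \<open>Finite complexes, given by the twists of \<open>F\<^sub>0, \<dots>, F\<^sub>n\<close> and \<open>n\<close> matrices, are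
  continued by zero modules.\<close>

definition fin_twists :: "int list list \<Rightarrow> nat \<Rightarrow> int list" where
  "fin_twists ts i = (if i < length ts then ts ! i else [])"

definition fin_maps ::
    "('r, 'b) ring_scheme \<Rightarrow> int list list \<Rightarrow> 'r mat list \<Rightarrow> nat \<Rightarrow> 'r mat" where
  "fin_maps R ts ms i =
     (if i < length ms then ms ! i
      else mat (length (fin_twists ts i)) (length (fin_twists ts (Suc i))) (\<lambda>_. \<zero>\<^bsub>R\<^esub>))"

definition finite_minimal_graded_resolution ::
    "('r, 'b) ring_scheme \<Rightarrow> (int \<Rightarrow> 'r set) \<Rightarrow> 'r set
      \<Rightarrow> int list list \<Rightarrow> 'r mat list \<Rightarrow> bool" where
  "finite_minimal_graded_resolution R G I ts ms \<longleftrightarrow>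
     length ts = Suc (length ms) \<and>
     minimal_graded_resolution R G I (fin_twists ts) (fin_maps R ts ms)"

text \<open>The Castelnuovo--Mumford regularity of \<open>P/I\<close> (\<open>I\<close> a proper homogeneous ideal) as a
  graded \<open>P\<close>-module, read off the minimal graded free resolution.\<close>

definition cm_regularity :: "'k::field poly3 set \<Rightarrow> int" where
  "cm_regularity I =
     (THE r. \<exists>tw D. minimal_graded_resolution poly_ring homog I tw D \<and>
                    r = Max {b - int i | i b. b \<in> set (tw i)})"


section \<open>Pfaffians\<close>

text \<open>\<open>pf A is\<close> is the Pfaffian of the submatrix of \<open>A\<close> with rows and columns \<open>is\<close>, by
  expansion along the first row; it is \<open>0\<close> if \<open>is\<close> has odd length.\<close>

function pf :: "'r::comm_ring_1 mat \<Rightarrow> nat list \<Rightarrow> 'r" where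
  "pf A [] = 1"
| "pf A (i # is) =
     (\<Sum>j<length is. (- 1) ^ j * A $$ (i, is ! j) * pf A (take j is @ drop (Suc j) is))"
  by pat_completeness auto
termination by (relation "measure (\<lambda>(A, is). length is)") auto

definition pf_del :: "'r::comm_ring_1 mat \<Rightarrow> nat set \<Rightarrow> 'r" where
  "pf_del A S = pf A (filter (\<lambda>i. i \<notin> S) [0..<dim_row A])"

definition pfaffian :: "'r::comm_ring_1 mat \<Rightarrow> 'r" where
  "pfaffian A = pf_del A {}"

text \<open>Indices start at \<open>0\<close>; this does not affect the parity of \<open>i + j\<close>.\<close>

definition pf_adjoint :: "'r::comm_ring_1 mat \<Rightarrow> 'r mat" where
  "pf_adjoint A = mat (dim_row A) (dim_row A) (\<lambda>(i, j).
     if i < j then (- 1) ^ (i + j) * pf_del A {i, j}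
     else if i = j then 0
     else (- 1) ^ (i + j + 1) * pf_del A {i, j})"

text \<open>Skew-symmetric includes a zero diagonal, as is needed in characteristic \<open>2\<close>.\<close>

definition skew_symmetric :: "'r::comm_ring_1 mat \<Rightarrow> bool" where
  "skew_symmetric A \<longleftrightarrow>
     dim_row A = dim_col A \<and> (\<forall>i<dim_row A. A $$ (i, i) = 0) \<and>
     (\<forall>i<dim_row A. \<forall>j<dim_row A. A $$ (i, j) = - A $$ (j, i))"


section \<open>The two resolutions\<close>

definition row_mat :: "'r list \<Rightarrow> 'r mat" where
  "row_mat gs = mat_of_row (vec_of_list gs)"

text \<open>A graded Buchsbaum--Eisenbud resolution of \<open>P/J\<close> with first map the row \<open>gs\<close>, middle map
  \<open>X\<close> and last map the transposed row.  The sign \<open>(-1)\<^bsup>j+1\<^esup>\<close> of the \<open>j\<close>-th entry becomes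
  \<open>(-1)\<^bsup>j\<^esup>\<close> with indices starting at \<open>0\<close>.\<close>

definition buchsbaum_eisenbud_resolution ::
    "'k::field poly3 set \<Rightarrow> 'k poly3 list \<Rightarrow> 'k poly3 mat \<Rightarrow> bool" where
  "buchsbaum_eisenbud_resolution J gs X \<longleftrightarrow>
     X \<in> carrier_mat (length gs) (length gs) \<and> skew_symmetric X \<and>
     (\<forall>j<length gs. gs ! j = (- 1) ^ j * pf_del X {j}) \<and>
     (\<exists>as bs e. finite_minimal_graded_resolution poly_ring homog J
        [[0], as, bs, [e]] [row_mat gs, X, transpose_mat (row_mat gs)])"

text \<open>The twists and maps of
  \<open>\<dots> \<rightarrow> R\<^bsup>2d\<^esup>(-b-d) \<rightarrow>\<^sub>B R\<^bsup>2d\<^esup>(-b-1) \<rightarrow>\<^sub>A R\<^bsup>2d\<^esup>(-b) \<rightarrow>\<^sub>C R\<^sup>3(-q) \<rightarrow>\<^sub>E R \<rightarrow> 0\<close>,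
  continued 2-periodically by \<open>A\<close> and \<open>B\<close>, where \<open>A\<close> has degree \<open>1\<close> and \<open>B\<close> degree \<open>d - 1\<close>.\<close>

fun periodic_twists :: "nat \<Rightarrow> nat \<Rightarrow> int \<Rightarrow> nat \<Rightarrow> int list" where
  "periodic_twists q d b 0 = [0]"
| "periodic_twists q d b (Suc 0) = replicate 3 (int q)"
| "periodic_twists q d b (Suc (Suc n)) =
     replicate (2 * d) (b + int (n div 2) * int d + int (n mod 2))"

fun periodic_maps :: "'r mat \<Rightarrow> 'r mat \<Rightarrow> 'r mat \<Rightarrow> 'r mat \<Rightarrow> nat \<Rightarrow> 'r mat" where
  "periodic_maps E C A B 0 = E"
| "periodic_maps E C A B (Suc 0) = C"
| "periodic_maps E C A B (Suc (Suc n)) = (if even n then A else B)"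

definition hypersurface :: "'k::field poly3 \<Rightarrow> 'k poly3 set ring" where
  "hypersurface f = poly_ring Quot (PIdl\<^bsub>poly_ring\<^esub> f)"

definition reduce :: "'k::field poly3 \<Rightarrow> 'k poly3 \<Rightarrow> 'k poly3 set" where
  "reduce f a = PIdl\<^bsub>poly_ring\<^esub> f +>\<^bsub>poly_ring\<^esub> a"

text \<open>\<open>\<mm>\<^bsup>[q]\<^esup> = (x\<^sup>q, y\<^sup>q, z\<^sup>q) R\<close>\<close>

definition frobenius_power :: "'k::field poly3 \<Rightarrow> nat \<Rightarrow> 'k poly3 set set" where
  "frobenius_power f q = Idl\<^bsub>hypersurface f\<^esub> (reduce f ` set (power_gens q))"

end

theory Submission
  imports Defs
begin

text \<open>
  Write \<open>a = (x\<^sup>q, y\<^sup>q, z\<^sup>q)\<close>, \<open>J = (a) : f\<close> and \<open>h = Pf \<phi>\<close>.  Expanding Pfaffians along two rows shows that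
  \<open>K = h S + \<psi>\<^sup>T \<phi>\<^sup>\<or> \<psi>\<close> is the Koszul matrix of \<open>a\<close>.  Lifting multiplication by \<open>f\<close> to a map from the
  resolution of \<open>P/J\<close> to the Koszul complex then gives \<open>f \<in> (a, h)\<close>, while \<open>h J \<subseteq> (a)\<close> because
  \<open>h w = - \<phi>\<^sup>\<or> \<psi> a\<close>.  Since \<open>P/J\<close> has socle degree \<open>3q - 3 - d\<close>, both facts force \<open>deg h = d\<close>, hence
  \<open>h = v f\<close>.  Compressedness makes \<open>J\<close> agree with \<open>(a)\<close> up to half the socle degree, so the \<open>w\<^sub>j\<close> have
  degree at least \<open>(3q - 1 - d)/2\<close>; as the resolution is minimal and no row of \<open>\<phi>\<close> vanishes, all entries
  of \<open>\<phi>\<close> are linear and \<open>m = 2d\<close>.  With \<open>K\<close> at hand the exactness of both complexes is linear algebra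
  over the resolution of \<open>P/J\<close> and the Koszul complex.  The regularity is well defined because two
  minimal resolutions have the same twists.
\<close>

section \<open>Pfaffians\<close>

text \<open>The parity condition closes a gap of one unit. Compressedness alone gives
  \<open>2 * deg w_j > 3 * (q - 1) - d\<close>; since \<open>q + d\<close> is odd, the next value
  \<open>3 * q - 2 - d\<close> is excluded too, so two such degrees add up to at least
  \<open>3 * q - 1 - d\<close>. The last twist of the resolution is \<open>3 * q - d\<close>, which
  is found by computing the degree of the power of the first variable as a Pfaffian. So an entry of
  \<phi> has degree at most 1, and minimality excludes nonzero constants. The ideal (a) is monomial,
  so everything about it is decided on supports: exactness of the Koszul complex is division with
  remainder, and the socle is detected by the monomial with all exponents \<open>q - 1\<close>.
  Characteristic 2 is allowed, so a Pfaffian with a repeated index cannot be shown to vanish by a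
  sign change; the two-row expansion is used as an alternating form. Exactness modulo f is stated
  over P, as congruences. The syzygies of the row (a, f) and of its syzygy matrix are computed once,
  in \<open>exact_F1\<close> and \<open>exact_F2\<close>, and serve both resolutions.\<close>

abbreviation del_nth :: "nat \<Rightarrow> 'a list \<Rightarrow> 'a list" where
  "del_nth k xs \<equiv> take k xs @ drop (Suc k) xs"

lemma nth_del_nth:
  "k < length xs \<Longrightarrow> l < length xs - 1 \<Longrightarrow>
     del_nth k xs ! l = xs ! (if l < k then l else Suc l)"
  by (auto simp: nth_append min_def)

lemma del_nth_commute:
  assumes "k \<le> l" and "Suc l < length xs"
  shows "del_nth l (del_nth k xs) = del_nth k (del_nth (Suc l) xs)"
proof -
  have "min (length xs) k = k" "min k (Suc l) = k" "min (length xs) (Suc l) = Suc l"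
    using assms by auto
  then show ?thesis
    using assms by (simp add: drop_take Suc_diff_le)
qed

lemma sum_skip:
  fixes k n :: nat
  assumes "k < n"
  shows "(\<Sum>l<n - 1. F l) = (\<Sum>l\<in>{..<n} - {k}. F (if l < k then l else l - 1))"
  using assms
  by (intro sum.reindex_bij_witness[of _ "\<lambda>l. if l < k then l else l - 1"
        "\<lambda>l. if l < k then l else Suc l"]) auto

text \<open>Skewness alone would give only that twice the sum vanishes. With a zero diagonal the
  terms (k, n) and (n, k) cancel in pairs, in every characteristic.\<close>

lemma alternating_form_zero:
  fixes u :: "nat \<Rightarrow> 'r::comm_ring_1"
  assumes "\<And>k. k < n \<Longrightarrow> B k k = 0" and "\<And>k l. k < n \<Longrightarrow> l < n \<Longrightarrow> B k l = - B l k"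
  shows "(\<Sum>k<n. \<Sum>l<n. u k * u l * B k l) = 0"
  using assms
proof (induction n)
  case 0
  show ?case by simp
next
  case (Suc n)
  have cross: "(\<Sum>k<n. u k * u n * B k n) + (\<Sum>l<n. u n * u l * B n l) = 0"
    unfolding sum.distrib[symmetric]
  proof (rule sum.neutral, rule ballI)
    fix x assume "x \<in> {..<n}"
    then have "B x n = - B n x" by (intro Suc.prems(2)) auto
    then show "u x * u n * B x n + u n * u x * B n x = 0" by (metis add.left_inverse
          mult.commute mult_minus_right)
  qed
  have "(\<Sum>k<n. \<Sum>l<n. u k * u l * B k l) = 0"
    by (rule Suc.IH; rule Suc.prems; simp)
  moreover have "B n n = 0" by (rule Suc.prems(1)) simp
  moreover have "(\<Sum>k<Suc n. \<Sum>l<Suc n. u k * u l * B k l) =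
      (\<Sum>k<n. \<Sum>l<n. u k * u l * B k l) +
      ((\<Sum>k<n. u k * u n * B k n) + (\<Sum>l<n. u n * u l * B n l)) + u n * u n * B n n"
    by (simp add: sum.distrib)
  ultimately show ?case by (simp only: cross) simp
qed

text \<open>Indexed by positions in T and extended skew-symmetrically to all k and l, so that double
  expansions run over a full square and their symmetry becomes an interchange of sums. For
  \<open>T = [0..<n]\<close> these are the entries of the Pfaffian adjoint.\<close>

definition pf_minor :: "'r::comm_ring_1 mat \<Rightarrow> nat list \<Rightarrow> nat \<Rightarrow> nat \<Rightarrow> 'r" where
  "pf_minor A T k l =
     (if k < l then (- 1) ^ (k + l) * pf A (del_nth k (del_nth l T))
      else if k = l then 0
      else (- 1) ^ (k + l + 1) * pf A (del_nth l (del_nth k T)))"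

lemma pf_minor_skew: "pf_minor A T k l = - pf_minor A T l k"
  by (simp add: pf_minor_def add.commute)

lemma pf_minor_diag [simp]: "pf_minor A T k k = 0"
  by (simp add: pf_minor_def)

text \<open>Positions beyond k move down by one when k is deleted, which changes their sign in the
  expansion. The case distinction in \<open>pf_minor\<close> absorbs exactly this change, and the
  missing position k contributes a zero term.\<close>

lemma pf_Cons_del_nth:
  assumes "k < length T"
  shows "pf A (i # del_nth k T) = (- 1) ^ Suc k * (\<Sum>l<length T. A $$ (i, T ! l) * pf_minor A T k l)"
proof -
  have "pf A (i # del_nth k T) = (\<Sum>l\<in>{..<length T} - {k}.
      (- 1) ^ (if l < k then l else l - 1) * A $$ (i, del_nth k T ! (if l < k then l else l - 1))
        * pf A (del_nth (if l < k then l else l - 1) (del_nth k T)))"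
  proof -
    have "length (del_nth k T) = length T - 1" using assms by simp
    then show ?thesis
      unfolding pf.simps by (simp only: sum_skip[OF assms])
  qed
  also have "\<dots> = (\<Sum>l\<in>{..<length T} - {k}.
      (- 1) ^ Suc k * (A $$ (i, T ! l) * pf_minor A T k l))"
  proof (rule sum.cong[OF refl])
    fix l assume l: "l \<in> {..<length T} - {k}"
    show "(- 1) ^ (if l < k then l else l - 1) * A $$ (i, del_nth k T ! (if l < k then l else l - 1))
        * pf A (del_nth (if l < k then l else l - 1) (del_nth k T))
      = (- 1) ^ Suc k * (A $$ (i, T ! l) * pf_minor A T k l)"
    proof (cases "l < k")
      case True
      have "(- 1) ^ l = (- 1) ^ Suc k * ((- 1) ^ (k + l + 1) :: 'a)"
        by (simp add: minus_one_power_iff)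
      with True show ?thesis
        using nth_del_nth[of k T l] assms by (simp add: pf_minor_def algebra_simps)
    next
      case False
      with l obtain l' where l': "l = Suc l'" "k \<le> l'" by (cases l) auto
      have "(- 1) ^ l' = (- 1) ^ Suc k * ((- 1) ^ (k + l) :: 'a)"
        by (simp add: minus_one_power_iff l'(1))
      moreover have "del_nth l' (del_nth k T) = del_nth k (del_nth l T)"
        using del_nth_commute[of k l' T] l' l by simp
      moreover have "del_nth k T ! l' = T ! l"
        using nth_del_nth[of k T l'] assms l l' by simp
      ultimately show ?thesis using l' l
        by (simp only: pf_minor_def if_P if_not_P not_less less_Suc_eq_le diff_Suc_1 not_le mult.assoc)
           (simp add: algebra_simps)
    qed
  qed
  also have "\<dots> = (- 1) ^ Suc k * (\<Sum>l<length T. A $$ (i, T ! l) * pf_minor A T k l)"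
    unfolding sum_distrib_left[symmetric] using assms
    by (subst (2) sum.remove[of _ k]) auto
  finally show ?thesis .
qed

text \<open>Expansion along two rows: after the term that pairs i with j, the signs of the two
  successive expansions cancel and a form bilinear in the rows i and j with skew coefficients
  remains. The sign rule, the vanishing for equal rows and the Koszul matrix are all read off from
  it.\<close>

lemma pf_Cons_Cons:
  "pf A (i # j # T) = A $$ (i, j) * pf A T +
     (\<Sum>k<length T. \<Sum>l<length T. A $$ (i, T ! k) * A $$ (j, T ! l) * pf_minor A T k l)"
proof -
  have "pf A (i # j # T) = A $$ (i, j) * pf A T +
     (\<Sum>k<length T. (- 1) ^ Suc k * A $$ (i, T ! k) * pf A (j # del_nth k T))"
    by (simp only: pf.simps(2)[of A i "j # T"] list.size add_Suc_right add_0_right sum.lessThan_Suc_shift) simp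
  also have "(\<Sum>k<length T. (- 1) ^ Suc k * A $$ (i, T ! k) * pf A (j # del_nth k T)) =
     (\<Sum>k<length T. \<Sum>l<length T. A $$ (i, T ! k) * A $$ (j, T ! l) * pf_minor A T k l)"
  proof (rule sum.cong[OF refl])
    fix k assume "k \<in> {..<length T}"
    moreover have "(- 1) ^ Suc k * a * ((- 1) ^ Suc k * b) = a * b" for a b :: 'a
      by (simp add: minus_one_power_iff)
    ultimately show "(- 1) ^ Suc k * A $$ (i, T ! k) * pf A (j # del_nth k T) =
        (\<Sum>l<length T. A $$ (i, T ! k) * A $$ (j, T ! l) * pf_minor A T k l)"
      by (simp only: pf_Cons_del_nth lessThan_iff sum_distrib_left mult.assoc)
  qed
  finally show ?thesis .
qed

lemma skew_symmetricD:
  assumes "skew_symmetric A" and "i < dim_row A" and "j < dim_row A"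
  shows "A $$ (i, j) = - A $$ (j, i)" and "A $$ (i, i) = 0"
  using assms unfolding skew_symmetric_def by blast+

text \<open>If the two indices come first, interchanging the sums of the two-row expansion changes
  the sign of the minors. Otherwise the expansion along the leading row reduces to shorter lists;
  the deletion may hit either side, hence the induction on the total length.\<close>

lemma pf_swap:
  assumes "skew_symmetric A" and "set (xs @ i # j # ys) \<subseteq> {..<dim_row A}"
  shows "pf A (xs @ i # j # ys) = - pf A (xs @ j # i # ys)"
  using assms(2)
proof (induction "length xs + length ys" arbitrary: xs ys rule: less_induct)
  case less
  show ?case
  proof (cases xs)
    case Nil
    have "(\<Sum>k<length ys. \<Sum>l<length ys. A $$ (i, ys ! k) * A $$ (j, ys ! l) * pf_minor A ys k l) =
      (\<Sum>k<length ys. \<Sum>l<length ys. - (A $$ (j, ys ! k) * A $$ (i, ys ! l) * pf_minor A ys k l))"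
      by (subst sum.swap, intro sum.cong refl, subst pf_minor_skew) (simp add: algebra_simps)
    then show ?thesis
      using less.prems skew_symmetricD(1)[OF assms(1), of i j]
      by (simp add: Nil pf_Cons_Cons sum_negf del: pf.simps)
  next
    case (Cons x us)
    define p where "p = length us"
    define L L' where "L = us @ i # j # ys" and "L' = us @ j # i # ys"
    \<comment> \<open>Matches the positions of L with those of L'. For the two interchanged
      positions the deleted lists coincide and only the parity of the position differs; for all
      others the entry and the parity agree and the induction hypothesis supplies the sign.\<close>
    define \<tau> where "\<tau> = (\<lambda>k. if k = p then Suc p else if k = Suc p then p else k)"
    have eq: "(- 1) ^ \<tau> k * A $$ (x, L ! \<tau> k) * pf A (del_nth (\<tau> k) L) =
        - ((- 1) ^ k * A $$ (x, L' ! k) * pf A (del_nth k L'))" if k: "k < length L'" for k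
    proof -
      consider "k < p" | "k = p" | "k = Suc p" | "k > Suc p" by linarith
      then show ?thesis
      proof cases
        case 1
        have "pf A (del_nth k us @ i # j # ys) = - pf A (del_nth k us @ j # i # ys)"
          using 1 less.prems by (intro less.hyps)
            (auto simp: Cons p_def dest: in_set_takeD in_set_dropD)
        then show ?thesis using 1 by (simp add: \<tau>_def L_def L'_def p_def nth_append)
      next
        case 2
        then show ?thesis by (simp add: \<tau>_def L_def L'_def p_def nth_append)
      next
        case 3
        then show ?thesis by (simp add: \<tau>_def L_def L'_def p_def nth_append)
      next
        case 4
        then obtain r where r: "k = Suc (Suc (p + r))"
          by (metis add_Suc less_imp_Suc_add)
        have rl: "r < length ys" using k by (simp add: r L'_def p_def)
        have "pf A (us @ i # j # del_nth r ys) = - pf A (us @ j # i # del_nth r ys)"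
          using rl less.prems by (intro less.hyps)
            (auto simp: Cons p_def dest: in_set_takeD in_set_dropD)
        moreover have "us @ a # b # del_nth r ys = del_nth k (us @ a # b # ys)" for a b
          by (simp add: r p_def numeral_3_eq_3)
        ultimately have "pf A (del_nth k L) = - pf A (del_nth k L')"
          unfolding L_def L'_def by metis
        then show ?thesis using 4 by (simp add: \<tau>_def L_def L'_def p_def nth_append)
      qed
    qed
    have "(\<Sum>k<length L'. - ((- 1) ^ k * A $$ (x, L' ! k) * pf A (del_nth k L'))) = pf A (x # L)"
      unfolding pf.simps
    proof (rule sum.reindex_bij_witness[of _ \<tau> \<tau>])
      fix k assume "k \<in> {..<length L'}"
      then show "(- 1) ^ \<tau> k * A $$ (x, L ! \<tau> k) * pf A (del_nth (\<tau> k) L) =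
          - ((- 1) ^ k * A $$ (x, L' ! k) * pf A (del_nth k L'))"
        by (intro eq) simp
    qed (auto simp: \<tau>_def L_def L'_def p_def)
    then have "pf A (x # L) = (\<Sum>k<length L'. - ((- 1) ^ k * A $$ (x, L' ! k) * pf A (del_nth k L')))"
      by (rule sym)
    also have "\<dots> = - pf A (x # L')" by (simp add: sum_negf)
    finally show ?thesis by (simp add: Cons L_def L'_def)
  qed
qed

lemma pf_move:
  assumes "skew_symmetric A" and "set (us @ xs @ i # ys) \<subseteq> {..<dim_row A}"
  shows "pf A (us @ xs @ i # ys) = (- 1) ^ length xs * pf A (us @ i # xs @ ys)"
  using assms(2)
proof (induction xs arbitrary: us)
  case (Cons x xs)
  have "pf A ((us @ [x]) @ xs @ i # ys) = (- 1) ^ length xs * pf A ((us @ [x]) @ i # xs @ ys)"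
    by (rule Cons.IH) (use Cons.prems in auto)
  moreover have "pf A (us @ x # i # xs @ ys) = - pf A (us @ i # x # xs @ ys)"
    by (rule pf_swap[OF assms(1)]) (use Cons.prems in auto)
  ultimately show ?case by simp
qed simp

text \<open>Moving the second copy next to the first costs only a sign; then the two-row expansion
  is an alternating form in one and the same row.\<close>

lemma pf_repeat:
  assumes "skew_symmetric A" and "i \<in> set T" and "set T \<subseteq> {..<dim_row A}"
  shows "pf A (i # T) = 0"
proof -
  obtain xs ys where T: "T = xs @ i # ys" using assms(2) by (meson split_list)
  have "pf A ([i] @ xs @ i # ys) = (- 1) ^ length xs * pf A ([i] @ i # xs @ ys)"
    by (rule pf_move) (use assms T in auto)
  moreover have "pf A (i # i # zs) = 0" for zs
  proof -
    have "(\<Sum>k<length zs. \<Sum>l<length zs. A $$ (i, zs ! k) * A $$ (i, zs ! l) * pf_minor A zs k l) = 0"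
      by (rule alternating_form_zero) (auto intro: pf_minor_skew)
    moreover have "A $$ (i, i) = 0"
      using assms(2,3) skew_symmetricD(2)[OF assms(1)] by auto
    ultimately show ?thesis by (simp only: pf_Cons_Cons) simp
  qed
  ultimately show ?thesis by (simp add: T del: pf.simps)
qed

lemma upt_split:
  assumes "i \<le> j" and "j < n"
  shows "[i..<n] = [i..<j] @ j # [Suc j..<n]"
  using upt_add_eq_append[OF assms(1), of "n - j"] assms by (simp add: upt_conv_Cons)

lemma filter_upt_del_nth:
  assumes "k < l" and "l < n"
  shows "filter (\<lambda>i. i \<notin> {k, l}) [0..<n] = del_nth k (del_nth l [0..<n])"
proof -
  have "[0..<n] = [0..<k] @ k # [Suc k..<l] @ l # [Suc l..<n]"
    using assms upt_split[of 0 k n] upt_split[of "Suc k" l n] by simp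
  then have "filter (\<lambda>i. i \<notin> {k, l}) [0..<n] = [0..<k] @ [Suc k..<l] @ [Suc l..<n]"
    using assms by (auto intro!: filter_True)
  also have "\<dots> = del_nth k (del_nth l [0..<n])" using assms by simp
  finally show ?thesis .
qed

lemma pf_adjoint_dim [simp]:
  "dim_row (pf_adjoint A) = dim_row A" "dim_col (pf_adjoint A) = dim_row A"
  by (simp_all add: pf_adjoint_def)

lemma pf_adjoint_nth:
  assumes "k < dim_row A" and "l < dim_row A"
  shows "pf_adjoint A $$ (k, l) = pf_minor A [0..<dim_row A] k l"
proof -
  have "{k, l} = {l, k}" by auto
  then show ?thesis
    using assms filter_upt_del_nth[of k l "dim_row A"] filter_upt_del_nth[of l k "dim_row A"]
    by (auto simp: pf_adjoint_def pf_minor_def pf_del_def)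
qed

lemma pfaffian_eq_pf: "pfaffian A = pf A [0..<dim_row A]"
  by (simp add: pfaffian_def pf_del_def)

text \<open>Cramer's rule for Pfaffians: up to sign the (i, j) entry is the Pfaffian on i followed
  by all indices except j. An index repeats unless \<open>i = j\<close>, and in that case moving j
  back to its place restores the sorted list.\<close>

lemma mult_pf_adjoint:
  assumes A: "A \<in> carrier_mat n n" and sk: "skew_symmetric A"
  shows "A * pf_adjoint A = pfaffian A \<cdot>\<^sub>m 1\<^sub>m n"
proof (rule eq_matI)
  fix i j assume "i < dim_row (pfaffian A \<cdot>\<^sub>m 1\<^sub>m n)" "j < dim_col (pfaffian A \<cdot>\<^sub>m 1\<^sub>m n)"
  then have ij: "i < n" "j < n" by auto
  have nn: "dim_row A = n" "dim_col A = n" using A by auto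
  let ?T = "[0..<n]"
  have "(A * pf_adjoint A) $$ (i, j) = (\<Sum>l<n. A $$ (i, l) * pf_adjoint A $$ (l, j))"
    using ij nn by (auto simp: scalar_prod_def lessThan_atLeast0 intro!: sum.cong)
  also have "\<dots> = - (\<Sum>l<n. A $$ (i, ?T ! l) * pf_minor A ?T j l)"
  proof -
    have "A $$ (i, l) * pf_adjoint A $$ (l, j) = - (A $$ (i, ?T ! l) * pf_minor A ?T j l)"
      if "l < n" for l
    proof -
      have "pf_adjoint A $$ (l, j) = - pf_minor A ?T j l"
        using pf_adjoint_nth[of l A j] that ij nn pf_minor_skew[of A ?T l j] by simp
      then show ?thesis using that by simp
    qed
    then show ?thesis by (simp add: sum_negf)
  qed
  also have "\<dots> = (- 1) ^ j * pf A (i # del_nth j ?T)"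
  proof -
    have "pf A (i # del_nth j ?T) = (- 1) ^ Suc j * (\<Sum>l<n. A $$ (i, ?T ! l) * pf_minor A ?T j l)"
      using pf_Cons_del_nth[of j ?T A i] ij by simp
    moreover have "(- 1) ^ j * ((- 1) ^ Suc j * b) = - b" for b :: 'a
      by (simp add: minus_one_power_iff)
    ultimately show ?thesis by metis
  qed
  also have "\<dots> = (pfaffian A \<cdot>\<^sub>m 1\<^sub>m n) $$ (i, j)"
  proof (cases "i = j")
    case True
    have T: "[0..<n] = [] @ [0..<j] @ j # [Suc j..<n]" 
      using upt_split[of 0 j n] ij by simp
    have "pf A ([] @ [0..<j] @ j # [Suc j..<n]) = (- 1) ^ length [0..<j] * pf A ([] @ j # [0..<j] @ [Suc j..<n])"
      by (rule pf_move[OF sk]) (use ij nn in auto)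
    then have "pf A [0..<n] = (- 1) ^ j * pf A (j # del_nth j ?T)"
      using T ij by simp
    then show ?thesis using True ij nn by (simp add: pfaffian_eq_pf)
  next
    case False
    have "pf A (i # del_nth j ?T) = 0"
      by (rule pf_repeat[OF sk]) (use ij nn False in auto)
    then show ?thesis using False ij by simp
  qed
  finally show "(A * pf_adjoint A) $$ (i, j) = (pfaffian A \<cdot>\<^sub>m 1\<^sub>m n) $$ (i, j)" .
qed (use A in auto)

lemma transpose_pf_adjoint: "transpose_mat (pf_adjoint A) = - pf_adjoint A"
  by (rule eq_matI) (auto simp: pf_adjoint_def add.commute insert_commute)

lemma skew_symmetric_transpose: "skew_symmetric A \<Longrightarrow> transpose_mat A = - A"
proof (rule eq_matI)
  assume sk: "skew_symmetric A"
  then have n: "dim_row A = dim_col A" by (simp add: skew_symmetric_def)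
  then show "dim_row (transpose_mat A) = dim_row (- A)" "dim_col (transpose_mat A) = dim_col (- A)"
    by auto
  fix i j assume ij: "i < dim_row (- A)" "j < dim_col (- A)"
  then have "A $$ (j, i) = - A $$ (i, j)" using n by (intro skew_symmetricD(1)[OF sk]) auto
  then show "transpose_mat A $$ (i, j) = (- A) $$ (i, j)" using ij n by simp
qed

lemma pf_adjoint_mult:
  assumes A: "A \<in> carrier_mat n n" and sk: "skew_symmetric A"
  shows "pf_adjoint A * A = pfaffian A \<cdot>\<^sub>m 1\<^sub>m n"
proof -
  have B: "pf_adjoint A \<in> carrier_mat n n" using A by (intro carrier_matI) auto
  have "transpose_mat (pf_adjoint A * A) = (- A) * (- pf_adjoint A)"
    by (simp only: transpose_mult[OF B A] transpose_pf_adjoint skew_symmetric_transpose[OF sk])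
  also have "\<dots> = - (- (A * pf_adjoint A))"
    by (metis A B carrier_matD index_uminus_mat(2) uminus_mult_left_mat uminus_mult_right_mat)
  also have "\<dots> = pfaffian A \<cdot>\<^sub>m 1\<^sub>m n"
    by (simp add: mult_pf_adjoint[OF A sk])
  also have "\<dots> = transpose_mat (pfaffian A \<cdot>\<^sub>m 1\<^sub>m n)" by (rule eq_matI) auto
  finally show ?thesis by (simp only: transpose_mat_eq)
qed

text \<open>Lets Pfaffians of the block \<phi> be read as Pfaffians of X on the indices from 3
  on.\<close>

lemma pf_relabel:
  assumes "\<And>i j. i \<in> set is \<Longrightarrow> j \<in> set is \<Longrightarrow> A $$ (f i, f j) = B $$ (i, j)"
  shows "pf A (map f is) = pf B is"
  using assms
proof (induction "length is" arbitrary: "is" rule: less_induct)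
  case less
  show ?case
  proof (cases "is")
    case (Cons i xs)
    have "pf A (map f (del_nth k xs)) = pf B (del_nth k xs)" if "k < length xs" for k
      using that by (intro less.hyps less.prems)
        (auto simp: Cons dest: in_set_takeD in_set_dropD)
    then show ?thesis using less.prems
      by (auto simp: Cons take_map drop_map intro!: sum.cong)
  qed simp
qed

lemma pf_odd: "odd (length is) \<Longrightarrow> pf A is = 0"
proof (induction "length is" arbitrary: "is" rule: less_induct)
  case less
  then show ?case
  proof (cases "is")
    case (Cons i xs)
    have "pf A (del_nth k xs) = 0" if "k < length xs" for k
      using that less.prems by (intro less.hyps) (auto simp: Cons)
    then show ?thesis by (simp add: Cons)
  qed simp
qed

section \<open>Polynomials in three variables\<close>

lemma three_cases: "(v::3) = 0 \<or> v = 1 \<or> v = 2"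
proof (induct v)
  case (of_int z)
  then have "0 \<le> z" and "z < 3" by simp_all
  then have "z = 0 \<or> z = 1 \<or> z = 2" by arith
  then show ?case by auto
qed

lemma UNIV_three: "(UNIV :: 3 set) = {0, 1, 2}"
  using three_cases by auto

lemma three_distinct: "(0::3) \<noteq> 1" "(0::3) \<noteq> 2" "(1::3) \<noteq> 2" "(1::3) \<noteq> 0" "(2::3) \<noteq> 0" "(2::3) \<noteq> 1"
proof -
  have "card (UNIV :: 3 set) = 3" by simp
  then have c: "card {0, 1, 2 :: 3} = 3" by (simp only: UNIV_three)
  have "card {a, b, c} = 3 \<Longrightarrow> a \<noteq> b \<and> a \<noteq> c \<and> b \<noteq> c" for a b c :: 'x
    by (auto simp: card_insert_if split: if_splits)
  note this[OF c]
  then show "(0::3) \<noteq> 1" "(0::3) \<noteq> 2" "(1::3) \<noteq> 2" "(1::3) \<noteq> 0" "(2::3) \<noteq> 0" "(2::3) \<noteq> 1"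
    by metis+
qed

lemma sum_three: "(\<Sum>v\<in>(UNIV :: 3 set). g v) = g 0 + g 1 + (g 2 :: 'a :: comm_monoid_add)"
proof -
  have "sum g {a, b, c} = g a + g b + g c" if "a \<noteq> b" "a \<noteq> c" "b \<noteq> c" for a b c
    using that by (simp add: add.assoc)
  from this[OF three_distinct(1,2,3)] show ?thesis by (simp only: UNIV_three)
qed

lemma mon_degree_add: "mon_degree (m + n) = mon_degree m + mon_degree n"
  by (simp add: mon_degree_def lookup_add sum.distrib)

lemma mon_degree_single [simp]: "mon_degree (Poly_Mapping.single v n) = n"
  by (simp add: mon_degree_def lookup_single when_def)

lemma mon_degree_zero [simp]: "mon_degree 0 = 0"
  by (simp add: mon_degree_def)

lemma mon_degree_eq_0: "mon_degree m = 0 \<Longrightarrow> m = 0"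
  by (simp add: mon_degree_def poly_mapping_eq_iff fun_eq_iff)

lemma poly_mapping_monomials:
  "a = (\<Sum>m\<in>Poly_Mapping.keys a. Poly_Mapping.single m (Poly_Mapping.lookup a m))"
  by (rule poly_mapping_eqI)
    (auto simp: lookup_sum lookup_single when_def in_keys_iff)

text \<open>The monomial case is restricted to the support of the fixed \<open>a\<close>, so that
  facts about this support are available there, while the additive case ranges over arbitrary
  summands.\<close>

lemma poly_mapping_additive_induct [case_names zero single add]:
  fixes a :: "'m \<Rightarrow>\<^sub>0 'b::comm_monoid_add"
  assumes "P 0" and "\<And>m c. c \<noteq> 0 \<Longrightarrow> m \<in> Poly_Mapping.keys a \<Longrightarrow> P (Poly_Mapping.single m c)"
    and "\<And>a b. P a \<Longrightarrow> P b \<Longrightarrow> P (a + b)"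
  shows "P a"
proof -
  have "P (\<Sum>m\<in>A. Poly_Mapping.single m (Poly_Mapping.lookup a m))"
    if "finite A" "A \<subseteq> Poly_Mapping.keys a" for A
    using that by induction (auto intro!: assms simp: in_keys_iff)
  from this[of "Poly_Mapping.keys a"] show ?thesis
    by (simp flip: poly_mapping_monomials)
qed

text \<open>Projection onto the span of a set of monomials. It yields both the homogeneous
  components (\<open>hcomp\<close>) and the remainder modulo a power of a variable
  (\<open>rem_var\<close>).\<close>

definition restrict_keys :: "('m \<Rightarrow> bool) \<Rightarrow> ('m \<Rightarrow>\<^sub>0 'b::comm_monoid_add) \<Rightarrow> 'm \<Rightarrow>\<^sub>0 'b" where
  "restrict_keys Q a = (\<Sum>m\<in>{m \<in> Poly_Mapping.keys a. Q m}.
     Poly_Mapping.single m (Poly_Mapping.lookup a m))"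

lemma lookup_restrict_keys:
  "Poly_Mapping.lookup (restrict_keys Q a) m = (if Q m then Poly_Mapping.lookup a m else 0)"
  by (auto simp: restrict_keys_def lookup_sum lookup_single when_def in_keys_iff)

lemma restrict_keys_add: "restrict_keys Q (a + b) = restrict_keys Q a + restrict_keys Q b"
  by (rule poly_mapping_eqI) (simp add: lookup_restrict_keys lookup_add)

lemma restrict_keys_zero [simp]: "restrict_keys Q 0 = 0"
  by (rule poly_mapping_eqI) (simp add: lookup_restrict_keys)

lemma restrict_keys_sum: "restrict_keys Q (\<Sum>i\<in>A. g i) = (\<Sum>i\<in>A. restrict_keys Q (g i))"
  by (induction A rule: infinite_finite_induct) (auto simp: restrict_keys_add)

lemma restrict_keys_single:
  "restrict_keys Q (Poly_Mapping.single m c) = (if Q m then Poly_Mapping.single m c else 0)"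
  by (rule poly_mapping_eqI) (auto simp: lookup_restrict_keys lookup_single when_def)

lemma keys_restrict_keys: "Poly_Mapping.keys (restrict_keys Q a) = {m \<in> Poly_Mapping.keys a. Q m}"
  by (auto simp: in_keys_iff lookup_restrict_keys split: if_splits)

lemma restrict_keys_split:
  fixes a :: "'m \<Rightarrow>\<^sub>0 'b::ab_group_add"
  shows "a = restrict_keys Q a + restrict_keys (\<lambda>m. \<not> Q m) a"
  by (rule poly_mapping_eqI) (auto simp: lookup_restrict_keys lookup_add)

lemma restrict_keys_eqI:
  "(\<And>m. m \<in> Poly_Mapping.keys a \<Longrightarrow> Q m) \<Longrightarrow> restrict_keys Q a = a"
  by (rule poly_mapping_eqI) (auto simp: lookup_restrict_keys in_keys_iff)

text \<open>For a monomial m of a, either all or none of the monomials of its product with b satisfy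
  Q, as decided by Q'. It is applied to homogeneous b, which shifts degrees, and to powers of a
  variable.\<close>

lemma restrict_keys_mult:
  fixes a :: "'m::comm_monoid_add \<Rightarrow>\<^sub>0 'b::comm_ring_1"
  assumes "\<And>m n. n \<in> Poly_Mapping.keys b \<Longrightarrow> Q (m + n) = Q' m"
  shows "restrict_keys Q (a * b) = restrict_keys Q' a * b"
proof (induction a rule: poly_mapping_additive_induct)
  case (single m c)
  show ?case
  proof (cases "Q' m")
    case True
    have "Q n" if n: "n \<in> Poly_Mapping.keys (Poly_Mapping.single m c * b)" for n
    proof -
      obtain m' n' where "n = m' + n'" "m' \<in> Poly_Mapping.keys (Poly_Mapping.single m c)"
          "n' \<in> Poly_Mapping.keys b"
        using subsetD[OF keys_mult n] by auto
      then show ?thesis using assms True by (auto split: if_splits)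
    qed
    with True show ?thesis by (simp add: restrict_keys_eqI restrict_keys_single)
  next
    case False
    have "\<not> Q n" if n: "n \<in> Poly_Mapping.keys (Poly_Mapping.single m c * b)" for n
    proof -
      obtain m' n' where "n = m' + n'" "m' \<in> Poly_Mapping.keys (Poly_Mapping.single m c)"
          "n' \<in> Poly_Mapping.keys b"
        using subsetD[OF keys_mult n] by auto
      then show ?thesis using assms False by (auto split: if_splits)
    qed
    then have "restrict_keys Q (Poly_Mapping.single m c * b) = 0"
      by (intro poly_mapping_eqI) (auto simp: lookup_restrict_keys in_keys_iff)
    then show ?thesis using False by (simp add: restrict_keys_single)
  qed
qed (simp_all add: restrict_keys_add distrib_right)

section \<open>Homogeneous polynomials and homogeneous components\<close>

lemma homogI: "(\<And>m. m \<in> Poly_Mapping.keys a \<Longrightarrow> int (mon_degree m) = i) \<Longrightarrow> a \<in> homog i"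
  by (simp add: homog_def)

lemma homogD: "a \<in> homog i \<Longrightarrow> m \<in> Poly_Mapping.keys a \<Longrightarrow> int (mon_degree m) = i"
  by (simp add: homog_def)

lemma homog_zero [simp]: "0 \<in> homog i"
  by (simp add: homog_def)

lemma homog_add: "a \<in> homog i \<Longrightarrow> b \<in> homog i \<Longrightarrow> a + b \<in> homog i"
  unfolding homog_def using keys_add[of a b] by blast

lemma homog_uminus: "a \<in> homog i \<Longrightarrow> - a \<in> homog i"
  by (simp add: homog_def in_keys_iff)

lemma homog_uminus_iff [simp]: "- a \<in> homog i \<longleftrightarrow> a \<in> homog i"
  using homog_uminus[of a] homog_uminus[of "- a"] by auto

lemma homog_minus: "a \<in> homog i \<Longrightarrow> b \<in> homog i \<Longrightarrow> a - b \<in> homog i"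
  using homog_add[of a i "- b"] by simp

lemma homog_mult: "a \<in> homog i \<Longrightarrow> b \<in> homog j \<Longrightarrow> a * b \<in> homog (i + j)"
  unfolding homog_def using keys_mult[of a b] by (fastforce simp: mon_degree_add)

lemma homog_sum: "(\<And>x. x \<in> A \<Longrightarrow> g x \<in> homog i) \<Longrightarrow> sum g A \<in> homog i"
  by (induction A rule: infinite_finite_induct) (auto intro: homog_add)

lemma homog_const [simp]: "const c \<in> homog 0"
  by (auto simp: homog_def const_def split: if_splits)

lemma homog_one [simp]: "1 \<in> homog 0"
  using homog_const[of 1] by (simp add: const_def)

lemma homog_sign [simp]: "(- 1) ^ n \<in> homog 0"
  by (induction n) (auto intro: homog_uminus)

lemma homog_unique: "a \<noteq> 0 \<Longrightarrow> a \<in> homog i \<Longrightarrow> a \<in> homog j \<Longrightarrow> i = j"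
  using keys_eq_empty[of a] homogD[of a] by (metis all_not_in_conv)

lemma homog_nonneg: "a \<noteq> 0 \<Longrightarrow> a \<in> homog i \<Longrightarrow> 0 \<le> i"
  using keys_eq_empty[of a] homogD[of a i] by (metis all_not_in_conv of_nat_0_le_iff)

lemma homog_0_const: "a \<in> homog 0 \<Longrightarrow> \<exists>c. a = const c"
proof -
  assume "a \<in> homog 0"
  then have "m = 0" if "m \<in> Poly_Mapping.keys a" for m
    using that homogD[of a 0 m] mon_degree_eq_0 by simp
  then have "a = const (Poly_Mapping.lookup a 0)"
    by (intro poly_mapping_eqI) (auto simp: const_def lookup_single when_def in_keys_iff)
  then show ?thesis ..
qed

lemma const_mult: "const c * const c' = const (c * c')"
  by (simp add: const_def mult_single)

lemma const_one: "const 1 = 1"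
  by (simp add: const_def)

lemma const_zero: "const 0 = 0"
  by (simp add: const_def)

lemma const_add: "const (a + b) = const a + const b"
  by (simp add: const_def single_add)

lemma lookup_const_mult: "Poly_Mapping.lookup (const c * a) m = c * Poly_Mapping.lookup a m"
proof (induction a rule: poly_mapping_additive_induct)
  case (single n e)
  then show ?case by (simp add: const_def mult_single lookup_single when_def)
qed (simp_all add: distrib_left lookup_add)

lemma const_eq_0_iff [simp]: "const c = 0 \<longleftrightarrow> c = 0"
  by (metis const_def lookup_single_eq lookup_zero single_zero)

definition hcomp :: "int \<Rightarrow> 'k::field poly3 \<Rightarrow> 'k poly3" where
  "hcomp i = restrict_keys (\<lambda>m. int (mon_degree m) = i)"

lemma hcomp_homog [simp]: "hcomp i a \<in> homog i"
  by (auto simp: hcomp_def homog_def keys_restrict_keys)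

lemma hcomp_id: "a \<in> homog i \<Longrightarrow> hcomp i a = a"
  by (auto simp: hcomp_def homog_def intro: restrict_keys_eqI)

lemma hcomp_add: "hcomp i (a + b) = hcomp i a + hcomp i b"
  by (simp add: hcomp_def restrict_keys_add)

lemma hcomp_sum: "hcomp i (sum g A) = (\<Sum>x\<in>A. hcomp i (g x))"
  by (simp add: hcomp_def restrict_keys_sum)

lemma hcomp_mult: "b \<in> homog j \<Longrightarrow> hcomp i (a * b) = hcomp (i - j) a * b"
  unfolding hcomp_def by (rule restrict_keys_mult) (auto simp: homog_def mon_degree_add)

subsection \<open>Ideals\<close>

lemma ideal_poly_ringI:
  fixes I :: "'r::comm_ring_1 set"
  assumes "0 \<in> I" and "\<And>a b. a \<in> I \<Longrightarrow> b \<in> I \<Longrightarrow> a + b \<in> I" and "\<And>a r. a \<in> I \<Longrightarrow> r * a \<in> I"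
  shows "ideal I class_ring"
proof (rule idealI[OF class_ring.ring_axioms])
  show "subgroup I (add_monoid class_ring)"
  proof (rule group.subgroupI)
    show "group (add_monoid (class_ring :: 'r ring))" using class_ring.a_group by simp
    fix a assume "a \<in> I"
    moreover have "inv\<^bsub>add_monoid (class_ring :: 'r ring)\<^esub> a = - a"
      using fun_cong[OF class_ring_simps(8), of a] by (simp add: a_inv_def)
    ultimately show "inv\<^bsub>add_monoid (class_ring :: 'r ring)\<^esub> a \<in> I"
      using assms(3)[of a "- 1"] by simp
  qed (use assms in auto)
qed (use assms in \<open>auto simp: mult.commute\<close>)

lemma ideal_class_ringD:
  assumes "ideal I (class_ring :: 'r::comm_ring_1 ring)"
  shows "0 \<in> I" and "\<And>a b. a \<in> I \<Longrightarrow> b \<in> I \<Longrightarrow> a + b \<in> I" and "\<And>a r. a \<in> I \<Longrightarrow> r * a \<in> I"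
    and "\<And>a r. a \<in> I \<Longrightarrow> a * r \<in> I" and "\<And>a. a \<in> I \<Longrightarrow> - a \<in> I"
    and "\<And>a b. a \<in> I \<Longrightarrow> b \<in> I \<Longrightarrow> a - b \<in> I"
    and "\<And>g (A :: 'x set). (\<And>x. x \<in> A \<Longrightarrow> g x \<in> I) \<Longrightarrow> sum g A \<in> I"
proof -
  interpret ideal I "class_ring :: 'r ring" by fact
  show z: "0 \<in> I" using additive_subgroup.zero_closed[OF is_additive_subgroup] by simp
  show a: "\<And>a b. a \<in> I \<Longrightarrow> b \<in> I \<Longrightarrow> a + b \<in> I" using a_closed by simp
  show m: "\<And>a r. a \<in> I \<Longrightarrow> r * a \<in> I" using I_l_closed by simp
  then show "\<And>a r. a \<in> I \<Longrightarrow> a * r \<in> I" by (simp add: mult.commute)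
  show n: "\<And>a. a \<in> I \<Longrightarrow> - a \<in> I" using m[of _ "- 1"] by simp
  show "\<And>a b. a \<in> I \<Longrightarrow> b \<in> I \<Longrightarrow> a - b \<in> I" using a n by (metis diff_conv_add_uminus)
  show "sum g A \<in> I" if "\<And>x. x \<in> A \<Longrightarrow> g x \<in> I" for g and A :: "'x set"
    using that by (induction A rule: infinite_finite_induct) (auto intro: z a)
qed

lemma ideal_Idl: "ideal (Idl\<^bsub>class_ring\<^esub> S) (class_ring :: 'r::comm_ring_1 ring)"
  by (rule ring.genideal_ideal[OF class_ring.ring_axioms]) simp

lemma Idl_superset: "S \<subseteq> Idl\<^bsub>(class_ring :: 'r::comm_ring_1 ring)\<^esub> S"
  by (rule ring.genideal_self[OF class_ring.ring_axioms]) simp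

lemma Idl_least:
  "ideal I (class_ring :: 'r::comm_ring_1 ring) \<Longrightarrow> S \<subseteq> I \<Longrightarrow> Idl\<^bsub>class_ring\<^esub> S \<subseteq> I"
  by (rule ring.genideal_minimal[OF class_ring.ring_axioms])

lemma Idl_list:
  fixes gs :: "'r::comm_ring_1 list"
  shows "Idl\<^bsub>class_ring\<^esub> (set gs) = {\<Sum>i<length gs. r i * gs ! i | r. True}" (is "?L = ?R")
proof
  show "?L \<subseteq> ?R"
  proof (rule Idl_least)
    show "ideal ?R class_ring"
    proof (rule ideal_poly_ringI)
      show "0 \<in> ?R" by (auto intro: exI[of _ "\<lambda>_. 0"])
    next
      fix a b assume "a \<in> ?R" "b \<in> ?R"
      then obtain r r' where "a = (\<Sum>i<length gs. r i * gs ! i)" "b = (\<Sum>i<length gs. r' i * gs ! i)"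
        by auto
      then have "a + b = (\<Sum>i<length gs. (r i + r' i) * gs ! i)"
        by (simp add: sum.distrib distrib_right)
      then show "a + b \<in> ?R" by (auto intro!: exI[of _ "\<lambda>i. r i + r' i"])
    next
      fix a t assume "a \<in> ?R"
      then obtain r where "a = (\<Sum>i<length gs. r i * gs ! i)" by auto
      then have "t * a = (\<Sum>i<length gs. (t * r i) * gs ! i)"
        by (simp add: sum_distrib_left mult.assoc)
      then show "t * a \<in> ?R" by (auto intro!: exI[of _ "\<lambda>i. t * r i"])
    qed
    show "set gs \<subseteq> ?R"
    proof
      fix g assume "g \<in> set gs"
      then obtain j where j: "j < length gs" "g = gs ! j" by (auto simp: in_set_conv_nth)
      have "(\<Sum>i<length gs. (if i = j then 1 else 0) * gs ! i) = (\<Sum>i<length gs. if i = j then gs ! i else 0)"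
        by (rule sum.cong) auto
      also have "\<dots> = g" using j by simp
      finally show "g \<in> ?R" by (auto intro!: exI[of _ "\<lambda>i. if i = j then 1 else 0"])
    qed
  qed
  show "?R \<subseteq> ?L"
  proof
    fix x assume "x \<in> ?R"
    then obtain r where x: "x = (\<Sum>i<length gs. r i * gs ! i)" by blast
    show "x \<in> ?L" unfolding x
      by (intro ideal_class_ringD(3,7)[OF ideal_Idl] subsetD[OF Idl_superset]) simp
  qed
qed

lemma PIdl_iff: "a \<in> PIdl\<^bsub>class_ring\<^esub> f \<longleftrightarrow> (\<exists>r. a = r * (f :: 'r::comm_ring_1))"
  by (auto simp: cgenideal_def)

subsection \<open>The ideal of \<open>q\<close>-th powers of the variables\<close>

lemma Var_power: "Var v ^ n = Poly_Mapping.single (Poly_Mapping.single v n) 1"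
  by (induction n) (simp_all add: Var_def mult_single flip: single_add)

lemma Var_power_homog: "Var v ^ n \<in> homog (int n)"
  by (auto simp: Var_power homog_def)

lemma Var_power_nonzero [simp]: "Var v ^ n \<noteq> 0"
  by (metis Var_power lookup_single_eq lookup_zero zero_neq_one)

lemma single_divide_var:
  fixes m :: "'v \<Rightarrow>\<^sub>0 nat"
  assumes "n \<le> Poly_Mapping.lookup m v"
  shows "\<exists>m'. m = m' + Poly_Mapping.single v n"
proof -
  have "m = Poly_Mapping.update v (Poly_Mapping.lookup m v - n) m + Poly_Mapping.single v n"
    using assms
    by (intro poly_mapping_eqI) (auto simp: lookup_add lookup_update lookup_single when_def)
  then show ?thesis ..
qed

lemma var_power_dvd:
  fixes a :: "'k::field poly3"
  assumes "\<And>m. m \<in> Poly_Mapping.keys a \<Longrightarrow> n \<le> Poly_Mapping.lookup m v"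
  shows "Var v ^ n dvd a"
proof (induction rule: poly_mapping_additive_induct[where a = a])
  case (single m c)
  then obtain m' where "m = m' + Poly_Mapping.single v n"
    using single_divide_var[of n m v] assms by auto
  then have "Poly_Mapping.single m c = Poly_Mapping.single m' c * Var v ^ n"
    by (simp add: Var_power mult_single)
  then show ?case by simp
qed (auto)

text \<open>Normal form modulo \<open>Var v ^ q\<close>. It annihilates multiples of this power and
  commutes with powers of the other variables, which is how syzygies of the three powers are
  computed below.\<close>

definition rem_var :: "nat \<Rightarrow> 3 \<Rightarrow> 'k::field poly3 \<Rightarrow> 'k poly3" where
  "rem_var q v = restrict_keys (\<lambda>m. Poly_Mapping.lookup m v < q)"

lemma rem_var_add: "rem_var q v (a + b) = rem_var q v a + rem_var q v b"
  by (simp add: rem_var_def restrict_keys_add)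

lemma rem_var_zero [simp]: "rem_var q v 0 = 0"
  by (simp add: rem_var_def)

lemma rem_var_decomp: "\<exists>b. a = Var v ^ q * b + rem_var q v a"
proof -
  have "Var v ^ q dvd restrict_keys (\<lambda>m. \<not> Poly_Mapping.lookup m v < q) a"
    by (rule var_power_dvd) (auto simp: keys_restrict_keys)
  then show ?thesis
    using restrict_keys_split[of a "\<lambda>m. Poly_Mapping.lookup m v < q"]
    by (metis add.commute dvdE rem_var_def)
qed

lemma rem_var_mult_same [simp]: "rem_var q v (Var v ^ q * a) = 0"
proof -
  have "rem_var q v (a * Var v ^ q) = restrict_keys (\<lambda>_. False) a * Var v ^ q"
    unfolding rem_var_def by (rule restrict_keys_mult) (auto simp: Var_power lookup_add)
  then show ?thesis
    by (simp add: restrict_keys_def mult.commute)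
qed

lemma rem_var_mult_other [simp]: "u \<noteq> v \<Longrightarrow> rem_var q v (Var u ^ n * a) = Var u ^ n * rem_var q v a"
proof -
  assume "u \<noteq> v"
  then have "rem_var q v (a * Var u ^ n) = rem_var q v a * Var u ^ n"
    unfolding rem_var_def by (intro restrict_keys_mult) (auto simp: Var_power lookup_add lookup_single)
  then show ?thesis by (simp add: mult.commute)
qed

abbreviation power_ideal :: "nat \<Rightarrow> 'k::field poly3 set" where
  "power_ideal q \<equiv> Idl\<^bsub>poly_ring\<^esub> (set (power_gens q))"

text \<open>The ideal is generated by monomials, so membership is a condition on each monomial of
  the support separately.\<close>

lemma power_ideal_keys:
  "power_ideal q = {a. \<forall>m\<in>Poly_Mapping.keys a. \<exists>v. q \<le> Poly_Mapping.lookup m v}" (is "_ = ?R")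
proof
  have "ideal ?R poly_ring"
  proof (rule ideal_poly_ringI)
    fix a b :: "'a poly3" assume "a \<in> ?R" "b \<in> ?R"
    then show "a + b \<in> ?R" using keys_add[of a b] by blast
  next
    fix a r :: "'a poly3" assume a: "a \<in> ?R"
    have "\<exists>v. q \<le> Poly_Mapping.lookup m v" if m: "m \<in> Poly_Mapping.keys (r * a)" for m
    proof -
      obtain n n' where n: "m = n + n'" "n' \<in> Poly_Mapping.keys a"
        using subsetD[OF keys_mult m] by auto
      with a obtain v where "q \<le> Poly_Mapping.lookup n' v" by auto
      then show ?thesis by (auto simp: n lookup_add intro: trans_le_add2)
    qed
    then show "r * a \<in> ?R" by simp
  qed simp
  moreover have "set (power_gens q) \<subseteq> ?R"
    by (auto simp: power_gens_def Var_power lookup_single when_def)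
  ultimately show "power_ideal q \<subseteq> ?R" by (rule Idl_least)
  show "?R \<subseteq> power_ideal q"
  proof
    fix a :: "'a poly3" assume a: "a \<in> ?R"
    show "a \<in> power_ideal q"
    proof (induction rule: poly_mapping_additive_induct[where a = a])
      case (single m c)
      with a obtain v where "q \<le> Poly_Mapping.lookup m v" by auto
      then have "Var v ^ q dvd Poly_Mapping.single m c"
        using single(1) by (intro var_power_dvd) auto
      moreover have "Var v ^ q \<in> set (power_gens q)"
        using three_cases[of v] by (auto simp: power_gens_def)
      ultimately show ?case
        by (metis dvdE ideal_class_ringD(4)[OF ideal_Idl] subsetD[OF Idl_superset])
    next
      case zero
      show ?case by (rule ideal_class_ringD(1)[OF ideal_Idl])
    next
      case (add a b)
      then show ?case by (rule ideal_class_ringD(2)[OF ideal_Idl])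
    qed
  qed
qed

section \<open>Links of Pfaffian ideals\<close>

lemma smult_mat_mult_vec:
  fixes A :: "'r::comm_ring_1 mat"
  assumes "A \<in> carrier_mat nr nc" and "v \<in> carrier_vec nc"
  shows "(k \<cdot>\<^sub>m A) *\<^sub>v v = k \<cdot>\<^sub>v (A *\<^sub>v v)"
  using assms by (intro eq_vecI) (auto simp: row_smult)

lemma mult_mat_smult_vec:
  fixes A :: "'r::comm_ring_1 mat"
  assumes "A \<in> carrier_mat nr nc" and "v \<in> carrier_vec nc"
  shows "A *\<^sub>v (k \<cdot>\<^sub>v v) = k \<cdot>\<^sub>v (A *\<^sub>v v)"
  using assms by (intro eq_vecI) auto

lemma mult_mat_uminus_vec:
  fixes A :: "'r::comm_ring_1 mat"
  assumes "A \<in> carrier_mat nr nc" and "v \<in> carrier_vec nc"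
  shows "A *\<^sub>v (- v) = - (A *\<^sub>v v)"
  using assms by (intro eq_vecI) auto

lemma less_three: "i < (3::nat) \<longleftrightarrow> i = 0 \<or> i = 1 \<or> i = 2"
  by auto

lemma sum_upto_three: "(\<Sum>i<(3::nat). g i) = g 0 + g 1 + (g 2 :: 'a :: comm_monoid_add)"
  by (simp add: eval_nat_numeral)

lemma scalar_prod_three:
  "y \<in> carrier_vec 3 \<Longrightarrow> x \<bullet> y = x $ 0 * y $ 0 + x $ 1 * y $ 1 + x $ 2 * y $ (2::nat)"
  by (simp add: scalar_prod_def lessThan_atLeast0[symmetric] sum_upto_three)

lemma mult_mat_vec_nth:
  "A \<in> carrier_mat nr nc \<Longrightarrow> v \<in> carrier_vec nc \<Longrightarrow> i < nr \<Longrightarrow>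
     (A *\<^sub>v v) $ i = (\<Sum>j<nc. A $$ (i, j) * v $ j)"
  by (auto simp: scalar_prod_def lessThan_atLeast0 intro!: sum.cong)

text \<open>Multiplication by the matrix \<open>K\<close> with rows \<open>(0, a\<^sub>2, -a\<^sub>1)\<close>, \<open>(-a\<^sub>2, 0, a\<^sub>0)\<close>, \<open>(a\<^sub>1, -a\<^sub>0, 0)\<close>,
  the second differential of the Koszul complex of \<open>a\<close>.\<close>

definition koszul :: "'r::comm_ring_1 vec \<Rightarrow> 'r vec \<Rightarrow> 'r vec" where
  "koszul a x = vec 3 (\<lambda>i. if i = 0 then a $ 2 * x $ 1 - a $ 1 * x $ 2
     else if i = 1 then a $ 0 * x $ 2 - a $ 2 * x $ 0 else a $ 1 * x $ 0 - a $ 0 * x $ 1)"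

lemma koszul_carrier [simp]: "koszul a x \<in> carrier_vec 3" "dim_vec (koszul a x) = 3"
  by (simp_all add: koszul_def)

lemma koszul_nth [simp]:
  "koszul a x $ 0 = a $ 2 * x $ 1 - a $ 1 * x $ 2"
  "koszul a x $ 1 = a $ 0 * x $ 2 - a $ 2 * x $ 0"
  "koszul a x $ Suc 0 = a $ 0 * x $ 2 - a $ 2 * x $ 0"
  "koszul a x $ 2 = a $ 1 * x $ 0 - a $ 0 * x $ 1"
  by (simp_all add: koszul_def)

lemma eq_vec_threeI:
  fixes x y :: "'r vec"
  assumes "x \<in> carrier_vec 3" "y \<in> carrier_vec 3" "x $ 0 = y $ 0" "x $ 1 = y $ 1" "x $ 2 = y $ (2::nat)"
  shows "x = y"
  using assms by (intro eq_vecI) (auto simp: less_three)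

lemma koszul_add: "x \<in> carrier_vec 3 \<Longrightarrow> y \<in> carrier_vec 3 \<Longrightarrow> koszul a (x + y) = koszul a x + koszul a y"
  by (rule eq_vec_threeI) (simp_all add: algebra_simps)

lemma koszul_minus: "x \<in> carrier_vec 3 \<Longrightarrow> y \<in> carrier_vec 3 \<Longrightarrow> koszul a (x - y) = koszul a x - koszul a y"
  by (rule eq_vec_threeI) (simp_all add: algebra_simps)

lemma koszul_smult: "x \<in> carrier_vec 3 \<Longrightarrow> koszul a (k \<cdot>\<^sub>v x) = k \<cdot>\<^sub>v koszul a x"
  by (rule eq_vec_threeI) (simp_all add: algebra_simps)

lemma koszul_mult_mat:
  assumes G: "G \<in> carrier_mat 3 n" and Y: "Y \<in> carrier_mat 3 n" and u: "u \<in> carrier_vec n"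
    and eq: "\<And>j. j < n \<Longrightarrow> koszul a (col G j) = col Y j"
  shows "koszul a (G *\<^sub>v u) = Y *\<^sub>v u"
proof -
  have Yij: "Y $$ (i, j) = koszul a (col G j) $ i" if "i < 3" "j < n" for i j
    using eq[OF that(2)] that Y by (metis carrier_matD index_col)
  have *: "(Y *\<^sub>v u) $ i = (\<Sum>j<n. koszul a (col G j) $ i * u $ j)" if "i < 3" for i
    using mult_mat_vec_nth[OF Y u that] Yij[OF that] by simp
  show ?thesis
  proof (rule eq_vec_threeI)
    show "koszul a (G *\<^sub>v u) $ 0 = (Y *\<^sub>v u) $ 0" "koszul a (G *\<^sub>v u) $ 1 = (Y *\<^sub>v u) $ 1"
      "koszul a (G *\<^sub>v u) $ 2 = (Y *\<^sub>v u) $ 2"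
      using G
      by (simp_all add: * mult_mat_vec_nth[OF G u] sum_distrib_left mult.assoc left_diff_distrib
           sum_subtractf del: index_mult_mat_vec)
  qed (use Y u in auto)
qed

text \<open>Such an M is the rank-one product of the column a and the row of the coefficients
  \<rho>.\<close>

lemma mult_mat_rank_one:
  fixes M :: "'r::comm_ring_1 mat"
  assumes M: "M \<in> carrier_mat nr n" and a: "a \<in> carrier_vec nr" and u: "u \<in> carrier_vec n"
    and eq: "\<And>j. j < n \<Longrightarrow> col M j = \<rho> j \<cdot>\<^sub>v a"
  shows "M *\<^sub>v u = (vec n \<rho> \<bullet> u) \<cdot>\<^sub>v a"
proof (rule eq_vecI)
  fix i assume "i < dim_vec ((vec n \<rho> \<bullet> u) \<cdot>\<^sub>v a)"
  then have i: "i < nr" using a by simp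
  have Mij: "M $$ (i, j) = \<rho> j * a $ i" if "j < n" for j
    using eq[OF that] that i M a by (metis carrier_matD carrier_vecD index_col index_smult_vec(1))
  have "(M *\<^sub>v u) $ i = (\<Sum>j<n. \<rho> j * a $ i * u $ j)"
    using mult_mat_vec_nth[OF M u i] Mij by simp
  also have "\<dots> = (\<Sum>j<n. \<rho> j * u $ j) * a $ i"
    unfolding sum_distrib_right by (rule sum.cong) (auto simp: algebra_simps)
  also have "(\<Sum>j<n. \<rho> j * u $ j) = vec n \<rho> \<bullet> u"
    using u by (auto simp: scalar_prod_def lessThan_atLeast0 intro!: sum.cong)
  finally show "(M *\<^sub>v u) $ i = ((vec n \<rho> \<bullet> u) \<cdot>\<^sub>v a) $ i" using i a by simp
qed (use M a in auto)

lemma col_eq_mult_unit: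
  fixes A :: "'r::comm_ring_1 mat"
  assumes "A \<in> carrier_mat nr nc" and "j < nc"
  shows "col A j = A *\<^sub>v unit_vec nc j"
  using assms by (intro eq_vecI) auto

text \<open>\<open>a\<close> and \<open>w\<close> generate an ideal whose Buchsbaum--Eisenbud matrix has blocks \<open>S\<close>, \<open>-\<psi>\<^sup>T\<close>, \<open>\<psi>\<close>, \<open>\<phi>\<close>;
  \<open>h\<close> is the Pfaffian of \<open>\<phi>\<close> and \<open>\<phi>'\<close> its Pfaffian adjoint.\<close>

locale pfaffian_link =
  fixes m :: nat and a w :: "'r::idom vec" and S \<psi> \<phi> \<phi>' :: "'r mat" and h :: 'r
  assumes a [simp]: "a \<in> carrier_vec 3" and w [simp]: "w \<in> carrier_vec m"
    and S [simp]: "S \<in> carrier_mat 3 3" and \<psi> [simp]: "\<psi> \<in> carrier_mat m 3"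
    and \<phi> [simp]: "\<phi> \<in> carrier_mat m m" and \<phi>' [simp]: "\<phi>' \<in> carrier_mat m m"
    and \<phi>\<phi>': "\<phi> * \<phi>' = h \<cdot>\<^sub>m 1\<^sub>m m" and \<phi>'\<phi>: "\<phi>' * \<phi> = h \<cdot>\<^sub>m 1\<^sub>m m"
    and skew_S: "transpose_mat S = - S" and skew_\<phi>: "transpose_mat \<phi> = - \<phi>"
    and zero_a: "S *\<^sub>v a = transpose_mat \<psi> *\<^sub>v w" and zero_w: "\<psi> *\<^sub>v a = - (\<phi> *\<^sub>v w)"
    and exact: "\<And>r u. r \<in> carrier_vec 3 \<Longrightarrow> u \<in> carrier_vec m \<Longrightarrow> a \<bullet> r + w \<bullet> u = 0 \<Longrightarrow>
       \<exists>s\<in>carrier_vec 3. \<exists>t\<in>carrier_vec m.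
         r = S *\<^sub>v s - transpose_mat \<psi> *\<^sub>v t \<and> u = \<psi> *\<^sub>v s + \<phi> *\<^sub>v t"
    and koszul_eq: "\<And>x. x \<in> carrier_vec 3 \<Longrightarrow>
       koszul a x = h \<cdot>\<^sub>v (S *\<^sub>v x) + transpose_mat \<psi> *\<^sub>v (\<phi>' *\<^sub>v (\<psi> *\<^sub>v x))"
    and koszul_exact1: "\<And>r. r \<in> carrier_vec 3 \<Longrightarrow> a \<bullet> r = 0 \<Longrightarrow>
       \<exists>x\<in>carrier_vec 3. r = koszul a x"
    and koszul_exact2: "\<And>x. x \<in> carrier_vec 3 \<Longrightarrow> koszul a x = 0\<^sub>v 3 \<Longrightarrow> \<exists>g. x = g \<cdot>\<^sub>v a"
    and a_nonzero: "a $ 0 \<noteq> 0"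
begin

abbreviation \<psi>t where "\<psi>t \<equiv> transpose_mat \<psi>"

lemma \<psi>t [simp]: "\<psi>t \<in> carrier_mat 3 m" by simp

lemma mv_carrier [simp]:
  "x \<in> carrier_vec 3 \<Longrightarrow> S *\<^sub>v x \<in> carrier_vec 3"
  "x \<in> carrier_vec 3 \<Longrightarrow> \<psi> *\<^sub>v x \<in> carrier_vec m"
  "u \<in> carrier_vec m \<Longrightarrow> \<psi>t *\<^sub>v u \<in> carrier_vec 3"
  "u \<in> carrier_vec m \<Longrightarrow> \<phi> *\<^sub>v u \<in> carrier_vec m"
  "u \<in> carrier_vec m \<Longrightarrow> \<phi>' *\<^sub>v u \<in> carrier_vec m"
  using mult_mat_vec_carrier S \<psi> \<phi> \<phi>' \<psi>t by blast+

lemma dims [simp]: "dim_row S = 3" "dim_col S = 3" "dim_row \<psi> = m" "dim_col \<psi> = 3"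
  "dim_row \<phi> = m" "dim_col \<phi> = m" "dim_row \<phi>' = m" "dim_col \<phi>' = m" "dim_vec a = 3" "dim_vec w = m"
  using carrier_matD[OF S] carrier_matD[OF \<psi>] carrier_matD[OF \<phi>] carrier_matD[OF \<phi>'] by auto

lemmas lin =
  mult_add_distrib_mat_vec[OF S] mult_add_distrib_mat_vec[OF \<psi>] mult_add_distrib_mat_vec[OF \<psi>t]
  mult_add_distrib_mat_vec[OF \<phi>] mult_add_distrib_mat_vec[OF \<phi>']
  mult_minus_distrib_mat_vec[OF S] mult_minus_distrib_mat_vec[OF \<psi>] mult_minus_distrib_mat_vec[OF \<psi>t]
  mult_minus_distrib_mat_vec[OF \<phi>] mult_minus_distrib_mat_vec[OF \<phi>']
  mult_mat_smult_vec[OF S] mult_mat_smult_vec[OF \<psi>] mult_mat_smult_vec[OF \<psi>t]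
  mult_mat_smult_vec[OF \<phi>] mult_mat_smult_vec[OF \<phi>']
  mult_mat_uminus_vec[OF S] mult_mat_uminus_vec[OF \<psi>] mult_mat_uminus_vec[OF \<psi>t]
  mult_mat_uminus_vec[OF \<phi>] mult_mat_uminus_vec[OF \<phi>']

lemma \<phi>\<phi>'_vec [simp]: "u \<in> carrier_vec m \<Longrightarrow> \<phi> *\<^sub>v (\<phi>' *\<^sub>v u) = h \<cdot>\<^sub>v u"
  using assoc_mult_mat_vec[OF \<phi> \<phi>', of u] \<phi>\<phi>' smult_mat_mult_vec[OF one_carrier_mat, of u m h] by simp

lemma \<phi>'\<phi>_vec [simp]: "u \<in> carrier_vec m \<Longrightarrow> \<phi>' *\<^sub>v (\<phi> *\<^sub>v u) = h \<cdot>\<^sub>v u"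
  using assoc_mult_mat_vec[OF \<phi>' \<phi>, of u] \<phi>'\<phi> smult_mat_mult_vec[OF one_carrier_mat, of u m h] by simp

lemma scalar_S: "x \<in> carrier_vec 3 \<Longrightarrow> y \<in> carrier_vec 3 \<Longrightarrow> x \<bullet> (S *\<^sub>v y) = - ((S *\<^sub>v x) \<bullet> y)"
  using transpose_vec_mult_scalar[OF S, of y x] by (simp add: skew_S)

lemma scalar_\<phi>: "x \<in> carrier_vec m \<Longrightarrow> y \<in> carrier_vec m \<Longrightarrow> x \<bullet> (\<phi> *\<^sub>v y) = - ((\<phi> *\<^sub>v x) \<bullet> y)"
  using transpose_vec_mult_scalar[OF \<phi>, of y x] by (simp add: skew_\<phi>)

lemma scalar_\<psi>: "x \<in> carrier_vec m \<Longrightarrow> y \<in> carrier_vec 3 \<Longrightarrow> x \<bullet> (\<psi> *\<^sub>v y) = (\<psi>t *\<^sub>v x) \<bullet> y"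
  using transpose_vec_mult_scalar[OF \<psi>, of y x] by simp

lemma scalar_\<psi>t: "x \<in> carrier_vec 3 \<Longrightarrow> y \<in> carrier_vec m \<Longrightarrow> x \<bullet> (\<psi>t *\<^sub>v y) = (\<psi> *\<^sub>v x) \<bullet> y"
  using transpose_vec_mult_scalar[OF \<psi>t, of y x] by simp

text \<open>The row (a, w) times the middle matrix is zero, by transposing \<open>zero_a\<close> and
  \<open>zero_w\<close> and using skewness. This is the first block of columns;
  \<open>w_\<phi>\<close> is the second.\<close>

lemma a_S_w_\<psi>: "x \<in> carrier_vec 3 \<Longrightarrow> a \<bullet> (S *\<^sub>v x) + w \<bullet> (\<psi> *\<^sub>v x) = 0"
  by (simp add: scalar_S scalar_\<psi> zero_a)

lemma w_\<phi>: "y \<in> carrier_vec m \<Longrightarrow> w \<bullet> (\<phi> *\<^sub>v y) = a \<bullet> (\<psi>t *\<^sub>v y)"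
  by (simp add: scalar_\<phi> scalar_\<psi>t zero_w)

text \<open>Take \<open>y = \<phi>' u\<close> in \<open>w_\<phi>\<close>. The columns of \<psi>t
  \<phi>' thus express the products of h with the entries of w through a, so that h multiplies the
  ideal (a, w) into (a).\<close>

lemma a_\<psi>t_\<phi>': "u \<in> carrier_vec m \<Longrightarrow> a \<bullet> (\<psi>t *\<^sub>v (\<phi>' *\<^sub>v u)) = h * (w \<bullet> u)"
  by (simp flip: w_\<phi>)

lemma koszul_lift:
  assumes Y: "Y \<in> carrier_mat 3 n" and zero: "\<And>u. u \<in> carrier_vec n \<Longrightarrow> a \<bullet> (Y *\<^sub>v u) = 0"
  shows "\<exists>G\<in>carrier_mat 3 n. \<forall>u\<in>carrier_vec n. koszul a (G *\<^sub>v u) = Y *\<^sub>v u"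
proof -
  have "\<exists>x. x \<in> carrier_vec 3 \<and> col Y j = koszul a x" if "j < n" for j
    using koszul_exact1[of "col Y j"] zero[of "unit_vec n j"] Y that by (auto simp: col_eq_mult_unit)
  then obtain x where x: "\<And>j. j < n \<Longrightarrow> x j \<in> carrier_vec 3 \<and> col Y j = koszul a (x j)"
    by metis
  define G where "G = mat 3 n (\<lambda>(i, j). x j $ i)"
  have G: "G \<in> carrier_mat 3 n" by (simp add: G_def)
  have "col G j = x j" if "j < n" for j
    using x[OF that] that by (intro eq_vecI) (auto simp: G_def)
  then show ?thesis using koszul_mult_mat[OF G Y] x G by auto
qed

text \<open>Multiplication by \<open>g\<close> lifts to a map from the resolution of the quotient by \<open>(a, w)\<close> to the
  Koszul complex of \<open>a\<close>; composing it with the comparison map in the opposite direction gives a map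
  homotopic to \<open>g\<close>, whose last component is \<open>\<gamma>h\<close>.\<close>

lemma colon_subset:
  assumes B: "B \<in> carrier_mat 3 m" and gw: "\<And>u. u \<in> carrier_vec m \<Longrightarrow> a \<bullet> (B *\<^sub>v u) = g * (w \<bullet> u)"
  shows "\<exists>\<gamma>. \<exists>\<rho>\<in>carrier_vec 3. g = h * \<gamma> + a \<bullet> \<rho>"
proof -
  have Bv [simp]: "u \<in> carrier_vec m \<Longrightarrow> B *\<^sub>v u \<in> carrier_vec 3" for u
    using mult_mat_vec_carrier B by blast
  have [simp]: "dim_row B = 3" using B by simp
  note Blin = mult_mat_smult_vec[OF B] mult_mat_uminus_vec[OF B]
  \<comment> \<open>The first component of the lift of g sends (r, u) to \<open>g r + B u\<close>.
    Composed with the middle matrix it takes values in the syzygies of a; \<open>G1\<close> and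
    \<open>G2\<close> are the two blocks of a factorization through the Koszul map.\<close>
  have "\<exists>G\<in>carrier_mat 3 3. \<forall>x\<in>carrier_vec 3. koszul a (G *\<^sub>v x) = (g \<cdot>\<^sub>m S + B * \<psi>) *\<^sub>v x"
  proof (rule koszul_lift)
    fix x :: "'r vec" assume x [simp]: "x \<in> carrier_vec 3"
    have "(g \<cdot>\<^sub>m S + B * \<psi>) *\<^sub>v x = g \<cdot>\<^sub>v (S *\<^sub>v x) + B *\<^sub>v (\<psi> *\<^sub>v x)"
      using B by (subst add_mult_distrib_mat_vec[of _ 3 3]) (auto simp: smult_mat_mult_vec[OF S] assoc_mult_mat_vec[OF B \<psi> x])
    moreover have "a \<bullet> (S *\<^sub>v x) = - (w \<bullet> (\<psi> *\<^sub>v x))"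
      using a_S_w_\<psi>[OF x] by (simp add: eq_neg_iff_add_eq_0)
    ultimately show "a \<bullet> ((g \<cdot>\<^sub>m S + B * \<psi>) *\<^sub>v x) = 0"
      by (simp add: scalar_prod_add_distrib[of _ 3] gw)
  qed (use B in auto)
  then obtain G1 where G1: "G1 \<in> carrier_mat 3 3"
    and kG1: "\<And>x. x \<in> carrier_vec 3 \<Longrightarrow> koszul a (G1 *\<^sub>v x) = g \<cdot>\<^sub>v (S *\<^sub>v x) + B *\<^sub>v (\<psi> *\<^sub>v x)"
    using B by (auto simp: add_mult_distrib_mat_vec[of _ 3 3] smult_mat_mult_vec[OF S] assoc_mult_mat_vec[OF B \<psi>])
  have "\<exists>G\<in>carrier_mat 3 m. \<forall>y\<in>carrier_vec m. koszul a (G *\<^sub>v y) = (B * \<phi> - g \<cdot>\<^sub>m \<psi>t) *\<^sub>v y"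
  proof (rule koszul_lift)
    fix y :: "'r vec" assume y [simp]: "y \<in> carrier_vec m"
    have "(B * \<phi> - g \<cdot>\<^sub>m \<psi>t) *\<^sub>v y = B *\<^sub>v (\<phi> *\<^sub>v y) - g \<cdot>\<^sub>v (\<psi>t *\<^sub>v y)"
      using B by (subst minus_mult_distrib_mat_vec[of _ 3 m]) (auto simp: smult_mat_mult_vec[OF \<psi>t] assoc_mult_mat_vec[OF B \<phi> y])
    then show "a \<bullet> ((B * \<phi> - g \<cdot>\<^sub>m \<psi>t) *\<^sub>v y) = 0"
      by (simp add: scalar_prod_minus_distrib[of _ 3] gw w_\<phi>)
  qed (use B in auto)
  then obtain G2 where G2: "G2 \<in> carrier_mat 3 m"
    and kG2: "\<And>y. y \<in> carrier_vec m \<Longrightarrow> koszul a (G2 *\<^sub>v y) = B *\<^sub>v (\<phi> *\<^sub>v y) - g \<cdot>\<^sub>v (\<psi>t *\<^sub>v y)"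
    using B by (auto simp: minus_mult_distrib_mat_vec[of _ 3 m] smult_mat_mult_vec[OF \<psi>t] assoc_mult_mat_vec[OF B \<phi>])
  have [simp]: "x \<in> carrier_vec 3 \<Longrightarrow> G1 *\<^sub>v x \<in> carrier_vec 3"
    "y \<in> carrier_vec m \<Longrightarrow> G2 *\<^sub>v y \<in> carrier_vec 3" for x y
    using mult_mat_vec_carrier G1 G2 by blast+
  have [simp]: "dim_row G1 = 3" "dim_row G2 = 3" using G1 G2 by auto

  have "koszul a (G1 *\<^sub>v a + G2 *\<^sub>v w) = 0\<^sub>v 3"
  proof -
    have "koszul a (G1 *\<^sub>v a + G2 *\<^sub>v w) =
        g \<cdot>\<^sub>v (\<psi>t *\<^sub>v w) + - (B *\<^sub>v (\<phi> *\<^sub>v w)) + (B *\<^sub>v (\<phi> *\<^sub>v w) - g \<cdot>\<^sub>v (\<psi>t *\<^sub>v w))"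
      by (simp add: koszul_add kG1 kG2 zero_a zero_w Blin)
    also have "\<dots> = 0\<^sub>v 3"
      by (rule eq_vecI) (auto simp del: index_mult_mat_vec)
    finally show ?thesis .
  qed
  \<comment> \<open>\<gamma> is the third component of the lift, a map between modules of rank
    one.\<close>
  then obtain \<gamma> where \<gamma>: "G1 *\<^sub>v a + G2 *\<^sub>v w = \<gamma> \<cdot>\<^sub>v a"
    using koszul_exact2[of "G1 *\<^sub>v a + G2 *\<^sub>v w"] by auto

  \<comment> \<open>In the opposite direction, \<open>koszul_eq\<close> makes x \<mapsto> (h x, -
    \<phi>' \<psi> x) the second component of a comparison map that lifts the identity. M is the
    composite of both second components minus g.\<close>
  define M where "M = h \<cdot>\<^sub>m G1 - G2 * (\<phi>' * \<psi>) - g \<cdot>\<^sub>m 1\<^sub>m 3"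
  have M: "M \<in> carrier_mat 3 3" using G1 G2 by (auto simp: M_def)
  have Mv: "M *\<^sub>v x = h \<cdot>\<^sub>v (G1 *\<^sub>v x) - G2 *\<^sub>v (\<phi>' *\<^sub>v (\<psi> *\<^sub>v x)) - g \<cdot>\<^sub>v x"
    if x: "x \<in> carrier_vec 3" for x
  proof -
    have c: "h \<cdot>\<^sub>m G1 \<in> carrier_mat 3 3" "\<phi>' * \<psi> \<in> carrier_mat m 3" "G2 * (\<phi>' * \<psi>) \<in> carrier_mat 3 3"
      "g \<cdot>\<^sub>m 1\<^sub>m 3 \<in> carrier_mat 3 3" using G1 G2 by auto
    have "M *\<^sub>v x = (h \<cdot>\<^sub>m G1) *\<^sub>v x - (G2 * (\<phi>' * \<psi>)) *\<^sub>v x - (g \<cdot>\<^sub>m 1\<^sub>m 3) *\<^sub>v x"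
      unfolding M_def minus_mult_distrib_mat_vec[OF minus_carrier_mat[OF c(3)] c(4) x]
        minus_mult_distrib_mat_vec[OF c(1,3) x] ..
    then show ?thesis using c x
      by (simp add: smult_mat_mult_vec[OF G1] smult_mat_mult_vec[OF one_carrier_mat]
           assoc_mult_mat_vec[OF G2 c(2) x] assoc_mult_mat_vec[OF \<phi>' \<psi> x])
  qed
  have "koszul a (M *\<^sub>v x) = 0\<^sub>v 3" if x [simp]: "x \<in> carrier_vec 3" for x
  proof -
    have "koszul a (M *\<^sub>v x) = h \<cdot>\<^sub>v (g \<cdot>\<^sub>v (S *\<^sub>v x) + B *\<^sub>v (\<psi> *\<^sub>v x))
       - (h \<cdot>\<^sub>v (B *\<^sub>v (\<psi> *\<^sub>v x)) - g \<cdot>\<^sub>v (\<psi>t *\<^sub>v (\<phi>' *\<^sub>v (\<psi> *\<^sub>v x))))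
       - g \<cdot>\<^sub>v (h \<cdot>\<^sub>v (S *\<^sub>v x) + \<psi>t *\<^sub>v (\<phi>' *\<^sub>v (\<psi> *\<^sub>v x)))"
      by (simp add: Mv koszul_minus koszul_smult kG1 kG2 Blin flip: koszul_eq)
    also have "\<dots> = 0\<^sub>v 3"
      by (rule eq_vecI) (auto simp: algebra_simps simp del: index_mult_mat_vec)
    finally show ?thesis .
  qed
  then have "\<exists>g. col M j = g \<cdot>\<^sub>v a" if "j < 3" for j
    using koszul_exact2[of "col M j"] that M by (auto simp: col_eq_mult_unit[OF M])
  \<comment> \<open>By exactness the columns of M are multiples of a. At a itself the comparison map
    takes the value h (a, w), so M a is both (h \<gamma> - g) a and a multiple of a by an element of
    (a); one coordinate with nonzero a is enough to compare them.\<close>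
  then obtain \<rho> where \<rho>: "\<And>j. j < 3 \<Longrightarrow> col M j = \<rho> j \<cdot>\<^sub>v a" by metis
  have "h \<cdot>\<^sub>v (G1 *\<^sub>v a) - G2 *\<^sub>v (\<phi>' *\<^sub>v (\<psi> *\<^sub>v a)) - g \<cdot>\<^sub>v a = (vec 3 \<rho> \<bullet> a) \<cdot>\<^sub>v a"
    using mult_mat_rank_one[OF M a a \<rho>] by (simp add: Mv)
  moreover have "\<phi>' *\<^sub>v (\<psi> *\<^sub>v a) = - (h \<cdot>\<^sub>v w)" by (simp add: zero_w lin)
  ultimately have eq: "h \<cdot>\<^sub>v (G1 *\<^sub>v a) - - (h \<cdot>\<^sub>v (G2 *\<^sub>v w)) - g \<cdot>\<^sub>v a = (vec 3 \<rho> \<bullet> a) \<cdot>\<^sub>v a"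
    by (simp add: mult_mat_smult_vec[OF G2] mult_mat_uminus_vec[OF G2])
  have "h * (G1 *\<^sub>v a) $ 0 + h * (G2 *\<^sub>v w) $ 0 - g * a $ 0 = (vec 3 \<rho> \<bullet> a) * a $ 0"
    using arg_cong[OF eq, of "\<lambda>x. vec_index x 0"] by (simp del: index_mult_mat_vec)
  moreover have "(G1 *\<^sub>v a) $ 0 + (G2 *\<^sub>v w) $ 0 = \<gamma> * a $ 0"
    using arg_cong[OF \<gamma>, of "\<lambda>x. vec_index x 0"] by (simp del: index_mult_mat_vec)
  then have "h * (G1 *\<^sub>v a) $ 0 + h * (G2 *\<^sub>v w) $ 0 = h * \<gamma> * a $ 0"
    by (metis distrib_left mult.assoc)
  ultimately have "(h * \<gamma> - g - (vec 3 \<rho> \<bullet> a)) * a $ 0 = 0"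
    by (simp add: algebra_simps)
  then have "h * \<gamma> - g - (vec 3 \<rho> \<bullet> a) = 0" using a_nonzero by (simp only: mult_eq_0_iff) simp
  then have "g = h * \<gamma> - vec 3 \<rho> \<bullet> a" by (simp add: algebra_simps)
  also have "\<dots> = h * \<gamma> + a \<bullet> (- vec 3 \<rho>)"
    using comm_scalar_prod[OF a, of "vec 3 \<rho>"] by simp
  finally show ?thesis by (intro exI[of _ \<gamma>] bexI[of _ "- vec 3 \<rho>"]) auto
qed

lemma \<phi>_inj: "t \<in> carrier_vec m \<Longrightarrow> h \<noteq> 0 \<Longrightarrow> \<phi> *\<^sub>v t = 0\<^sub>v m \<Longrightarrow> t = 0\<^sub>v m"
proof -
  assume t [simp]: "t \<in> carrier_vec m" and h: "h \<noteq> 0" and "\<phi> *\<^sub>v t = 0\<^sub>v m"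
  moreover have "\<phi>' *\<^sub>v 0\<^sub>v m = 0\<^sub>v m" by (rule eq_vecI) auto
  ultimately have "h \<cdot>\<^sub>v t = 0\<^sub>v m" using \<phi>'\<phi>_vec[OF t] by simp
  then have "h * t $ i = 0" if "i < m" for i
    using that t by (metis carrier_vecD index_smult_vec(1) index_zero_vec(1))
  then show "t = 0\<^sub>v m" using h by (intro eq_vecI) auto
qed

end

text \<open>The unit v comes with an explicit inverse because the base is merely an integral domain.
  \<open>colon_f\<close> is the inclusion of the colon ideal (a) : f in (a, w).\<close>

locale pfaffian_hypersurface = pfaffian_link +
  fixes f v v' :: 'a
  assumes h: "h = v * f" and unit: "v * v' = 1" and f_nonzero: "f \<noteq> 0"
    and colon_f: "\<And>t r. r \<in> carrier_vec 3 \<Longrightarrow> f * t = a \<bullet> r \<Longrightarrow>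
      \<exists>s\<in>carrier_vec 3. \<exists>u\<in>carrier_vec m. t = a \<bullet> s + w \<bullet> u"
begin

text \<open>Syzygies of the row (a, f). The coefficient t of f lies in the colon ideal, and
  subtracting a known syzygy with the same t leaves a syzygy of a alone. This one is Koszul, and
  \<open>koszul_eq\<close> rewrites Koszul syzygies in the required form.\<close>

lemma exact_F1:
  assumes r [simp]: "r \<in> carrier_vec 3" and eq: "a \<bullet> r + f * t = 0"
  shows "\<exists>u\<in>carrier_vec m. \<exists>s\<in>carrier_vec 3.
    r = \<psi>t *\<^sub>v (\<phi>' *\<^sub>v u) + f \<cdot>\<^sub>v s \<and> t = - (v * (w \<bullet> u)) - a \<bullet> s"
proof -
  have "f * t = a \<bullet> (- r)" using eq by (simp add: eq_neg_iff_add_eq_0 add.commute)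
  then obtain s' u' where s' [simp]: "s' \<in> carrier_vec 3" and u' [simp]: "u' \<in> carrier_vec m"
    and t: "t = a \<bullet> s' + w \<bullet> u'" using colon_f[of "- r" t] by auto
  \<comment> \<open>Chosen so that the known syzygy given by u0 and s0 has last coordinate t; the
    factor v' cancels the v in that coordinate.\<close>
  define u0 s0 where "u0 = - (v' \<cdot>\<^sub>v u')" and "s0 = - s'"
  have [simp]: "u0 \<in> carrier_vec m" "s0 \<in> carrier_vec 3" by (simp_all add: u0_def s0_def)
  have [simp]: "dim_vec u0 = m" "dim_vec s0 = 3" "dim_vec r = 3"
    by (simp_all add: u0_def s0_def carrier_vecD[OF s'] carrier_vecD[OF u'] carrier_vecD[OF r])
  have vwu: "v * (w \<bullet> u0) = - (w \<bullet> u')"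
    using unit by (simp add: u0_def carrier_vecD[OF u'] flip: mult.assoc)
  have t0: "t = - (v * (w \<bullet> u0)) - a \<bullet> s0"
    by (simp add: t vwu s0_def)
  define r1 where "r1 = r - \<psi>t *\<^sub>v (\<phi>' *\<^sub>v u0) - f \<cdot>\<^sub>v s0"
  have [simp]: "r1 \<in> carrier_vec 3" by (simp add: r1_def)
  have "a \<bullet> r1 = a \<bullet> r - h * (w \<bullet> u0) - f * (a \<bullet> s0)"
    by (simp add: r1_def scalar_prod_minus_distrib[of _ 3] a_\<psi>t_\<phi>')
  also have "\<dots> = a \<bullet> r + f * t" by (simp add: t0 h algebra_simps)
  finally obtain x where x [simp]: "x \<in> carrier_vec 3" and r1: "r1 = koszul a x"
    using koszul_exact1[of r1] eq by auto
  \<comment> \<open>With \<open>h = v f\<close>, the formula for \<open>koszul a x\<close> splits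
    into the image of \<psi> x under \<psi>t \<phi>' and f times \<open>s1\<close>. The last
    coordinate of this syzygy is zero by \<open>a_S_w_\<psi>\<close>.\<close>
  define u1 s1 where "u1 = v' \<cdot>\<^sub>v (\<psi> *\<^sub>v x)" and "s1 = v \<cdot>\<^sub>v (S *\<^sub>v x)"
  define u2 where "u2 = \<psi> *\<^sub>v x"
  have [simp]: "u2 \<in> carrier_vec m" by (simp add: u2_def)
  have k: "koszul a x = \<psi>t *\<^sub>v (\<phi>' *\<^sub>v u2) + f \<cdot>\<^sub>v s1"
    by (subst koszul_eq[OF x], rule eq_vecI)
       (auto simp: u2_def s1_def h algebra_simps simp del: index_mult_mat_vec)
  have "v * (w \<bullet> u2) + a \<bullet> s1 = v * (a \<bullet> (S *\<^sub>v x) + w \<bullet> (\<psi> *\<^sub>v x))"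
    by (simp add: u2_def s1_def algebra_simps)
  then have z: "v * (w \<bullet> u2) + a \<bullet> s1 = 0" by (simp add: a_S_w_\<psi>)
  have "r = \<psi>t *\<^sub>v (\<phi>' *\<^sub>v u0) + f \<cdot>\<^sub>v s0 + r1"
    by (rule eq_vecI) (auto simp: r1_def carrier_vecD[OF r] simp del: index_mult_mat_vec)
  also have "\<dots> = \<psi>t *\<^sub>v (\<phi>' *\<^sub>v (u0 + u2)) + f \<cdot>\<^sub>v (s0 + s1)"
    unfolding r1 k by (simp only: lin mv_carrier \<open>u0 \<in> _\<close> \<open>u2 \<in> _\<close>)
      (rule eq_vecI, auto simp: algebra_simps s0_def s1_def carrier_vecD[OF s'] simp del: index_mult_mat_vec)
  finally have "r = \<psi>t *\<^sub>v (\<phi>' *\<^sub>v (u0 + u2)) + f \<cdot>\<^sub>v (s0 + s1)" .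
  moreover have "t = - (v * (w \<bullet> (u0 + u2))) - a \<bullet> (s0 + s1)"
    using z by (simp add: t0 scalar_prod_add_distrib[of _ m] scalar_prod_add_distrib[of _ 3] s1_def algebra_simps)
  moreover have "u0 + u2 \<in> carrier_vec m" "s0 + s1 \<in> carrier_vec 3" by (simp_all add: s1_def)
  ultimately show ?thesis by blast
qed

text \<open>The second equation says that (s, v u) is a syzygy of (a, w), hence the image of some
  (x, y) under the middle matrix. The first equation then becomes \<open>koszul a x = 0\<close>, so
  x is a multiple of a, and subtracting that multiple of (a, w), which the middle matrix
  annihilates, removes x.\<close>

lemma exact_F2:
  assumes u [simp]: "u \<in> carrier_vec m" and s [simp]: "s \<in> carrier_vec 3"
    and eq1: "\<psi>t *\<^sub>v (\<phi>' *\<^sub>v u) + f \<cdot>\<^sub>v s = 0\<^sub>v 3" and eq2: "v * (w \<bullet> u) + a \<bullet> s = 0"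
  shows "\<exists>t\<in>carrier_vec m. u = \<phi> *\<^sub>v t \<and> s = - (v \<cdot>\<^sub>v (\<psi>t *\<^sub>v t))"
proof -
  have "a \<bullet> s + w \<bullet> (v \<cdot>\<^sub>v u) = 0"
    using eq2 by (simp add: add.commute carrier_vecD[OF u])
  then obtain x y where x [simp]: "x \<in> carrier_vec 3" and y [simp]: "y \<in> carrier_vec m"
    and sx: "s = S *\<^sub>v x - \<psi>t *\<^sub>v y" and ux: "v \<cdot>\<^sub>v u = \<psi> *\<^sub>v x + \<phi> *\<^sub>v y"
    using exact[of s "v \<cdot>\<^sub>v u"] by auto
  have \<psi>x: "\<psi> *\<^sub>v x = v \<cdot>\<^sub>v u - \<phi> *\<^sub>v y"
    by (rule eq_vecI) (auto simp: ux simp del: index_mult_mat_vec)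
  have "koszul a x = h \<cdot>\<^sub>v (S *\<^sub>v x) + (v \<cdot>\<^sub>v (\<psi>t *\<^sub>v (\<phi>' *\<^sub>v u)) - h \<cdot>\<^sub>v (\<psi>t *\<^sub>v y))"
    by (simp add: koszul_eq \<psi>x lin)
  also have "\<dots> = v \<cdot>\<^sub>v (\<psi>t *\<^sub>v (\<phi>' *\<^sub>v u) + f \<cdot>\<^sub>v s)"
    by (rule eq_vecI) (auto simp: sx h algebra_simps simp del: index_mult_mat_vec)
  also have "\<dots> = 0\<^sub>v 3" by (rule eq_vecI) (simp_all add: eq1)
  finally obtain g where g: "x = g \<cdot>\<^sub>v a" using koszul_exact2[of x] by auto
  define y' where "y' = y - g \<cdot>\<^sub>v w"
  have y' [simp]: "y' \<in> carrier_vec m" by (simp add: y'_def)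
  have s': "s = - (\<psi>t *\<^sub>v y')"
    by (rule eq_vecI) (auto simp: sx g y'_def lin zero_a algebra_simps simp del: index_mult_mat_vec)
  have u': "v \<cdot>\<^sub>v u = \<phi> *\<^sub>v y'"
    by (rule eq_vecI) (auto simp: ux g y'_def lin zero_w algebra_simps simp del: index_mult_mat_vec)
  have v': "v' * v = 1" using unit by (simp add: mult.commute)
  have "u = v' \<cdot>\<^sub>v (v \<cdot>\<^sub>v u)" by (simp add: smult_smult_assoc v')
  then have "u = \<phi> *\<^sub>v (v' \<cdot>\<^sub>v y')" by (simp add: u' lin)
  moreover have "s = - (v \<cdot>\<^sub>v (\<psi>t *\<^sub>v (v' \<cdot>\<^sub>v y')))"
    by (simp add: s' lin smult_smult_assoc unit)
  ultimately show ?thesis by (intro bexI[of _ "v' \<cdot>\<^sub>v y'"]) auto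
qed

end

section \<open>The Koszul complex of the powers of the variables\<close>

lemma Var_nonzero [simp]: "Var v \<noteq> 0"
  using Var_power_nonzero[of v 1] by simp

lemma power_gens_nth [simp]:
  "length (power_gens q) = 3" "power_gens q ! 0 = Var 0 ^ q" "power_gens q ! Suc 0 = Var 1 ^ q"
  "power_gens q ! 2 = Var 2 ^ q"
  by (simp_all add: power_gens_def)

lemma power_vec [simp]:
  "vec_of_list (power_gens q) \<in> carrier_vec 3" "dim_vec (vec_of_list (power_gens q)) = 3"
  "vec_of_list (power_gens q) $ 0 = Var 0 ^ q" "vec_of_list (power_gens q) $ 1 = Var 1 ^ q"
  "vec_of_list (power_gens q) $ Suc 0 = Var 1 ^ q" "vec_of_list (power_gens q) $ 2 = Var 2 ^ q"
  by (simp_all only: power_gens_def vec_of_list_index carrier_dim_vec dim_vec_of_list) simp_all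

text \<open>Division with remainder: modulo the first power only the last two terms of the relation
  survive, and modulo the first two powers only the last. This determines the last coordinate up to
  multiples of the first two powers, and the other coordinates follow by cancellation.\<close>

lemma power_koszul_exact1:
  fixes r :: "'k::field poly3 vec"
  assumes r: "r \<in> carrier_vec 3" and eq: "vec_of_list (power_gens q) \<bullet> r = 0"
  shows "\<exists>x\<in>carrier_vec 3. r = koszul (vec_of_list (power_gens q)) x"
proof -
  define x y z :: "'k poly3" where "x = Var 0 ^ q" and "y = Var 1 ^ q" and "z = Var 2 ^ q"
  have nz: "x \<noteq> 0" "y \<noteq> 0" "z \<noteq> 0" by (simp_all add: x_def y_def z_def)
  have eq': "x * r $ 0 + y * r $ 1 + z * r $ 2 = 0"
    using eq by (simp add: scalar_prod_three[OF r] x_def y_def z_def)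
  have "rem_var q 0 (x * r $ 0 + y * r $ 1 + z * r $ 2) =
      y * rem_var q 0 (r $ 1) + z * rem_var q 0 (r $ 2)"
    by (simp add: rem_var_add x_def y_def z_def three_distinct)
  then have eq0: "y * rem_var q 0 (r $ 1) + z * rem_var q 0 (r $ 2) = 0"
    by (simp only: eq' rem_var_zero)
  have "rem_var q 1 (y * rem_var q 0 (r $ 1) + z * rem_var q 0 (r $ 2)) =
      z * rem_var q 1 (rem_var q 0 (r $ 2))"
    by (simp add: rem_var_add y_def z_def three_distinct)
  then have "z * rem_var q 1 (rem_var q 0 (r $ 2)) = 0" by (simp only: eq0 rem_var_zero)
  then have "rem_var q 1 (rem_var q 0 (r $ 2)) = 0" using nz by simp
  then obtain s where s: "rem_var q 0 (r $ 2) = y * s"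
    using rem_var_decomp[of "rem_var q 0 (r $ 2)" 1 q] by (auto simp: y_def)
  obtain s' where s': "r $ 2 = x * s' + y * s"
    using rem_var_decomp[of "r $ 2" 0 q] s by (auto simp: x_def)
  have "y * (rem_var q 0 (r $ 1) + z * s) = 0" using eq0 s by (simp add: algebra_simps)
  then have "rem_var q 0 (r $ 1) = - (z * s)" using nz by (simp add: eq_neg_iff_add_eq_0)
  then obtain s'' where s'': "r $ 1 = x * s'' - z * s"
    using rem_var_decomp[of "r $ 1" 0 q] by (auto simp: x_def)
  have "x * (r $ 0 + y * s'' + z * s') = 0"
    using eq' by (simp add: s' s'' algebra_simps del: One_nat_def)
  then have "r $ 0 + y * s'' + z * s' = 0" using nz by simp
  then have r0: "r $ 0 = - (z * s') - y * s''"
    by (simp add: eq_neg_iff_add_eq_0 algebra_simps)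
  define c where "c = vec 3 (\<lambda>i. if i = 0 then s else if i = 1 then - s' else s'')"
  have c: "c $ 0 = s" "c $ 1 = - s'" "c $ 2 = s''" by (simp_all add: c_def)
  have "r = koszul (vec_of_list (power_gens q)) c"
    by (rule eq_vec_threeI[OF r])
      (simp_all add: r0 s' s'' c x_def y_def z_def del: One_nat_def)
  then show ?thesis by (intro bexI[of _ c]) (auto simp: c_def)
qed

lemma power_koszul_exact2:
  fixes x :: "'k::field poly3 vec"
  assumes x: "x \<in> carrier_vec 3" and eq: "koszul (vec_of_list (power_gens q)) x = 0\<^sub>v 3"
  shows "\<exists>g. x = g \<cdot>\<^sub>v vec_of_list (power_gens q)"
proof -
  let ?a = "vec_of_list (power_gens q) :: 'k poly3 vec"
  have "koszul ?a x $ i = 0" if "i < 3" for i using eq that by simp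
  from this[of 1] this[of 2]
  have e1: "Var 0 ^ q * x $ 2 = Var 2 ^ q * x $ 0" and e2: "Var 1 ^ q * x $ 0 = Var 0 ^ q * x $ 1"
    by simp_all
  have "rem_var q 0 (Var 1 ^ q * x $ 0) = Var 1 ^ q * rem_var q 0 (x $ 0)"
    by (simp add: three_distinct)
  then have "Var 1 ^ q * rem_var q 0 (x $ 0) = 0" by (simp add: e2)
  then have "rem_var q 0 (x $ 0) = 0" by (simp only: mult_eq_0_iff Var_power_nonzero) simp
  then obtain g where g: "x $ 0 = Var 0 ^ q * g" using rem_var_decomp[of "x $ 0" 0 q] by auto
  have "Var 0 ^ q * x $ 1 = Var 0 ^ q * (g * Var 1 ^ q)" using e2 by (simp add: g algebra_simps)
  then have g1: "x $ 1 = g * Var 1 ^ q" by simp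
  have "Var 0 ^ q * x $ 2 = Var 0 ^ q * (g * Var 2 ^ q)" using e1 by (simp add: g algebra_simps)
  then have g2: "x $ 2 = g * Var 2 ^ q" by simp
  show ?thesis
    by (intro exI[of _ g] eq_vec_threeI[OF x]) (simp_all add: g g1 g2 mult.commute del: One_nat_def)
qed

section \<open>Pfaffians of the block matrix and the Koszul matrix\<close>

lemma nth_upt_add: "[k..<k + m] = map ((+) k) [0..<m]"
  by (rule nth_equalityI) simp_all

lemma pf_minor_relabel:
  assumes "\<And>i j. i \<in> set T \<Longrightarrow> j \<in> set T \<Longrightarrow> A $$ (g i, g j) = B $$ (i, j)"
  shows "pf_minor A (map g T) k l = pf_minor B T k l"
proof -
  have "pf A (del_nth i (del_nth j (map g T))) = pf B (del_nth i (del_nth j T))" for i j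
    using pf_relabel[of "del_nth i (del_nth j T)" A g B] assms
    by (simp add: take_map drop_map) (meson UnE in_set_dropD in_set_takeD)
  then show ?thesis by (simp only: pf_minor_def)
qed

text \<open>The Pfaffian of X on i, j and all indices of \<phi>, for i and j below 3, is evaluated
  twice. The two-row expansion gives the (i, j) entry of the matrix on the right, where the signs of
  both factors - \<psi> cancel. On the other hand it is the Pfaffian with the third index below 3
  deleted, which is an entry of a up to sign, or zero for \<open>i = j\<close>.\<close>

lemma block_pf_koszul:
  fixes X :: "'r::comm_ring_1 mat" and a x :: "'r vec"
  assumes S: "S \<in> carrier_mat 3 3" and \<psi>: "\<psi> \<in> carrier_mat m 3" and \<phi>: "\<phi> \<in> carrier_mat m m"
    and X: "X = four_block_mat S (- transpose_mat \<psi>) \<psi> \<phi>" and sk: "skew_symmetric X"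
    and a: "\<And>l. l < 3 \<Longrightarrow> a $ l = (- 1) ^ l * pf_del X {l}" and x: "x \<in> carrier_vec 3"
  shows "koszul a x = pfaffian \<phi> \<cdot>\<^sub>v (S *\<^sub>v x) + transpose_mat \<psi> *\<^sub>v (pf_adjoint \<phi> *\<^sub>v (\<psi> *\<^sub>v x))"
proof -
  let ?T = "[3..<3 + m]"
  have dX: "dim_row X = 3 + m" using S \<phi> by (simp add: X)
  have T: "?T = map ((+) 3) [0..<m]" by (rule nth_upt_add)
  have rel: "X $$ (3 + i, 3 + j) = \<phi> $$ (i, j)" if "i < m" "j < m" for i j
    using that S \<psi> \<phi> by (simp add: X)
  have Xi: "X $$ (i, 3 + k) = - \<psi> $$ (k, i)" if "i < 3" "k < m" for i k
    using that S \<psi> \<phi> by (simp add: X)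
  have XS: "X $$ (i, j) = S $$ (i, j)" if "i < 3" "j < 3" for i j
    using that S \<psi> \<phi> by (simp add: X)
  define K where "K = (\<lambda>i j. pf X (i # j # ?T))"
  have h: "pf X ?T = pfaffian \<phi>"
    unfolding T pfaffian_eq_pf using \<phi> rel by (subst pf_relabel[where B = \<phi>]) auto
  have minor: "pf_minor X ?T k l = pf_adjoint \<phi> $$ (k, l)" if "k < m" "l < m" for k l
    unfolding T using \<phi> rel that by (subst pf_minor_relabel[where B = \<phi>]) (auto simp: pf_adjoint_nth)
  have K: "K i j = S $$ (i, j) * pfaffian \<phi> +
      (\<Sum>k<m. \<Sum>l<m. \<psi> $$ (k, i) * \<psi> $$ (l, j) * pf_adjoint \<phi> $$ (k, l))" if "i < 3" "j < 3" for i j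
    unfolding K_def pf_Cons_Cons using that by (auto simp: h XS Xi minor intro!: sum.cong)
  have upt: "[0..<dim_row X] = 0 # 1 # 2 # ?T"
    by (simp add: dX upt_conv_Cons numeral_3_eq_3)
  have "filter (\<lambda>i. i \<notin> {l}) ?T = ?T" if "l < 3" for l
    using that by (intro filter_True) auto
  then have "pf_del X {0} = K 1 2" "pf_del X {1} = K 0 2" "pf_del X {2} = K 0 1"
    by (simp_all add: pf_del_def upt K_def del: pf.simps upt_Suc)
  then have K1: "K 1 2 = a $ 0" "K 0 2 = - a $ 1" "K 0 1 = a $ 2"
    by (simp_all add: a)
  have "K j i = - K i j" if "i < 3" "j < 3" for i j
  proof -
    have "{3..<3 + m} \<subseteq> {..<3 + m}" by auto
    then show ?thesis
      using pf_swap[OF sk, of "[]" j i ?T] that by (simp add: K_def dX del: pf.simps)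
  qed
  from this[of 1 2] this[of 0 2] this[of 0 1]
  have K2: "K 2 1 = - a $ 0" "K 2 0 = a $ 1" "K 1 0 = - a $ 2"
    by (simp_all add: K1 del: One_nat_def)
  have K3: "K i i = 0" if "i < 3" for i
    unfolding K_def using that by (intro pf_repeat[OF sk]) (auto simp: dX)
  let ?y = "pfaffian \<phi> \<cdot>\<^sub>v (S *\<^sub>v x) + transpose_mat \<psi> *\<^sub>v (pf_adjoint \<phi> *\<^sub>v (\<psi> *\<^sub>v x))"
  have \<psi>x: "\<psi> *\<^sub>v x \<in> carrier_vec m" using \<psi> x by simp
  have ad: "pf_adjoint \<phi> \<in> carrier_mat m m" using \<phi> by (intro carrier_matI) auto
  have adx: "pf_adjoint \<phi> *\<^sub>v (\<psi> *\<^sub>v x) \<in> carrier_vec m" using ad \<psi>x by simp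
  have \<psi>t: "transpose_mat \<psi> \<in> carrier_mat 3 m" using \<psi> by simp
  have y: "?y $ i = (\<Sum>j<3. K i j * x $ j)" if i: "i < 3" for i
  proof -
    have "?y $ i = pfaffian \<phi> * (\<Sum>j<3. S $$ (i, j) * x $ j) +
       (\<Sum>k<m. transpose_mat \<psi> $$ (i, k) * (\<Sum>l<m. pf_adjoint \<phi> $$ (k, l) * (\<Sum>j<3. \<psi> $$ (l, j) * x $ j)))"
      using i S \<psi> by (simp add: mult_mat_vec_nth[OF S x] mult_mat_vec_nth[OF \<psi>t adx]
        mult_mat_vec_nth[OF ad \<psi>x] mult_mat_vec_nth[OF \<psi> x] del: index_mult_mat_vec)
    also have "(\<Sum>k<m. transpose_mat \<psi> $$ (i, k) * (\<Sum>l<m. pf_adjoint \<phi> $$ (k, l) * (\<Sum>j<3. \<psi> $$ (l, j) * x $ j)))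
      = (\<Sum>k<m. \<Sum>l<m. \<Sum>j<3. \<psi> $$ (k, i) * \<psi> $$ (l, j) * pf_adjoint \<phi> $$ (k, l) * x $ j)"
      using i \<psi> by (auto simp: sum_distrib_left algebra_simps intro!: sum.cong)
    also have "\<dots> = (\<Sum>j<3. \<Sum>k<m. \<Sum>l<m. \<psi> $$ (k, i) * \<psi> $$ (l, j) * pf_adjoint \<phi> $$ (k, l) * x $ j)"
      by (subst sum.swap, subst (2) sum.swap, subst sum.swap, rule sum.cong[OF refl], rule sum.swap)
    also have "pfaffian \<phi> * (\<Sum>j<3. S $$ (i, j) * x $ j) + \<dots> = (\<Sum>j<3. K i j * x $ j)"
      unfolding sum_distrib_left sum.distrib[symmetric]
      by (rule sum.cong) (auto simp: K i sum_distrib_right sum_distrib_left algebra_simps)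
    finally show ?thesis .
  qed
  show ?thesis
  proof (rule eq_vec_threeI)
    show "koszul a x $ 0 = ?y $ 0" "koszul a x $ 1 = ?y $ 1" "koszul a x $ 2 = ?y $ 2"
      by (subst y; simp add: sum_upto_three K1 K2 K3 algebra_simps del: One_nat_def)+
  qed (use S x mult_mat_vec_carrier[OF \<psi>t adx] in auto)
qed

section \<open>Degrees of Pfaffians\<close>

lemma sum_list_del_nth:
  fixes g :: "'x \<Rightarrow> 'y::ab_group_add"
  assumes "j < length xs"
  shows "sum_list (map g (del_nth j xs)) = sum_list (map g xs) - g (xs ! j)"
proof -
  have "sum_list (map g xs) = sum_list (map g (take j xs @ xs ! j # drop (Suc j) xs))"
    using id_take_nth_drop[OF assms] by simp
  then show ?thesis by simp
qed

text \<open>Every term of the Pfaffian pairs off the indices, so each index contributes its d once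
  and each pair contributes one e. The degree is doubled in the hypothesis because a single index
  contributes only half of \<open>e - 2 * d i\<close>.\<close>

lemma pf_homog:
  assumes "\<And>i j. i \<in> set is \<Longrightarrow> j \<in> set is \<Longrightarrow> A $$ (i, j) \<in> homog (e - d i - d j)"
    and "2 * D = (\<Sum>i\<leftarrow>is. e - 2 * d i)"
  shows "pf A is \<in> homog D"
  using assms
proof (induction "length is" arbitrary: "is" D rule: less_induct)
  case less
  show ?case
  proof (cases "is")
    case (Cons i xs)
    have "(- 1) ^ j * A $$ (i, xs ! j) * pf A (del_nth j xs) \<in> homog D" if j: "j < length xs" for j
    proof -
      let ?D = "D - (e - d i - d (xs ! j))"
      have "pf A (del_nth j xs) \<in> homog ?D"
      proof (rule less.hyps)
        show "2 * ?D = (\<Sum>i\<leftarrow>del_nth j xs. e - 2 * d i)"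
          using less.prems(2) by (simp only: sum_list_del_nth[OF j]) (simp add: Cons)
        show "A $$ (i, k) \<in> homog (e - d i - d k)" if "i \<in> set (del_nth j xs)" "k \<in> set (del_nth j xs)" for i k
          using that by (intro less.prems(1)) (auto simp: Cons dest: in_set_takeD in_set_dropD)
      qed (use j in \<open>auto simp: Cons\<close>)
      moreover have "A $$ (i, xs ! j) \<in> homog (e - d i - d (xs ! j))"
        using j by (intro less.prems(1)) (auto simp: Cons)
      ultimately have "(- 1) ^ j * A $$ (i, xs ! j) * pf A (del_nth j xs) \<in> homog (0 + (e - d i - d (xs ! j)) + ?D)"
        by (intro homog_mult homog_sign)
      then show ?thesis by simp
    qed
    then show ?thesis by (auto simp: Cons intro: homog_sum)
  qed (use less.prems(2) in simp)
qed

section \<open>Graded resolutions over the polynomial ring\<close>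

lemma mat_app_class_ring:
  fixes A :: "'r::comm_ring_1 mat"
  shows "dim_vec v = dim_col A \<Longrightarrow> mat_app class_ring A v = A *\<^sub>v v"
  by (intro eq_vecI)
    (auto simp: mat_app_def scalar_prod_def lessThan_atLeast0 class_ring_simps intro!: sum.cong)

lemma free_vecs_class_ring: "free_vecs (class_ring :: 'r::comm_ring_1 ring) n = carrier_vec n"
  unfolding free_vecs_def carrier_vec_def by simp

lemma lookup_mult_0:
  "Poly_Mapping.lookup a 0 = 0 \<Longrightarrow> Poly_Mapping.lookup ((r :: 'k::field poly3) * a) 0 = 0"
proof (rule ccontr)
  assume a: "Poly_Mapping.lookup a 0 = 0" and "Poly_Mapping.lookup (r * a) 0 \<noteq> 0"
  then have "0 \<in> Poly_Mapping.keys (r * a)" by (simp add: in_keys_iff)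
  then obtain m n where mn: "0 = m + n" "n \<in> Poly_Mapping.keys a"
    using subsetD[OF keys_mult] by blast
  then have "mon_degree n = 0" using mon_degree_add[of m n] by simp
  then have "n = 0" by (rule mon_degree_eq_0)
  with mn a show False by (simp add: in_keys_iff)
qed

text \<open>Turns minimality of a resolution into vanishing constant terms of the entries.\<close>

lemma irrelevant_ideal_iff:
  "a \<in> irrelevant_ideal poly_ring homog \<longleftrightarrow> Poly_Mapping.lookup (a :: 'k::field poly3) 0 = 0"
proof
  have "ideal {a :: 'k poly3. Poly_Mapping.lookup a 0 = 0} poly_ring"
    by (rule ideal_poly_ringI) (auto simp: lookup_add lookup_mult_0)
  moreover have "Poly_Mapping.lookup a 0 = 0" if "a \<in> homog i" "1 \<le> i" for a :: "'k poly3" and i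
    using homogD[OF that(1), of 0] that(2) by (auto simp: in_keys_iff)
  ultimately have "irrelevant_ideal poly_ring homog \<subseteq> {a :: 'k poly3. Poly_Mapping.lookup a 0 = 0}"
    unfolding irrelevant_ideal_def by (intro Idl_least UN_least subsetI CollectI) simp_all
  then show "a \<in> irrelevant_ideal poly_ring homog \<Longrightarrow> Poly_Mapping.lookup a 0 = 0" by blast
next
  assume a: "Poly_Mapping.lookup a 0 = 0"
  show "a \<in> irrelevant_ideal poly_ring homog"
    unfolding irrelevant_ideal_def
  proof (induction rule: poly_mapping_additive_induct[where a = a])
    case (single m c)
    then have "m \<noteq> 0" using a by (auto simp: in_keys_iff)
    then have "mon_degree m \<noteq> 0" using mon_degree_eq_0 by auto
    then have "Poly_Mapping.single m c \<in> (\<Union>i\<in>{1..}. homog i)"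
      by (intro UN_I[of "int (mon_degree m)"] homogI) (auto split: if_splits)
    then show ?case by (rule subsetD[OF Idl_superset])
  next
    case zero
    show ?case by (rule ideal_class_ringD(1)[OF ideal_Idl])
  next
    case (add a b)
    then show ?case by (rule ideal_class_ringD(2)[OF ideal_Idl])
  qed
qed

lemma minimal_graded_resolution_poly:
  "minimal_graded_resolution poly_ring homog I tw D \<longleftrightarrow>
    (\<forall>i. D i \<in> carrier_mat (length (tw i)) (length (tw (Suc i)))) \<and>
    (\<forall>i. \<forall>r<length (tw i). \<forall>c<length (tw (Suc i)). D i $$ (r, c) \<in> homog (tw (Suc i) ! c - tw i ! r)) \<and>
    tw 0 = [0] \<and> {(D 0 *\<^sub>v v) $ 0 | v. v \<in> carrier_vec (length (tw 1))} = I \<and>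
    (\<forall>i. \<forall>v\<in>carrier_vec (length (tw (Suc i))). D i *\<^sub>v v = 0\<^sub>v (length (tw i)) \<longleftrightarrow>
       (\<exists>u\<in>carrier_vec (length (tw (Suc (Suc i)))). v = D (Suc i) *\<^sub>v u)) \<and>
    (\<forall>i. \<forall>r<length (tw i). \<forall>c<length (tw (Suc i)). Poly_Mapping.lookup (D i $$ (r, c)) 0 = 0)"
  (is "_ \<longleftrightarrow> ?C \<and> ?H \<and> ?Z \<and> ?I \<and> ?E \<and> ?M")
proof -
  have "(minimal_graded_resolution poly_ring homog I tw D \<longleftrightarrow> ?C \<and> ?H \<and> ?Z \<and> ?I \<and> ?E \<and> ?M)" if C: "?C"
  proof -
    have app: "mat_app poly_ring (D i) v = D i *\<^sub>v v" if "v \<in> carrier_vec (length (tw (Suc i)))" for i v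
      using C that by (intro mat_app_class_ring) (metis carrier_matD(2) carrier_vecD)
    have zero: "vec n (\<lambda>_. \<zero>\<^bsub>poly_ring\<^esub>) = 0\<^sub>v n" for n by auto
    have I: "{mat_app poly_ring (D 0) v $ 0 |v. v \<in> free_vecs poly_ring (length (tw 1))} =
        {(D 0 *\<^sub>v v) $ 0 | v. v \<in> carrier_vec (length (tw 1))}"
      by (rule Collect_cong, rule ex_cong1) (auto simp: free_vecs_class_ring app)
    have im: "D (Suc i) *\<^sub>v u \<in> carrier_vec (length (tw (Suc i)))" for i u
      using carrier_matD(1)[OF spec[OF C]] by (intro carrier_vecI) simp
    have E: "{v \<in> free_vecs poly_ring (length (tw (Suc i))).
             mat_app poly_ring (D i) v = vec (length (tw i)) (\<lambda>_. \<zero>\<^bsub>poly_ring\<^esub>)}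
          = mat_app poly_ring (D (Suc i)) ` free_vecs poly_ring (length (tw (Suc (Suc i)))) \<longleftrightarrow>
       (\<forall>v\<in>carrier_vec (length (tw (Suc i))). D i *\<^sub>v v = 0\<^sub>v (length (tw i)) \<longleftrightarrow>
         (\<exists>u\<in>carrier_vec (length (tw (Suc (Suc i)))). v = D (Suc i) *\<^sub>v u))" (is "?L = ?R \<longleftrightarrow> ?Q") for i
    proof -
      have "?L = {v \<in> carrier_vec (length (tw (Suc i))). D i *\<^sub>v v = 0\<^sub>v (length (tw i))}"
        unfolding free_vecs_class_ring zero by (intro Collect_cong conj_cong refl) (simp only: app)
      moreover have "?R = {v \<in> carrier_vec (length (tw (Suc i))).
          \<exists>u\<in>carrier_vec (length (tw (Suc (Suc i)))). v = D (Suc i) *\<^sub>v u}"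
        unfolding free_vecs_class_ring using im[of i] app[of _ "Suc i"] by (auto simp: image_iff)
      ultimately show ?thesis by blast
    qed
    have M: "elements_mat (D i) \<subseteq> irrelevant_ideal poly_ring homog \<longleftrightarrow>
        (\<forall>r<length (tw i). \<forall>c<length (tw (Suc i)). Poly_Mapping.lookup (D i $$ (r, c)) 0 = 0)" for i
    proof -
      have "dim_row (D i) = length (tw i)" "dim_col (D i) = length (tw (Suc i))" using C by auto
      then show ?thesis
        unfolding subset_iff irrelevant_ideal_iff by (metis elements_matD elements_matI[OF spec[OF C]])
    qed
    show ?thesis
      unfolding minimal_graded_resolution_def E M I by (rule refl)
  qed
  moreover have ?C if "minimal_graded_resolution poly_ring homog I tw D"
    by (rule conjunct1[OF that[unfolded minimal_graded_resolution_def]])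
  ultimately show ?thesis by argo
qed

lemma row_mat_mult:
  fixes gs :: "'r::comm_ring_1 list"
  shows "v \<in> carrier_vec (length gs) \<Longrightarrow> (row_mat gs *\<^sub>v v) $ 0 = vec_of_list gs \<bullet> v"
  by (simp add: row_mat_def)

lemma row_mat_carrier [simp]: "row_mat gs \<in> carrier_mat 1 (length gs)"
  by (simp add: row_mat_def mat_of_row_def)

lemma row_mat_nth [simp]: "j < length gs \<Longrightarrow> row_mat gs $$ (0, j) = gs ! j"
  by (simp add: row_mat_def vec_of_list_index)

text \<open>The last map is the transposed first map, so a nonzero j-th generator has both degrees
  \<open>as ! j\<close> and \<open>e - bs ! j\<close>. This determines the middle twists and gives
  the entries of X their symmetric degrees.\<close>

lemma buchsbaum_eisenbud_resolutionD:
  fixes gs :: "'k::field poly3 list"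
  assumes be: "buchsbaum_eisenbud_resolution J gs X" and nz: "\<And>j. j < length gs \<Longrightarrow> gs ! j \<noteq> 0"
  defines "n \<equiv> length gs"
  obtains as e where "length as = n"
    and "\<And>j. j < n \<Longrightarrow> gs ! j \<in> homog (as ! j)"
    and "\<And>i j. i < n \<Longrightarrow> j < n \<Longrightarrow> X $$ (i, j) \<in> homog (e - as ! i - as ! j)"
    and "\<And>i j. i < n \<Longrightarrow> j < n \<Longrightarrow> Poly_Mapping.lookup (X $$ (i, j)) 0 = 0"
    and "\<And>v. v \<in> carrier_vec n \<Longrightarrow> vec_of_list gs \<bullet> v = 0 \<Longrightarrow> \<exists>u\<in>carrier_vec n. v = X *\<^sub>v u"
    and "X *\<^sub>v vec_of_list gs = 0\<^sub>v n"
proof -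
  have X: "X \<in> carrier_mat n n" using be by (simp add: buchsbaum_eisenbud_resolution_def n_def)
  obtain as bs e where
    res: "finite_minimal_graded_resolution poly_ring homog J
        [[0], as, bs, [e]] [row_mat gs, X, transpose_mat (row_mat gs)]"
    using be unfolding buchsbaum_eisenbud_resolution_def by blast
  define tw where "tw = fin_twists [[0], as, bs, [e]]"
  define D where "D = fin_maps poly_ring [[0], as, bs, [e]] [row_mat gs, X, transpose_mat (row_mat gs)]"
  have tw: "tw 0 = [0]" "tw 1 = as" "tw (Suc 0) = as" "tw 2 = bs" "tw (Suc (Suc 0)) = bs" "tw 3 = [e]"
    "tw (Suc (Suc (Suc 0))) = [e]"
    by (simp_all add: tw_def fin_twists_def eval_nat_numeral)
  have D: "D 0 = row_mat gs" "D 1 = X" "D (Suc 0) = X" "D 2 = transpose_mat (row_mat gs)"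
    "D (Suc (Suc 0)) = transpose_mat (row_mat gs)"
    by (simp_all add: D_def fin_maps_def eval_nat_numeral)
  have "minimal_graded_resolution poly_ring homog J tw D"
    using res by (simp add: finite_minimal_graded_resolution_def tw_def D_def)
  then have C: "\<And>i. D i \<in> carrier_mat (length (tw i)) (length (tw (Suc i)))"
    and H: "\<And>i r c. r < length (tw i) \<Longrightarrow> c < length (tw (Suc i)) \<Longrightarrow>
      D i $$ (r, c) \<in> homog (tw (Suc i) ! c - tw i ! r)"
    and E: "\<And>i v. v \<in> carrier_vec (length (tw (Suc i))) \<Longrightarrow> D i *\<^sub>v v = 0\<^sub>v (length (tw i)) \<longleftrightarrow>
       (\<exists>u\<in>carrier_vec (length (tw (Suc (Suc i)))). v = D (Suc i) *\<^sub>v u)"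
    and M: "\<And>i r c. r < length (tw i) \<Longrightarrow> c < length (tw (Suc i)) \<Longrightarrow>
      Poly_Mapping.lookup (D i $$ (r, c)) 0 = 0"
    unfolding minimal_graded_resolution_poly by blast+
  have las: "length as = n" and lbs: "length bs = n"
    using C[of 0] C[of 1] X by (auto simp: tw D row_mat_def n_def)
  have g: "gs ! j \<in> homog (as ! j)" if "j < n" for j
    using H[of 0 0 j] that las by (simp add: tw D n_def)
  have "gs ! j \<in> homog (e - bs ! j)" if "j < n" for j
    using H[of j 2 0] that lbs row_mat_carrier[of gs] by (simp add: tw D n_def flip: One_nat_def)
  then have bs: "bs ! j = e - as ! j" if "j < n" for j
    using homog_unique[OF nz g] that by (fastforce simp: n_def)
  show ?thesis
  proof (rule that[OF las g])
    show "X $$ (i, j) \<in> homog (e - as ! i - as ! j)" if "i < n" "j < n" for i j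
      using H[of i 1 j] that las lbs by (simp add: tw D bs algebra_simps)
    show "Poly_Mapping.lookup (X $$ (i, j)) 0 = 0" if "i < n" "j < n" for i j
      using M[of i 1 j] that las lbs by (simp add: tw D)
    show "\<exists>u\<in>carrier_vec n. v = X *\<^sub>v u" if v: "v \<in> carrier_vec n" "vec_of_list gs \<bullet> v = 0" for v
    proof -
      have "row_mat gs *\<^sub>v v = 0\<^sub>v 1"
        using row_mat_mult[of v gs] v row_mat_carrier[of gs] by (intro eq_vecI) (auto simp: n_def)
      then show ?thesis using E[of v 0] v las lbs by (simp add: tw D)
    qed
    \<comment> \<open>The vector of generators is the image of the basis vector of the last module,
      so exactness puts it into the kernel of X.\<close>
    have row: "transpose_mat (row_mat gs) *\<^sub>v unit_vec 1 0 = vec_of_list gs"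
      by (intro eq_vecI) (auto simp: row_mat_def)
    have "\<exists>u\<in>carrier_vec 1. vec_of_list gs = transpose_mat (row_mat gs) *\<^sub>v u"
      by (intro bexI[of _ "unit_vec 1 0"]) (auto simp: row simp del: One_nat_def)
    then have im: "\<exists>u\<in>carrier_vec (length (tw (Suc (Suc 1)))). vec_of_list gs = D (Suc 1) *\<^sub>v u"
      by (simp add: tw D)
    have "vec_of_list gs \<in> carrier_vec (length (tw (Suc 1)))"
      using lbs by (simp add: tw n_def carrier_dim_vec)
    from iffD2[OF E[OF this] im] show "X *\<^sub>v vec_of_list gs = 0\<^sub>v n"
      using las by (simp add: tw D)
  qed auto
qed

section \<open>Graded quotients and the Hilbert function\<close>

lemma coset_class_ring: "I +>\<^bsub>(class_ring :: 'r::comm_ring_1 ring)\<^esub> a = (\<lambda>x. x + a) ` I"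
  by (auto simp: a_r_coset_def r_coset_def)

lemma coset_eq_iff:
  fixes I :: "'r::comm_ring_1 set"
  assumes "ideal I class_ring"
  shows "I +>\<^bsub>class_ring\<^esub> a = I +>\<^bsub>class_ring\<^esub> b \<longleftrightarrow> a - b \<in> I"
proof
  assume "I +>\<^bsub>class_ring\<^esub> a = I +>\<^bsub>class_ring\<^esub> b"
  moreover have "a \<in> (\<lambda>x. x + a) ` I" using ideal_class_ringD(1)[OF assms] by force
  ultimately obtain x where "x \<in> I" "a = x + b" by (auto simp: coset_class_ring)
  then show "a - b \<in> I" by simp
next
  assume ab: "a - b \<in> I"
  have "x + a \<in> (\<lambda>x. x + b) ` I" if "x \<in> I" for x
    using ideal_class_ringD(2)[OF assms that ab] by (intro image_eqI[of _ _ "x + (a - b)"]) auto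
  moreover have "x + b \<in> (\<lambda>x. x + a) ` I" if "x \<in> I" for x
    using ideal_class_ringD(6)[OF assms that ab] by (intro image_eqI[of _ _ "x - (a - b)"]) auto
  ultimately show "I +>\<^bsub>class_ring\<^esub> a = I +>\<^bsub>class_ring\<^esub> b"
    unfolding coset_class_ring by blast
qed

lemma coset_ops:
  fixes I :: "'r::comm_ring_1 set"
  assumes I: "ideal I class_ring"
  shows "(I +>\<^bsub>class_ring\<^esub> a) \<oplus>\<^bsub>class_ring Quot I\<^esub> (I +>\<^bsub>class_ring\<^esub> b) = I +>\<^bsub>class_ring\<^esub> (a + b)"
    and "(I +>\<^bsub>class_ring\<^esub> a) \<otimes>\<^bsub>class_ring Quot I\<^esub> (I +>\<^bsub>class_ring\<^esub> b) = I +>\<^bsub>class_ring\<^esub> (a * b)"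
    and "\<zero>\<^bsub>class_ring Quot I\<^esub> = I +>\<^bsub>class_ring\<^esub> 0"
    and "carrier (class_ring Quot I) = range (\<lambda>a. I +>\<^bsub>class_ring\<^esub> a)"
proof -
  note hom = ideal.rcos_ring_hom[OF I]
  show "(I +>\<^bsub>class_ring\<^esub> a) \<oplus>\<^bsub>class_ring Quot I\<^esub> (I +>\<^bsub>class_ring\<^esub> b) = I +>\<^bsub>class_ring\<^esub> (a + b)"
    using Ring.ring_hom_add[OF hom, of a b] by simp
  show "(I +>\<^bsub>class_ring\<^esub> a) \<otimes>\<^bsub>class_ring Quot I\<^esub> (I +>\<^bsub>class_ring\<^esub> b) = I +>\<^bsub>class_ring\<^esub> (a * b)"
    using Ring.ring_hom_mult[OF hom, of a b] by simp
  show "\<zero>\<^bsub>class_ring Quot I\<^esub> = I +>\<^bsub>class_ring\<^esub> 0"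
    by (simp add: FactRing_def coset_class_ring)
  show "carrier (class_ring Quot I) = range (\<lambda>a. I +>\<^bsub>class_ring\<^esub> a)"
    by (auto simp: FactRing_def A_RCOSETS_def RCOSETS_def a_r_coset_def)
qed

lemma quot_piece_vectorspace:
  assumes I: "ideal I poly_ring"
  shows "vectorspace class_ring (quot_piece I i)"
proof -
  let ?V = "quot_piece I i"
  have *: "x \<in> carrier ?V \<longleftrightarrow> (\<exists>a\<in>homog i. x = I +>\<^bsub>poly_ring\<^esub> a)" for x
    by (auto simp: quot_piece_def quot_homog_def)
  have add: "add ?V = add (poly_ring Quot I)" and zero: "zero ?V = I +>\<^bsub>poly_ring\<^esub> 0"
    and smult: "c \<odot>\<^bsub>?V\<^esub> A = (I +>\<^bsub>poly_ring\<^esub> const c) \<otimes>\<^bsub>poly_ring Quot I\<^esub> A" for c A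
    by (simp_all add: quot_piece_def coset_ops[OF I])
  have cm: "const c * a \<in> homog i" if "a \<in> homog i" for c a
    using homog_mult[OF homog_const that] by simp
  have "abelian_group ?V"
  proof (rule abelian_groupI)
    fix x assume "x \<in> carrier ?V"
    then obtain a where "a \<in> homog i" "x = I +>\<^bsub>poly_ring\<^esub> a" unfolding * by blast
    then show "\<exists>y\<in>carrier ?V. y \<oplus>\<^bsub>?V\<^esub> x = \<zero>\<^bsub>?V\<^esub>"
      unfolding * by (intro bexI[of _ "I +>\<^bsub>poly_ring\<^esub> (- a)"])
        (auto simp: add zero coset_ops[OF I] * intro: bexI[of _ "- a"])
  qed (auto simp: * add zero coset_ops[OF I] ac_simps intro: bexI homog_add)
  moreover have "Module.module class_ring ?V"
  proof (rule module.intro)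
    show "cring (class_ring :: 'a ring)" by (rule class_cring.cring_axioms[unfolded])
    show "module_axioms (class_ring :: 'a ring) ?V"
      by unfold_locales
        (auto simp: * add zero smult coset_ops[OF I] const_add const_mult[symmetric] const_one
          distrib_left distrib_right mult.assoc intro: bexI cm)
  qed fact
  ultimately show ?thesis
    by (intro vectorspace.intro class_field)
qed

lemma quot_piece_zero: "ideal I poly_ring \<Longrightarrow> \<zero>\<^bsub>quot_piece I i\<^esub> = I +>\<^bsub>poly_ring\<^esub> 0"
  by (simp add: quot_piece_def coset_ops(3))

lemma finsum_quot_piece:
  assumes I: "ideal I poly_ring" and "finite A" and "\<And>x. x \<in> A \<Longrightarrow> g x \<in> homog i"
  shows "finsum (quot_piece I i) (\<lambda>x. I +>\<^bsub>poly_ring\<^esub> g x) A = I +>\<^bsub>poly_ring\<^esub> (\<Sum>x\<in>A. g x)"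
proof -
  interpret vectorspace class_ring "quot_piece I i" by (rule quot_piece_vectorspace[OF I])
  have car: "(\<lambda>x. I +>\<^bsub>poly_ring\<^esub> g x) \<in> B \<rightarrow> carrier (quot_piece I i)" if "B \<subseteq> A" for B
    using that assms(3) by (auto simp: quot_piece_def quot_homog_def)
  have "finsum (quot_piece I i) (\<lambda>x. I +>\<^bsub>poly_ring\<^esub> g x) B = I +>\<^bsub>poly_ring\<^esub> (\<Sum>x\<in>B. g x)"
    if "finite B" "B \<subseteq> A" for B
    using that
  proof induction
    case empty
    show ?case
      by (simp only: M.finsum_empty sum.empty) (simp add: quot_piece_def coset_ops(3)[OF I])
  next
    case (insert x B)
    have "finsum (quot_piece I i) (\<lambda>x. I +>\<^bsub>poly_ring\<^esub> g x) (insert x B) =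
        (I +>\<^bsub>poly_ring\<^esub> g x) \<oplus>\<^bsub>quot_piece I i\<^esub> finsum (quot_piece I i) (\<lambda>x. I +>\<^bsub>poly_ring\<^esub> g x) B"
      using insert car[of B] car[of "{x}"] by (intro M.finsum_insert) auto
    with insert show ?case
      by (simp add: quot_piece_def coset_ops(1)[OF I])
  qed
  then show ?thesis using assms(2) by blast
qed

lemma lincomb_quot_piece:
  assumes I: "ideal I poly_ring" and "finite B" and "B \<subseteq> homog i" and inj: "inj_on (\<lambda>b. I +>\<^bsub>poly_ring\<^esub> b) B"
  shows "module.lincomb (quot_piece I i) k ((\<lambda>b. I +>\<^bsub>poly_ring\<^esub> b) ` B) =
    I +>\<^bsub>poly_ring\<^esub> (\<Sum>b\<in>B. const (k (I +>\<^bsub>poly_ring\<^esub> b)) * b)"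
proof -
  interpret vectorspace class_ring "quot_piece I i" by (rule quot_piece_vectorspace[OF I])
  have "const c * a \<in> homog i" if "a \<in> homog i" for c a
    using homog_mult[OF homog_const that] by simp
  then have eq: "finsum (quot_piece I i) (\<lambda>b. I +>\<^bsub>poly_ring\<^esub> (const (k (I +>\<^bsub>poly_ring\<^esub> b)) * b)) B =
      I +>\<^bsub>poly_ring\<^esub> (\<Sum>b\<in>B. const (k (I +>\<^bsub>poly_ring\<^esub> b)) * b)"
    using assms by (intro finsum_quot_piece) auto
  have sm: "k (I +>\<^bsub>poly_ring\<^esub> b) \<odot>\<^bsub>quot_piece I i\<^esub> (I +>\<^bsub>poly_ring\<^esub> b) =
      I +>\<^bsub>poly_ring\<^esub> (const (k (I +>\<^bsub>poly_ring\<^esub> b)) * b)" for b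
    by (simp add: quot_piece_def coset_ops(2)[OF I])
  moreover have "k v \<odot>\<^bsub>quot_piece I i\<^esub> v \<in> carrier (quot_piece I i)" if "v \<in> (\<lambda>b. I +>\<^bsub>poly_ring\<^esub> b) ` B" for v
    using that assms(3) by (intro smult_closed) (auto simp: quot_piece_def quot_homog_def)
  ultimately show ?thesis unfolding lincomb_def
    by (subst M.finsum_reindex[OF _ inj]) (simp_all add: sm eq Pi_def)
qed

lemma quot_piece_span:
  assumes I: "ideal I poly_ring" and finB: "finite B" and B: "B \<subseteq> homog i"
    and gen: "\<And>a. a \<in> homog i \<Longrightarrow> \<exists>k. a - (\<Sum>b\<in>B. const (k b) * b) \<in> I"
  shows "module.span class_ring (quot_piece I i) ((\<lambda>b. I +>\<^bsub>poly_ring\<^esub> b) ` B) = carrier (quot_piece I i)"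
proof -
  interpret vectorspace class_ring "quot_piece I i" by (rule quot_piece_vectorspace[OF I])
  let ?T = "\<lambda>b. I +>\<^bsub>poly_ring\<^esub> b"
  have car: "?T ` B \<subseteq> carrier (quot_piece I i)" using B by (auto simp: quot_piece_def quot_homog_def)
  have "?T a \<in> span (?T ` B)" if a: "a \<in> homog i" for a
  proof -
    obtain k where k: "a - (\<Sum>b\<in>B. const (k b) * b) \<in> I" using gen[OF a] by blast
    have "?T b \<in> span (?T ` B)" if "b \<in> B" for b
      using in_own_span[OF car] that by auto
    then have s: "?T (const c * b) \<in> span (?T ` B)" if "b \<in> B" for b c
      using submodule.smult_closed[OF span_is_submodule[OF car], of c "?T b"] that by (simp add: quot_piece_def coset_ops(2)[OF I])
    have "?T (\<Sum>b\<in>C. const (k b) * b) \<in> span (?T ` B)" if "finite C" "C \<subseteq> B" for C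
      using that
    proof induction
      case empty
      show ?case using span_zero[of "?T ` B"] by (simp add: quot_piece_def coset_ops(3)[OF I])
    next
      case (insert b C)
      then show ?case
        using span_add1[OF car s[of b "k b"], of "?T (\<Sum>b\<in>C. const (k b) * b)"]
        by (simp add: quot_piece_def coset_ops(1)[OF I])
    qed
    with finB have "?T (\<Sum>b\<in>B. const (k b) * b) \<in> span (?T ` B)" by blast
    moreover have "?T a = ?T (\<Sum>b\<in>B. const (k b) * b)" using k coset_eq_iff[OF I] by blast
    ultimately show ?thesis by simp
  qed
  then have "carrier (quot_piece I i) \<subseteq> span (?T ` B)"
    by (simp add: quot_piece_def quot_homog_def image_subset_iff)
  then show "gen_set (?T ` B)"
    by (intro subset_antisym[OF span_is_subset2[OF car]])
qed

lemma hilbert_fun_upper: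
  assumes I: "ideal I poly_ring" and finB: "finite B" and B: "B \<subseteq> homog i"
    and gen: "\<And>a. a \<in> homog i \<Longrightarrow> \<exists>k. a - (\<Sum>b\<in>B. const (k b) * b) \<in> I"
  shows "hilbert_fun I i \<le> card B"
proof -
  interpret vectorspace class_ring "quot_piece I i" by (rule quot_piece_vectorspace[OF I])
  have "dim \<le> card ((\<lambda>b. I +>\<^bsub>poly_ring\<^esub> b) ` B)"
    using finB B by (intro gen_ge_dim quot_piece_span[OF I finB B gen]) (auto simp: quot_piece_def quot_homog_def)
  also have "\<dots> \<le> card B" using finB by (rule card_image_le)
  finally show ?thesis by (simp add: hilbert_fun_def)
qed

text \<open>The finite generating set C certifies finite dimension, under which \<open>dim\<close>
  bounds the size of independent sets.\<close>

lemma hilbert_fun_lower: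
  assumes I: "ideal I poly_ring" and finB: "finite B" and B: "B \<subseteq> homog i"
    and indep: "\<And>k b. (\<Sum>b\<in>B. const (k b) * b) \<in> I \<Longrightarrow> b \<in> B \<Longrightarrow> k b = 0"
    and fgen: "finite C" "C \<subseteq> homog i" "\<And>a. a \<in> homog i \<Longrightarrow> \<exists>k. a - (\<Sum>b\<in>C. const (k b) * b) \<in> I"
  shows "card B \<le> hilbert_fun I i"
proof -
  interpret vectorspace class_ring "quot_piece I i" by (rule quot_piece_vectorspace[OF I])
  let ?T = "\<lambda>b. I +>\<^bsub>poly_ring\<^esub> b"
  have car: "?T ` A \<subseteq> carrier (quot_piece I i)" if "A \<subseteq> homog i" for A
    using that by (auto simp: quot_piece_def quot_homog_def)
  have fd: "fin_dim"
    unfolding fin_dim_def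
    by (intro exI[of _ "?T ` C"] conjI finite_imageI car fgen(1,2) quot_piece_span[OF I fgen(1,2)] fgen(3))
  have inj: "inj_on ?T B"
  proof (rule inj_onI, rule ccontr)
    fix b b' assume b: "b \<in> B" "b' \<in> B" "?T b = ?T b'" and ne: "b \<noteq> b'"
    \<comment> \<open>Two elements with equal cosets would satisfy the nontrivial relation with
      coefficients 1 and -1.\<close>
    define k where "k = (\<lambda>x. if x = b then 1 else if x = b' then - 1 else (0 :: 'a))"
    have "const (- 1) = - (1 :: 'a poly3)" by (simp add: const_def single_uminus)
    then have "(\<Sum>x\<in>B. const (k x) * x) = (\<Sum>x\<in>B. (if x = b then b else 0) + (if x = b' then - b' else 0))"
      using ne by (intro sum.cong) (auto simp: k_def const_zero const_one)
    also have "\<dots> = b - b'" using b finB by (simp add: sum.distrib)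
    also have "\<dots> \<in> I" using b(3) coset_eq_iff[OF I] by blast
    finally have "k b = 0" using indep[of k b] b(1) by simp
    then show False by (simp add: k_def)
  qed
  have "lin_indpt (?T ` B)"
  proof (rule finite_lin_indpt2)
    fix k assume "lincomb k (?T ` B) = \<zero>\<^bsub>quot_piece I i\<^esub>"
    then have "?T (\<Sum>b\<in>B. const (k (?T b)) * b) = ?T 0"
      unfolding lincomb_quot_piece[OF I finB B inj] quot_piece_zero[OF I] .
    then have "(\<Sum>b\<in>B. const (k (?T b)) * b) \<in> I" by (simp add: coset_eq_iff[OF I])
    from indep[OF this] show "\<forall>v\<in>?T ` B. k v = \<zero>\<^bsub>class_ring\<^esub>" by simp
  qed (use finB car[OF B] in auto)
  then have "card (?T ` B) \<le> dim" by (intro li_le_dim fd car B)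
  then show ?thesis by (simp add: hilbert_fun_def card_image[OF inj])
qed

section \<open>Counting monomials with all exponents below q\<close>

definition box_monomials :: "nat \<Rightarrow> int \<Rightarrow> (3 \<Rightarrow>\<^sub>0 nat) set" where
  "box_monomials q i = {m. int (mon_degree m) = i \<and> (\<forall>v. Poly_Mapping.lookup m v < q)}"

lemma mon_degree_three:
  "mon_degree m = Poly_Mapping.lookup m 0 + Poly_Mapping.lookup m 1 + Poly_Mapping.lookup m 2"
  by (simp add: mon_degree_def sum_three)

lemma all_three: "(\<forall>v::3. P v) \<longleftrightarrow> P 0 \<and> P 1 \<and> P 2"
  using three_cases by metis

text \<open>Exponents are integers here, so that negative degrees and the reflection of an exponent
  a to \<open>q - 1 - a\<close> involve no truncated subtraction.\<close>

definition triples :: "int \<Rightarrow> int \<Rightarrow> (int \<times> int \<times> int) set" where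
  "triples q n = {(a, b, c). 0 \<le> a \<and> a < q \<and> 0 \<le> b \<and> b < q \<and> 0 \<le> c \<and> c < q \<and> a + b + c = n}"

lemma finite_triples: "finite (triples q n)"
proof (rule finite_subset)
  show "triples q n \<subseteq> {0..<q} \<times> {0..<q} \<times> {0..<q}" by (auto simp: triples_def)
qed auto

lemma box_monomials_card: "finite (box_monomials q i)" "card (box_monomials q i) = card (triples (int q) i)"
proof -
  let ?F = "\<lambda>m :: 3 \<Rightarrow>\<^sub>0 nat. (int (Poly_Mapping.lookup m 0), int (Poly_Mapping.lookup m 1), int (Poly_Mapping.lookup m 2))"
  let ?G = "\<lambda>(a, b, c). Poly_Mapping.single 0 (nat a) + Poly_Mapping.single 1 (nat b) + Poly_Mapping.single (2::3) (nat c)"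
  have l: "Poly_Mapping.lookup (?G (a, b, c)) 0 = nat a" "Poly_Mapping.lookup (?G (a, b, c)) 1 = nat b"
    "Poly_Mapping.lookup (?G (a, b, c)) 2 = nat c" for a b c
    by (simp_all add: lookup_add lookup_single three_distinct)
  have "bij_betw ?F (box_monomials q i) (triples (int q) i)"
  proof (rule bij_betw_byWitness[where f' = ?G])
    show "\<forall>m\<in>box_monomials q i. ?G (?F m) = m"
    proof
      fix m :: "3 \<Rightarrow>\<^sub>0 nat"
      show "?G (?F m) = m"
      proof (rule poly_mapping_eqI)
        fix v :: 3
        show "Poly_Mapping.lookup (?G (?F m)) v = Poly_Mapping.lookup m v"
          using three_cases[of v] l[of "int (Poly_Mapping.lookup m 0)" "int (Poly_Mapping.lookup m 1)" "int (Poly_Mapping.lookup m 2)"]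
          by (metis nat_int)
      qed
    qed
    show "\<forall>t\<in>triples (int q) i. ?F (?G t) = t"
      by (auto simp: triples_def l[unfolded prod.case])
    show "?F ` box_monomials q i \<subseteq> triples (int q) i"
      by (auto simp: box_monomials_def triples_def mon_degree_three)
    show "?G ` triples (int q) i \<subseteq> box_monomials q i"
      by (auto simp: box_monomials_def triples_def mon_degree_three l[unfolded prod.case] all_three)
  qed
  then show "finite (box_monomials q i)" "card (box_monomials q i) = card (triples (int q) i)"
    using finite_triples[of "int q" i] bij_betw_finite bij_betw_same_card by blast+
qed

definition pairs :: "int \<Rightarrow> int \<Rightarrow> (int \<times> int) set" where
  "pairs q n = {(a, b). 0 \<le> a \<and> a < q \<and> 0 \<le> b \<and> b < q \<and> a + b = n}"

lemma card_pairs: "card (pairs q n) = nat (min (q - 1) n - max 0 (n - q + 1) + 1)"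
proof -
  have "bij_betw fst (pairs q n) {max 0 (n - q + 1)..min (q - 1) n}"
    by (rule bij_betw_byWitness[where f' = "\<lambda>a. (a, n - a)"]) (auto simp: pairs_def)
  then have "card (pairs q n) = card {max 0 (n - q + 1)..min (q - 1) n}" by (rule bij_betw_same_card)
  then show ?thesis by simp
qed

text \<open>Lowering the last exponent by one matches the triples of sum n + 1 with positive last
  exponent with those of sum n whose last exponent is at most \<open>q - 2\<close>. The unmatched
  triples on either side have a fixed last exponent and are pairs.\<close>

lemma triples_step:
  assumes "q \<ge> 1"
  shows "card (triples q (n + 1)) + card (pairs q (n - (q - 1))) = card (triples q n) + card (pairs q (n + 1))"
proof -
  let ?A = "{t \<in> triples q (n + 1). snd (snd t) \<ge> 1}" and ?B = "{t \<in> triples q (n + 1). snd (snd t) = 0}"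
  let ?C = "{t \<in> triples q n. snd (snd t) \<le> q - 2}" and ?D = "{t \<in> triples q n. snd (snd t) = q - 1}"
  have fin: "finite ?A" "finite ?B" "finite ?C" "finite ?D"
    by (auto intro: finite_subset[OF _ finite_triples])
  have "triples q (n + 1) = ?A \<union> ?B" "?A \<inter> ?B = {}" by (auto simp: triples_def)
  then have 1: "card (triples q (n + 1)) = card ?A + card ?B"
    using card_Un_disjoint[OF fin(1,2)] by metis
  have "triples q n = ?C \<union> ?D" "?C \<inter> ?D = {}" by (auto simp: triples_def)
  then have 2: "card (triples q n) = card ?C + card ?D"
    using card_Un_disjoint[OF fin(3,4)] by metis
  have "bij_betw (\<lambda>(a, b, c). (a, b, c - 1)) ?A ?C"
    by (rule bij_betw_byWitness[where f' = "\<lambda>(a, b, c). (a, b, c + 1)"]) (auto simp: triples_def)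
  moreover have "bij_betw (\<lambda>(a, b, c). (a, b)) ?B (pairs q (n + 1))"
    by (rule bij_betw_byWitness[where f' = "\<lambda>(a, b). (a, b, 0)"])
      (use assms in \<open>auto simp: triples_def pairs_def\<close>)
  moreover have "bij_betw (\<lambda>(a, b, c). (a, b)) ?D (pairs q (n - (q - 1)))"
    by (rule bij_betw_byWitness[where f' = "\<lambda>(a, b). (a, b, q - 1)"])
      (use assms in \<open>auto simp: triples_def pairs_def\<close>)
  ultimately show ?thesis using 1 2 by (simp add: bij_betw_same_card)
qed

text \<open>The number of pairs of sum n is larger the closer n lies to \<open>q - 1\<close>. Below
  the middle degree, the sum of the pairs gained in a step is closer to it than that of the pairs
  lost.\<close>

lemma triples_increasing:
  assumes "q \<ge> 1" and "i \<le> j" and "2 * j \<le> 3 * (q - 1)"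
  shows "card (triples q i) \<le> card (triples q j)"
  using assms(2,3)
proof (induction j rule: int_ge_induct)
  case (step j)
  have "card (pairs q (j - (q - 1))) \<le> card (pairs q (j + 1))"
    unfolding card_pairs using step.prems assms(1) by (intro nat_mono) (auto simp: min_def max_def)
  then have "card (triples q j) \<le> card (triples q (j + 1))" using triples_step[OF assms(1), of j] by linarith
  moreover have "card (triples q i) \<le> card (triples q j)" using step by simp
  ultimately show ?case by linarith
qed simp

lemma triples_symmetric: "card (triples q n) = card (triples q (3 * (q - 1) - n))"
  by (rule bij_betw_same_card[of "\<lambda>(a, b, c). (q - 1 - a, q - 1 - b, q - 1 - c)"],
      rule bij_betw_byWitness[where f' = "\<lambda>(a, b, c). (q - 1 - a, q - 1 - b, q - 1 - c)"])
    (auto simp: triples_def)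

text \<open>If \<open>s - i\<close> lies beyond the middle it is reflected back by symmetry. In the
  minimum that defines compressedness, the first term is therefore the smaller one whenever
  \<open>2 * i \<le> s\<close>.\<close>

lemma triples_unimodal:
  assumes "q \<ge> 1" and "2 * i \<le> s" and "s \<le> 3 * (q - 1)"
  shows "card (triples q i) \<le> card (triples q (s - i))"
proof (cases "2 * (s - i) \<le> 3 * (q - 1)")
  case True
  then show ?thesis using assms by (intro triples_increasing) auto
next
  case False
  then have "card (triples q i) \<le> card (triples q (3 * (q - 1) - (s - i)))"
    using assms by (intro triples_increasing) auto
  then show ?thesis using triples_symmetric[of q "s - i"] by simp
qed

section \<open>The Hilbert function of the ideal of powers and of larger ideals\<close>

abbreviation monomial :: "(3 \<Rightarrow>\<^sub>0 nat) \<Rightarrow> 'k::field poly3" where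
  "monomial m \<equiv> Poly_Mapping.single m 1"

lemma inj_monomial: "inj_on monomial M"
  by (rule inj_onI) (metis lookup_single_eq lookup_single_not_eq zero_neq_one)

lemma lookup_monomial_sum:
  fixes k :: "'k::field poly3 \<Rightarrow> 'k"
  assumes "finite M"
  shows "Poly_Mapping.lookup (\<Sum>b\<in>monomial ` M. const (k b) * b) n = (if n \<in> M then k (monomial n) else 0)"
proof -
  have "(\<Sum>b\<in>monomial ` M. const (k b) * b) = (\<Sum>m\<in>M. Poly_Mapping.single m (k (monomial m)))"
    by (simp add: sum.reindex[OF inj_monomial] const_def mult_single)
  then show ?thesis using assms
    by (simp add: lookup_sum lookup_single when_def)
qed

lemma monomial_homog: "m \<in> box_monomials q i \<Longrightarrow> monomial m \<in> homog i"
  by (auto simp: box_monomials_def homog_def split: if_splits)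

lemma homog_minus_box_sum:
  fixes a :: "'k::field poly3"
  assumes a: "a \<in> homog i" and M: "M \<subseteq> box_monomials q i"
    and zero: "\<And>m. m \<in> box_monomials q i - M \<Longrightarrow> Poly_Mapping.lookup a m = 0"
  shows "\<exists>k. a - (\<Sum>b\<in>monomial ` M. const (k b) * b) \<in> power_ideal q"
proof -
  have fin: "finite M" using M box_monomials_card(1) finite_subset by blast
  \<comment> \<open>Coefficients are indexed by the monomials as polynomials, so the exponent is
    recovered by inverting \<open>monomial\<close>.\<close>
  define k :: "'k poly3 \<Rightarrow> 'k" where "k = (\<lambda>b. Poly_Mapping.lookup a (inv_into UNIV monomial b))"
  have k: "k (monomial m) = Poly_Mapping.lookup a m" for m
    unfolding k_def by (subst inv_into_f_f[OF inj_monomial]) simp_all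
  have "a - (\<Sum>b\<in>monomial ` M. const (k b) * b) \<in> power_ideal q"
    unfolding power_ideal_keys
  proof (intro CollectI ballI, rule ccontr)
    fix m assume m: "m \<in> Poly_Mapping.keys (a - (\<Sum>b\<in>monomial ` M. const (k b) * b))"
      and "\<not> (\<exists>v. q \<le> Poly_Mapping.lookup m v)"
    then have lt: "\<And>v. Poly_Mapping.lookup m v < q" by (meson not_le)
    from m have "m \<notin> M" "Poly_Mapping.lookup a m \<noteq> 0"
      by (auto simp: in_keys_iff lookup_minus lookup_monomial_sum[OF fin] k split: if_splits)
    moreover from this have "m \<in> box_monomials q i"
      using lt homogD[OF a, of m] by (simp add: box_monomials_def in_keys_iff)
    ultimately show False using zero by blast
  qed
  then show ?thesis by (rule exI[of _ k])
qed

text \<open>A combination of box monomials in the ideal has no box monomial in its support, so all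
  its coefficients vanish; and the box monomials span the degree, because every other monomial lies
  in the ideal.\<close>

lemma hilbert_fun_power_ideal: "card (box_monomials q i) \<le> hilbert_fun (power_ideal q :: 'a::field poly3 set) i"
proof -
  let ?B = "monomial ` box_monomials q i :: 'a poly3 set"
  have "card ?B \<le> hilbert_fun (power_ideal q :: 'a poly3 set) i"
  proof (rule hilbert_fun_lower[where C = ?B])
    fix k and b :: "'a poly3"
    assume s: "(\<Sum>b\<in>?B. const (k b) * b) \<in> power_ideal q" and "b \<in> ?B"
    then obtain m where m: "m \<in> box_monomials q i" "b = monomial m" by blast
    show "k b = 0"
    proof (rule ccontr)
      assume "k b \<noteq> 0"
      then have "m \<in> Poly_Mapping.keys (\<Sum>b\<in>?B. const (k b) * b)"
        using m by (simp add: in_keys_iff lookup_monomial_sum[OF box_monomials_card(1)])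
      then obtain v where "q \<le> Poly_Mapping.lookup m v" using s unfolding power_ideal_keys by blast
      moreover have "Poly_Mapping.lookup m v < q" using m(1) by (simp add: box_monomials_def)
      ultimately show False by simp
    qed
  next
    fix a :: "'a poly3" assume "a \<in> homog i"
    then show "\<exists>k. a - (\<Sum>b\<in>?B. const (k b) * b) \<in> power_ideal q"
      by (rule homog_minus_box_sum) auto
  qed (auto intro: ideal_Idl box_monomials_card monomial_homog)
  then show ?thesis by (simp add: card_image[OF inj_monomial])
qed

text \<open>Some box monomial \<open>m0\<close> occurs in g. Modulo J it is a combination of the
  other monomials, so the box without \<open>m0\<close> already spans the quotient in degree
  i.\<close>

lemma hilbert_fun_less_box:
  assumes J: "ideal J poly_ring" and sub: "power_ideal q \<subseteq> J"
    and g: "g \<in> J" "g \<in> homog i" "g \<notin> power_ideal q"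
  shows "hilbert_fun J i < card (box_monomials q i)"
proof -
  obtain m0 where m0: "m0 \<in> Poly_Mapping.keys g" "\<And>v. Poly_Mapping.lookup m0 v < q"
    using g(3) unfolding power_ideal_keys by (auto simp: not_le)
  have g0: "Poly_Mapping.lookup g m0 \<noteq> 0" using m0(1) by (simp add: in_keys_iff)
  have m0b: "m0 \<in> box_monomials q i" using m0 homogD[OF g(2)] by (simp add: box_monomials_def)
  let ?M = "box_monomials q i - {m0}"
  have "hilbert_fun J i \<le> card (monomial ` ?M :: 'a poly3 set)"
  proof (rule hilbert_fun_upper[OF J])
    fix a :: "'a poly3" assume a: "a \<in> homog i"
    \<comment> \<open>Removes \<open>m0\<close> from a at the cost of an element of J.\<close>
    define a' where "a' = a - const (Poly_Mapping.lookup a m0 / Poly_Mapping.lookup g m0) * g"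
    have "const (Poly_Mapping.lookup a m0 / Poly_Mapping.lookup g m0) * g \<in> homog i"
      using homog_mult[OF homog_const g(2)] by simp
    then have "a' \<in> homog i" using a by (simp add: a'_def homog_minus)
    moreover have "Poly_Mapping.lookup a' m0 = 0"
      using g0 by (simp add: a'_def lookup_minus lookup_const_mult)
    ultimately obtain k where k: "a' - (\<Sum>b\<in>monomial ` ?M. const (k b) * b) \<in> power_ideal q"
      using homog_minus_box_sum[of a' i ?M q] by blast
    have "a - (\<Sum>b\<in>monomial ` ?M. const (k b) * b) = (a' - (\<Sum>b\<in>monomial ` ?M. const (k b) * b)) +
        const (Poly_Mapping.lookup a m0 / Poly_Mapping.lookup g m0) * g"
      by (simp add: a'_def)
    also have "\<dots> \<in> J"
      by (intro ideal_class_ringD(2,3)[OF J] g(1) subsetD[OF sub k])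
    finally show "\<exists>k. a - (\<Sum>b\<in>monomial ` ?M. const (k b) * b) \<in> J" by blast
  qed (auto intro: box_monomials_card monomial_homog)
  also have "\<dots> = card ?M" by (rule card_image[OF inj_monomial])
  also have "\<dots> < card (box_monomials q i)"
    using m0b box_monomials_card(1) by (intro psubset_card_mono) auto
  finally show ?thesis .
qed

section \<open>The link of \<open>f\<close>\<close>

lemma link_ideal_iff: "g \<in> link_ideal q f \<longleftrightarrow> g * f \<in> power_ideal q"
  by (simp add: link_ideal_def colon_def)

lemma ideal_link_ideal: "ideal (link_ideal q f) poly_ring"
  by (rule ideal_poly_ringI)
    (auto simp: link_ideal_iff distrib_right mult.assoc intro: ideal_class_ringD[OF ideal_Idl])

lemma power_ideal_subset_link: "power_ideal q \<subseteq> link_ideal q f"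
  using ideal_class_ringD(4)[OF ideal_Idl] by (auto simp: link_ideal_iff)

lemma lookup_single_mult:
  fixes p :: "'k::field poly3"
  shows "Poly_Mapping.lookup (Poly_Mapping.single n c * p) (n + m) = c * Poly_Mapping.lookup p m"
proof (induction p rule: poly_mapping_additive_induct)
  case (single m' c')
  show ?case by (simp add: mult_single lookup_single when_def)
qed (simp_all add: distrib_left lookup_add)

lemma Var_in_max_ideal: "Var v \<in> max_ideal"
  unfolding max_ideal_def using three_cases[of v] by (intro subsetD[OF Idl_superset]) auto

lemma sum_full_exponents:
  "(\<And>v. Poly_Mapping.lookup m v = n) \<Longrightarrow> mon_degree m = 3 * n"
  by (simp add: mon_degree_three)

text \<open>Let a represent a generator of the socle. Then \<open>a * f\<close> is outside the ideal
  of powers, but its product with any variable is inside. A box monomial of \<open>a * f\<close>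
  thus has all exponents equal to \<open>q - 1\<close>, and its degree is both
  \<open>3 * (q - 1)\<close> and \<open>s + d\<close>.\<close>

lemma link_socle_degree:
  fixes f :: "'k::field poly3"
  assumes f: "f \<in> homog (int d)" and gor: "gorenstein_of_socle_degree (link_ideal q f) s" and q: "q \<ge> 1"
  shows "s + int d = 3 * (int q - 1)"
proof -
  let ?J = "link_ideal q f"
  note J = ideal_link_ideal[of q f]
  obtain A where A: "A \<in> quot_homog ?J s" "A \<noteq> \<zero>\<^bsub>poly_ring Quot ?J\<^esub>"
    and soc: "quot_socle ?J = {(?J +>\<^bsub>poly_ring\<^esub> const c) \<otimes>\<^bsub>poly_ring Quot ?J\<^esub> A | c. True}"
    using gor unfolding gorenstein_of_socle_degree_def by blast
  obtain a where a: "a \<in> homog s" and Aa: "A = ?J +>\<^bsub>poly_ring\<^esub> a"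
    using A(1) by (auto simp: quot_homog_def)
  have "a \<notin> ?J"
  proof
    assume "a \<in> ?J"
    then have "A = ?J +>\<^bsub>poly_ring\<^esub> 0" unfolding Aa coset_eq_iff[OF J] by simp
    then show False using A(2) by (simp add: coset_ops(3)[OF J])
  qed
  then obtain m where m: "m \<in> Poly_Mapping.keys (a * f)" and lt: "\<And>v. Poly_Mapping.lookup m v < q"
    unfolding link_ideal_iff power_ideal_keys by (auto simp: not_le)
  have "(?J +>\<^bsub>poly_ring\<^esub> const 1) \<otimes>\<^bsub>poly_ring Quot ?J\<^esub> A = A"
    by (simp add: Aa coset_ops(2)[OF J] const_one)
  from sym[OF this] have "A \<in> quot_socle ?J" unfolding soc by (intro CollectI exI[of _ 1] conjI TrueI)
  have Va: "Var v * a \<in> ?J" for v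
  proof -
    have "(?J +>\<^bsub>poly_ring\<^esub> Var v) \<otimes>\<^bsub>poly_ring Quot ?J\<^esub> A = \<zero>\<^bsub>poly_ring Quot ?J\<^esub>"
      using \<open>A \<in> quot_socle ?J\<close> Var_in_max_ideal[of v] unfolding quot_socle_def by blast
    then have "?J +>\<^bsub>poly_ring\<^esub> (Var v * a) = ?J +>\<^bsub>poly_ring\<^esub> 0"
      by (simp only: Aa coset_ops(2,3)[OF J])
    then show ?thesis unfolding coset_eq_iff[OF J] by simp
  qed
  have "Poly_Mapping.lookup m v = q - 1" for v
  proof -
    have "Poly_Mapping.lookup (Var v * (a * f)) (Poly_Mapping.single v 1 + m) = Poly_Mapping.lookup (a * f) m"
      unfolding Var_def lookup_single_mult by simp
    then have "Poly_Mapping.single v 1 + m \<in> Poly_Mapping.keys (Var v * a * f)"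
      using m by (simp add: in_keys_iff mult.assoc)
    moreover have "Var v * a * f \<in> power_ideal q" using Va[of v] by (simp add: link_ideal_iff)
    ultimately obtain u where "q \<le> Poly_Mapping.lookup (Poly_Mapping.single v 1 + m) u"
      unfolding power_ideal_keys by blast
    then show ?thesis using lt[of u] by (auto simp: lookup_add lookup_single when_def split: if_splits)
  qed
  then have "mon_degree m = 3 * (q - 1)" by (rule sum_full_exponents)
  moreover have "int (mon_degree m) = s + int d" using homogD[OF homog_mult[OF a f] m] .
  ultimately show ?thesis using q by (simp add: of_nat_diff)
qed

text \<open>An element of the link outside the ideal of powers would push the Hilbert function of
  the link below the number of box monomials, whereas compressedness and unimodality keep it at
  least that large up to half the socle degree.\<close>

lemma link_low_degrees:
  fixes f :: "'k::field poly3"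
  assumes f: "f \<in> homog (int d)" and comp: "link_compressed q f" and q: "q \<ge> 1"
    and i: "2 * i \<le> 3 * (int q - 1) - int d" and g: "g \<in> link_ideal q f" "g \<in> homog i"
  shows "g \<in> power_ideal q"
proof (rule ccontr)
  assume ng: "g \<notin> power_ideal q"
  obtain s where gor: "gorenstein_of_socle_degree (link_ideal q f) s"
    and H: "\<And>i. hilbert_fun (link_ideal q f) i =
      min (hilbert_fun (power_ideal q :: 'k poly3 set) i) (hilbert_fun (power_ideal q :: 'k poly3 set) (s - i))"
    using comp unfolding link_compressed_def compressed_def by blast
  have s: "s = 3 * (int q - 1) - int d" using link_socle_degree[OF f gor q] by simp
  have "card (box_monomials q i) \<le> card (box_monomials q (s - i))"
    unfolding box_monomials_card(2) using q i s by (intro triples_unimodal) auto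
  then have "card (box_monomials q i) \<le> hilbert_fun (link_ideal q f) i"
    unfolding H using hilbert_fun_power_ideal[where 'a = 'k, of q i] hilbert_fun_power_ideal[where 'a = 'k, of q "s - i"]
    by (intro min.boundedI) linarith+
  moreover have "hilbert_fun (link_ideal q f) i < card (box_monomials q i)"
    by (rule hilbert_fun_less_box[OF ideal_link_ideal power_ideal_subset_link g ng])
  ultimately show False by simp
qed

text \<open>Multiply a monomial m of h, whose exponents are below q because \<open>D < q\<close>, by
  the complementary n, so that all exponents of \<open>n + m\<close> are \<open>q - 1\<close>. If
  \<open>D < d\<close>, the product of n with f exceeds the top degree \<open>3 * (q - 1)\<close>
  and n lies in the link; but its product with h contains the socle monomial.\<close>

lemma annihilator_degree:
  fixes h f :: "'k::field poly3"
  assumes f: "f \<in> homog (int d)" and h: "h \<in> homog D" "h \<noteq> 0" "D < int q"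
    and ann: "\<And>g. g \<in> link_ideal q f \<Longrightarrow> g * h \<in> power_ideal q"
  shows "int d \<le> D"
proof (rule ccontr)
  assume "\<not> int d \<le> D"
  then have Dd: "D < int d" by simp
  obtain m where m: "m \<in> Poly_Mapping.keys h" using h(2) keys_eq_empty[of h] by blast
  have deg: "int (mon_degree m) = D" by (rule homogD[OF h(1) m])
  have "Poly_Mapping.lookup m v \<le> mon_degree m" for v
    unfolding mon_degree_def by (rule member_le_sum) auto
  then have lt: "Poly_Mapping.lookup m v < q" for v
    using deg h(3) by (metis le_less_trans of_nat_less_iff)
  define n :: "3 \<Rightarrow>\<^sub>0 nat" where "n = Poly_Mapping.single 0 (q - 1 - Poly_Mapping.lookup m 0)
    + Poly_Mapping.single 1 (q - 1 - Poly_Mapping.lookup m 1) + Poly_Mapping.single 2 (q - 1 - Poly_Mapping.lookup m 2)"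
  have nm: "Poly_Mapping.lookup (n + m) v = q - 1" for v
    using three_cases[of v] lt[of v] by (auto simp: n_def lookup_add lookup_single three_distinct)
  then have "mon_degree (n + m) = 3 * (q - 1)" by (rule sum_full_exponents)
  then have dn: "int (mon_degree n) = 3 * (int q - 1) - D"
    using deg lt[of 0] by (simp add: mon_degree_add of_nat_diff)
  have "monomial n \<in> link_ideal q f"
    unfolding link_ideal_iff power_ideal_keys
  proof (intro CollectI ballI, rule ccontr)
    fix u assume u: "u \<in> Poly_Mapping.keys (monomial n * f)" and "\<not> (\<exists>v. q \<le> Poly_Mapping.lookup u v)"
    then have "Poly_Mapping.lookup u v \<le> q - 1" for v by (metis One_nat_def Suc_pred lt less_Suc_eq_le not_le not_less_zero neq0_conv)
    from this[of 0] this[of 1] this[of 2] have "mon_degree u \<le> 3 * (q - 1)" by (simp add: mon_degree_three)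
    moreover have "int (mon_degree u) = int (mon_degree n) + int d"
      using u by (intro homogD[OF homog_mult[OF _ f]]) (auto simp: homog_def split: if_splits)
    ultimately show False using dn Dd lt[of 0] by (simp add: of_nat_diff)
  qed
  then have "monomial n * h \<in> power_ideal q" by (rule ann)
  moreover have "n + m \<in> Poly_Mapping.keys (monomial n * h)"
    using m by (simp add: in_keys_iff lookup_single_mult)
  ultimately obtain v where "q \<le> Poly_Mapping.lookup (n + m) v" unfolding power_ideal_keys by blast
  then show False using nm[of v] lt[of v] by simp
qed

text \<open>Used to see that no generator is zero and that no entry of w lies in the ideal of
  powers.\<close>

lemma minimal_generators_nonredundant:
  assumes "minimal_homogeneous_generators gs I" and j: "j < length gs"
  shows "gs ! j \<notin> Idl\<^bsub>poly_ring\<^esub> (set (take j gs @ drop (Suc j) gs))" (is "_ \<notin> ?L")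
proof
  assume mem: "gs ! j \<in> ?L"
  have I: "Idl\<^bsub>poly_ring\<^esub> (set gs) = I" and ne: "?L \<noteq> I"
    using assms unfolding minimal_homogeneous_generators_def by blast+
  have gs: "set gs = insert (gs ! j) (set (take j gs @ drop (Suc j) gs))"
    using id_take_nth_drop[OF j] by (metis list.simps(15) set_append Un_insert_right)
  have "set gs \<subseteq> ?L" unfolding gs by (intro insert_subsetI mem Idl_superset)
  then have "I \<subseteq> ?L" unfolding I[symmetric] by (intro Idl_least ideal_Idl)
  moreover have "?L \<subseteq> I" unfolding I[symmetric] using Idl_superset[of "set gs"]
    by (intro Idl_least ideal_Idl) (auto simp: gs)
  ultimately show False using ne by blast
qed

lemma power_ideal_iff: "x \<in> power_ideal q \<longleftrightarrow> (\<exists>r\<in>carrier_vec 3. x = vec_of_list (power_gens q) \<bullet> r)"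
proof
  assume "x \<in> power_ideal q"
  then obtain c where c: "x = (\<Sum>i<3. c i * power_gens q ! i)" unfolding Idl_list by auto
  have "x = vec_of_list (power_gens q) \<bullet> vec 3 c"
    by (simp add: c scalar_prod_three sum_upto_three mult.commute)
  then show "\<exists>r\<in>carrier_vec 3. x = vec_of_list (power_gens q) \<bullet> r" by (rule bexI) simp
next
  assume "\<exists>r\<in>carrier_vec 3. x = vec_of_list (power_gens q) \<bullet> r"
  then obtain r where "r \<in> carrier_vec 3" "x = vec_of_list (power_gens q) \<bullet> r" by blast
  then have "x = (\<Sum>i<length (power_gens q). r $ i * power_gens q ! i)"
    by (simp add: scalar_prod_three sum_upto_three mult.commute)
  then show "x \<in> power_ideal q" unfolding Idl_list by blast
qed

lemma power_ideal_small_degree: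
  assumes "x \<in> power_ideal q" and "x \<in> homog i" and "i < int q"
  shows "x = 0"
proof (rule ccontr)
  assume "x \<noteq> 0"
  then obtain m where m: "m \<in> Poly_Mapping.keys x" using keys_eq_empty[of x] by blast
  then obtain v where "q \<le> Poly_Mapping.lookup m v" using assms(1) unfolding power_ideal_keys by blast
  also have "Poly_Mapping.lookup m v \<le> mon_degree m"
    unfolding mon_degree_def by (rule member_le_sum) auto
  finally show False using homogD[OF assms(2) m] assms(3) by linarith
qed

lemma hcomp_power_ideal: "x \<in> power_ideal q \<Longrightarrow> hcomp i x \<in> power_ideal q"
  unfolding power_ideal_keys by (auto simp: hcomp_def keys_restrict_keys)

lemma vec_of_list_append: "vec_of_list (xs @ ys) = vec_of_list xs @\<^sub>v vec_of_list ys"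
  by (rule eq_vecI) (auto simp: vec_of_list_index nth_append)

lemma homog_lookup_0: "a \<in> homog i \<Longrightarrow> a \<noteq> 0 \<Longrightarrow> Poly_Mapping.lookup a 0 = 0 \<Longrightarrow> 1 \<le> i"
proof (rule ccontr)
  assume a: "a \<in> homog i" "a \<noteq> 0" "Poly_Mapping.lookup a 0 = 0" and "\<not> 1 \<le> i"
  then have "i = 0" using homog_nonneg[OF a(2,1)] by simp
  then obtain c where "a = const c" using a(1) homog_0_const by blast
  then show False using a by (simp add: const_def)
qed

lemma sum_list_upt: "(\<Sum>i\<leftarrow>[0..<n]. g i) = (\<Sum>i<n. g i)"
  by (simp add: interv_sum_list_conv_sum_set_nat lessThan_atLeast0)

text \<open>A linear matrix of size 2n has minors with two indices removed, that is, with
  \<open>n - 1\<close> pairs left to match.\<close>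

lemma pf_minor_homog:
  assumes "\<And>i j. i \<in> set T \<Longrightarrow> j \<in> set T \<Longrightarrow> A $$ (i, j) \<in> homog 1"
    and "k < length T" and "l < length T" and "length T = 2 * n"
  shows "pf_minor A T k l \<in> homog (int n - 1)"
proof -
  have *: "pf A (del_nth i (del_nth j T)) \<in> homog (int n - 1)" if "i < j" "j < length T" for i j
  proof (rule pf_homog[where e = 1 and d = "\<lambda>_. 0"])
    show "2 * (int n - 1) = (\<Sum>i\<leftarrow>del_nth i (del_nth j T). 1 - 2 * 0)"
      using that assms(4) by (simp add: sum_list_triv)
  qed (use assms(1) in \<open>auto dest!: in_set_takeD in_set_dropD\<close>)
  have "(- 1) ^ r * a \<in> homog (int n - 1)" if "a \<in> homog (int n - 1)" for a :: "'a poly3" and r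
    using homog_mult[OF homog_sign that] by simp
  then show ?thesis using *[of k l] *[of l k] assms(2,3) by (auto simp: pf_minor_def)
qed

section \<open>The Buchsbaum--Eisenbud data of the link and their degrees\<close>

locale frobenius_link =
  fixes f :: "'k::field poly3" and q d m :: nat and ws :: "'k poly3 list"
    and X S \<psi> \<phi> :: "'k poly3 mat"
  assumes f_nonzero: "f \<noteq> 0" and f_homog: "f \<in> homog (int d)"
    and parity: "odd (q + d)" and q_ge: "q \<ge> d + 3"
    and compressed: "link_compressed q f"
    and ws: "length ws = m"
    and gens: "minimal_homogeneous_generators (power_gens q @ ws) (link_ideal q f)"
    and be: "buchsbaum_eisenbud_resolution (link_ideal q f) (power_gens q @ ws) X"
    and S: "S \<in> carrier_mat 3 3" and \<psi>: "\<psi> \<in> carrier_mat m 3" and \<phi>: "\<phi> \<in> carrier_mat m m"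
    and X: "X = four_block_mat S (- transpose_mat \<psi>) \<psi> \<phi>"
begin

definition gs where "gs = power_gens q @ ws"
definition a where "a = vec_of_list (power_gens q :: 'k poly3 list)"
definition w where "w = vec_of_list ws"
definition h where "h = pfaffian \<phi>"
definition \<phi>' where "\<phi>' = pf_adjoint \<phi>"

lemma gs_length: "length gs = 3 + m" by (simp add: gs_def ws)

lemma gs_nth: "l < 3 \<Longrightarrow> gs ! l = a $ l" "j < m \<Longrightarrow> gs ! (3 + j) = w $ j" "j < m \<Longrightarrow> ws ! j = w $ j"
  by (auto simp: gs_def nth_append a_def w_def vec_of_list_index)

lemma a_carrier [simp]: "a \<in> carrier_vec 3" and w_carrier [simp]: "w \<in> carrier_vec m"
  by (simp_all add: a_def w_def carrier_dim_vec ws)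

lemma a_nth: "a $ 0 = Var 0 ^ q" "a $ 1 = Var 1 ^ q" "a $ 2 = Var 2 ^ q"
  by (simp_all add: a_def del: One_nat_def)

lemma vec_gs: "vec_of_list gs = a @\<^sub>v w"
  by (simp add: gs_def a_def w_def vec_of_list_append)

lemma a_homog: "l < 3 \<Longrightarrow> a $ l \<in> homog (int q)" "l < 3 \<Longrightarrow> a $ l \<noteq> 0"
  by (auto simp: less_three a_nth Var_power_homog simp del: One_nat_def)

lemma gs_nonzero: "j < length gs \<Longrightarrow> gs ! j \<noteq> 0"
  using minimal_generators_nonredundant[OF gens, of j] ideal_class_ringD(1)[OF ideal_Idl]
  unfolding gs_def by metis

lemma w_notin: "j < m \<Longrightarrow> w $ j \<notin> power_ideal q"
proof
  assume j: "j < m" and mem: "w $ j \<in> power_ideal q"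
  have "set (power_gens q) \<subseteq> set (take (3 + j) gs @ drop (Suc (3 + j)) gs)"
    by (auto simp: gs_def)
  then have "power_ideal q \<subseteq> Idl\<^bsub>poly_ring\<^esub> (set (take (3 + j) gs @ drop (Suc (3 + j)) gs))"
    using Idl_superset by (intro Idl_least ideal_Idl) blast
  then show False
    using mem j minimal_generators_nonredundant[OF gens, of "3 + j"] gs_nth(2)[OF j]
    by (auto simp: gs_def ws)
qed

lemma link_eq: "link_ideal q f = Idl\<^bsub>poly_ring\<^esub> (set gs)"
  using gens by (simp add: minimal_homogeneous_generators_def gs_def)

lemma link_iff: "t \<in> link_ideal q f \<longleftrightarrow> (\<exists>r\<in>carrier_vec 3. \<exists>u\<in>carrier_vec m. t = a \<bullet> r + w \<bullet> u)"
proof -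
  have sum: "(\<Sum>i<length gs. c i * gs ! i) = a \<bullet> vec 3 c + w \<bullet> vec m (\<lambda>j. c (3 + j))" for c
  proof -
    have "(\<Sum>i<3 + m. c i * gs ! i) = (\<Sum>i<3. c i * gs ! i) + (\<Sum>j<m. c (3 + j) * gs ! (3 + j))"
      by (induction m) (simp_all only: add_Suc_right sum.lessThan_Suc add.assoc add_0_right lessThan_0 sum.empty)
    also have "(\<Sum>i<3. c i * gs ! i) = a \<bullet> vec 3 c"
      by (simp add: scalar_prod_def lessThan_atLeast0 gs_nth mult.commute)
    also have "(\<Sum>j<m. c (3 + j) * gs ! (3 + j)) = w \<bullet> vec m (\<lambda>j. c (3 + j))"
      by (simp add: scalar_prod_def lessThan_atLeast0 gs_nth mult.commute)
    finally show ?thesis by (simp add: gs_length)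
  qed
  show ?thesis
  proof
    assume "t \<in> link_ideal q f"
    then show "\<exists>r\<in>carrier_vec 3. \<exists>u\<in>carrier_vec m. t = a \<bullet> r + w \<bullet> u"
      unfolding link_eq Idl_list sum by fastforce
  next
    assume "\<exists>r\<in>carrier_vec 3. \<exists>u\<in>carrier_vec m. t = a \<bullet> r + w \<bullet> u"
    then obtain r u where ru: "r \<in> carrier_vec 3" "u \<in> carrier_vec m" "t = a \<bullet> r + w \<bullet> u" by blast
    define c where "c = (\<lambda>i. if i < 3 then r $ i else u $ (i - 3))"
    have "vec 3 c = r" "vec m (\<lambda>j. c (3 + j)) = u" using ru by (auto simp: c_def)
    then have "t = (\<Sum>i<length gs. c i * gs ! i)" by (simp add: sum ru(3))
    then show "t \<in> link_ideal q f" unfolding link_eq Idl_list by blast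
  qed
qed

lemma w_link: "j < m \<Longrightarrow> w $ j \<in> link_ideal q f"
  unfolding link_eq using ws by (intro subsetD[OF Idl_superset]) (simp add: gs_def flip: gs_nth(3))

lemma skew_X: "skew_symmetric X"
  using be by (simp add: buchsbaum_eisenbud_resolution_def)

lemma X_entries:
  "i < 3 \<Longrightarrow> j < 3 \<Longrightarrow> X $$ (i, j) = S $$ (i, j)"
  "i < m \<Longrightarrow> j < 3 \<Longrightarrow> X $$ (3 + i, j) = \<psi> $$ (i, j)"
  "i < m \<Longrightarrow> j < m \<Longrightarrow> X $$ (3 + i, 3 + j) = \<phi> $$ (i, j)"
  using S \<psi> \<phi> by (auto simp: X)

lemma dim_X: "dim_row X = 3 + m" "dim_col X = 3 + m"
  using S \<phi> by (auto simp: X)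

lemma skew_\<phi>: "skew_symmetric \<phi>"
  unfolding skew_symmetric_def
proof (intro conjI allI impI)
  fix i j assume "i < dim_row \<phi>" "j < dim_row \<phi>"
  then have "i < m" "j < m" using \<phi> by auto
  then show "\<phi> $$ (i, i) = 0" "\<phi> $$ (i, j) = - \<phi> $$ (j, i)"
    using skew_symmetricD[OF skew_X, of "3 + i" "3 + j"] dim_X by (simp_all only: X_entries)
qed (use \<phi> in auto)

lemma skew_S: "skew_symmetric S"
  unfolding skew_symmetric_def
proof (intro conjI allI impI)
  fix i j assume "i < dim_row S" "j < dim_row S"
  then have "i < 3" "j < 3" using S by auto
  then show "S $$ (i, i) = 0" "S $$ (i, j) = - S $$ (j, i)"
    using skew_symmetricD[OF skew_X, of i j] dim_X by (simp_all only: X_entries)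
qed (use S in auto)

lemma X_mult:
  assumes "x \<in> carrier_vec 3" and "y \<in> carrier_vec m"
  shows "X *\<^sub>v (x @\<^sub>v y) = (S *\<^sub>v x - transpose_mat \<psi> *\<^sub>v y) @\<^sub>v (\<psi> *\<^sub>v x + \<phi> *\<^sub>v y)"
proof -
  have "- transpose_mat \<psi> \<in> carrier_mat 3 m" using \<psi> by simp
  moreover have "- transpose_mat \<psi> *\<^sub>v y = - (transpose_mat \<psi> *\<^sub>v y)"
    using \<psi> assms by simp
  moreover have "S *\<^sub>v x + - (transpose_mat \<psi> *\<^sub>v y) = S *\<^sub>v x - transpose_mat \<psi> *\<^sub>v y"
    using S \<psi> by (intro eq_vecI) auto
  ultimately show ?thesis
    unfolding X using four_block_mat_mult_vec[OF S _ \<psi> \<phi> assms] by simp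
qed

definition res_degrees :: "int list \<Rightarrow> int \<Rightarrow> bool" where
  "res_degrees as e \<longleftrightarrow> length as = 3 + m \<and>
    (\<forall>j<3 + m. gs ! j \<in> homog (as ! j)) \<and>
    (\<forall>i<3 + m. \<forall>j<3 + m. X $$ (i, j) \<in> homog (e - as ! i - as ! j))"

lemma resolution:
  obtains as e where "res_degrees as e"
    and "\<And>i j. i < 3 + m \<Longrightarrow> j < 3 + m \<Longrightarrow> Poly_Mapping.lookup (X $$ (i, j)) 0 = 0"
    and "\<And>v. v \<in> carrier_vec (3 + m) \<Longrightarrow> vec_of_list gs \<bullet> v = 0 \<Longrightarrow> \<exists>u\<in>carrier_vec (3 + m). v = X *\<^sub>v u"
    and "X *\<^sub>v vec_of_list gs = 0\<^sub>v (3 + m)"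
proof -
  have be': "buchsbaum_eisenbud_resolution (link_ideal q f) gs X" using be by (simp add: gs_def)
  show ?thesis
  proof (rule buchsbaum_eisenbud_resolutionD[OF be' gs_nonzero])
    fix as e
    assume as: "length as = length gs" "\<And>j. j < length gs \<Longrightarrow> gs ! j \<in> homog (as ! j)"
      "\<And>i j. i < length gs \<Longrightarrow> j < length gs \<Longrightarrow> X $$ (i, j) \<in> homog (e - as ! i - as ! j)"
      and rest: "\<And>i j. i < length gs \<Longrightarrow> j < length gs \<Longrightarrow> Poly_Mapping.lookup (X $$ (i, j)) 0 = 0"
      "\<And>v. v \<in> carrier_vec (length gs) \<Longrightarrow> vec_of_list gs \<bullet> v = 0 \<Longrightarrow>
         \<exists>u\<in>carrier_vec (length gs). v = X *\<^sub>v u"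
      "X *\<^sub>v vec_of_list gs = 0\<^sub>v (length gs)"
    have "res_degrees as e" using as unfolding res_degrees_def gs_length by blast
    then show thesis using rest unfolding gs_length by (rule that)
  qed
qed

lemma pfaffian_link: "pfaffian_link m a w S \<psi> \<phi> \<phi>' h"
proof -
  obtain as e where
    ex: "\<And>v. v \<in> carrier_vec (3 + m) \<Longrightarrow> vec_of_list gs \<bullet> v = 0 \<Longrightarrow> \<exists>u\<in>carrier_vec (3 + m). v = X *\<^sub>v u"
    and zero: "X *\<^sub>v vec_of_list gs = 0\<^sub>v (3 + m)"
    using resolution by metis
  have "0\<^sub>v (3 + m) = 0\<^sub>v 3 @\<^sub>v (0\<^sub>v m :: 'k poly3 vec)" by (rule eq_vecI) auto
  then have "(S *\<^sub>v a - transpose_mat \<psi> *\<^sub>v w) @\<^sub>v (\<psi> *\<^sub>v a + \<phi> *\<^sub>v w) = 0\<^sub>v 3 @\<^sub>v 0\<^sub>v m"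
    using zero by (simp add: vec_gs X_mult)
  then have z: "S *\<^sub>v a - transpose_mat \<psi> *\<^sub>v w = 0\<^sub>v 3" "\<psi> *\<^sub>v a + \<phi> *\<^sub>v w = 0\<^sub>v m"
    using S \<psi> by (subst (asm) append_vec_eq[of _ 3]; simp add: carrier_dim_vec)+
  show ?thesis
  proof
    show "\<phi>' \<in> carrier_mat m m" using \<phi> by (auto simp: \<phi>'_def intro: carrier_matI)
    show "\<phi> * \<phi>' = h \<cdot>\<^sub>m 1\<^sub>m m" "\<phi>' * \<phi> = h \<cdot>\<^sub>m 1\<^sub>m m"
      using mult_pf_adjoint[OF \<phi> skew_\<phi>] pf_adjoint_mult[OF \<phi> skew_\<phi>] by (simp_all add: h_def \<phi>'_def)
    show "transpose_mat S = - S" "transpose_mat \<phi> = - \<phi>"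
      by (rule skew_symmetric_transpose[OF skew_S], rule skew_symmetric_transpose[OF skew_\<phi>])
    show "S *\<^sub>v a = transpose_mat \<psi> *\<^sub>v w"
    proof (rule eq_vecI)
      fix i assume i: "i < dim_vec (transpose_mat \<psi> *\<^sub>v w)"
      then show "(S *\<^sub>v a) $ i = (transpose_mat \<psi> *\<^sub>v w) $ i"
        using arg_cong[OF z(1), of "\<lambda>x. vec_index x i"] \<psi> by (simp del: index_mult_mat_vec)
    qed (use S \<psi> in auto)
    show "\<psi> *\<^sub>v a = - (\<phi> *\<^sub>v w)"
    proof (rule eq_vecI)
      fix i assume i: "i < dim_vec (- (\<phi> *\<^sub>v w))"
      then show "(\<psi> *\<^sub>v a) $ i = (- (\<phi> *\<^sub>v w)) $ i"
        using arg_cong[OF z(2), of "\<lambda>x. vec_index x i"] \<phi>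
        by (simp add: eq_neg_iff_add_eq_0 del: index_mult_mat_vec)
    qed (use \<psi> \<phi> in auto)
    show "a $ 0 \<noteq> 0" using a_homog(2)[of 0] by simp
    show "\<exists>x\<in>carrier_vec 3. r = koszul a x" if "r \<in> carrier_vec 3" "a \<bullet> r = 0" for r
      using power_koszul_exact1 that unfolding a_def by blast
    show "\<exists>g. x = g \<cdot>\<^sub>v a" if "x \<in> carrier_vec 3" "koszul a x = 0\<^sub>v 3" for x
      using power_koszul_exact2 that unfolding a_def by blast
    show "koszul a x = h \<cdot>\<^sub>v (S *\<^sub>v x) + transpose_mat \<psi> *\<^sub>v (\<phi>' *\<^sub>v (\<psi> *\<^sub>v x))"
      if "x \<in> carrier_vec 3" for x
      unfolding h_def \<phi>'_def
    proof (rule block_pf_koszul[OF S \<psi> \<phi> X skew_X _ that])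
      fix l :: nat assume l: "l < 3"
      then have "gs ! l = (- 1) ^ l * pf_del X {l}"
        using be by (simp add: buchsbaum_eisenbud_resolution_def gs_def ws)
      then show "a $ l = (- 1) ^ l * pf_del X {l}" by (simp add: gs_nth(1)[OF l])
    qed
    show "\<exists>s\<in>carrier_vec 3. \<exists>t\<in>carrier_vec m.
         r = S *\<^sub>v s - transpose_mat \<psi> *\<^sub>v t \<and> u = \<psi> *\<^sub>v s + \<phi> *\<^sub>v t"
      if r: "r \<in> carrier_vec 3" and u: "u \<in> carrier_vec m" and eq: "a \<bullet> r + w \<bullet> u = 0" for r u
    proof -
      have "vec_of_list gs \<bullet> (r @\<^sub>v u) = 0"
        unfolding vec_gs using scalar_prod_append[OF a_carrier w_carrier r u] eq by simp
      from ex[OF append_carrier_vec[OF r u] this]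
      obtain y where y: "y \<in> carrier_vec (3 + m)" "r @\<^sub>v u = X *\<^sub>v y" by blast
      define s t where "s = vec_first y 3" and "t = vec_last y m"
      have st: "s \<in> carrier_vec 3" "t \<in> carrier_vec m" "y = s @\<^sub>v t"
        using y(1) by (simp_all add: s_def t_def)
      have eq: "r @\<^sub>v u = (S *\<^sub>v s - transpose_mat \<psi> *\<^sub>v t) @\<^sub>v (\<psi> *\<^sub>v s + \<phi> *\<^sub>v t)"
        using y(2)[unfolded st(3) X_mult[OF st(1,2)]] .
      have "S *\<^sub>v s - transpose_mat \<psi> *\<^sub>v t \<in> carrier_vec 3" using S \<psi> st by simp
      from iffD1[OF append_vec_eq[OF r this] eq]
      have "r = S *\<^sub>v s - transpose_mat \<psi> *\<^sub>v t \<and> u = \<psi> *\<^sub>v s + \<phi> *\<^sub>v t" .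
      then show ?thesis using st by blast
    qed
  qed (use S \<psi> \<phi> in auto)
qed

sublocale link: pfaffian_link m a w S \<psi> \<phi> \<phi>' h
  by (rule pfaffian_link)

lemma f_not_in_power_ideal: "f \<notin> power_ideal q"
  using power_ideal_small_degree[of f q, OF _ f_homog] f_nonzero q_ge by auto

lemma h_annihilates: "g \<in> link_ideal q f \<Longrightarrow> g * h \<in> power_ideal q"
proof -
  assume "g \<in> link_ideal q f"
  then obtain r u where ru: "r \<in> carrier_vec 3" "u \<in> carrier_vec m" "g = a \<bullet> r + w \<bullet> u"
    unfolding link_iff by blast
  let ?s = "h \<cdot>\<^sub>v r + transpose_mat \<psi> *\<^sub>v (\<phi>' *\<^sub>v u)"
  have "g * h = a \<bullet> ?s"
    using ru by (simp add: scalar_prod_add_distrib[of _ 3] link.a_\<psi>t_\<phi>' carrier_vecD[OF ru(1)] algebra_simps)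
  moreover have "?s \<in> carrier_vec 3" using ru by simp
  ultimately show ?thesis unfolding power_ideal_iff a_def[symmetric] by blast
qed

lemma f_in_ideal: "\<exists>\<gamma>. \<exists>x\<in>power_ideal q. f = h * \<gamma> + x"
proof -
  have "\<exists>r. r \<in> carrier_vec 3 \<and> f * w $ j = a \<bullet> r" if "j < m" for j
    using w_link[OF that] unfolding link_ideal_iff power_ideal_iff a_def[symmetric]
    by (auto simp: mult.commute)
  then obtain b where b: "\<And>j. j < m \<Longrightarrow> b j \<in> carrier_vec 3 \<and> f * w $ j = a \<bullet> b j" by metis
  \<comment> \<open>The columns of B express f times the entries of w through a, as membership in
    the link provides; \<open>colon_subset\<close> is then applied with
    \<open>g = f\<close>.\<close>
  define B where "B = mat 3 m (\<lambda>(i, j). b j $ i)"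
  have B: "B \<in> carrier_mat 3 m" by (simp add: B_def)
  have Bij: "i < 3 \<Longrightarrow> j < m \<Longrightarrow> B $$ (i, j) = b j $ i" for i j by (simp add: B_def)
  have "a \<bullet> (B *\<^sub>v u) = f * (w \<bullet> u)" if u: "u \<in> carrier_vec m" for u
  proof -
    have "a \<bullet> (B *\<^sub>v u) = (\<Sum>j<m. a $ 0 * (b j $ 0 * u $ j) + a $ 1 * (b j $ 1 * u $ j) + a $ 2 * (b j $ 2 * u $ j))"
      using mult_mat_vec_carrier[OF B u] Bij
      by (simp add: scalar_prod_three mult_mat_vec_nth[OF B u] sum_distrib_left sum.distrib
          del: index_mult_mat_vec One_nat_def)
    also have "\<dots> = (\<Sum>j<m. f * (w $ j * u $ j))"
    proof (rule sum.cong[OF refl])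
      fix j assume "j \<in> {..<m}"
      then have "f * w $ j = a $ 0 * b j $ 0 + a $ 1 * b j $ 1 + a $ 2 * b j $ 2"
        using b[of j] by (simp add: scalar_prod_three del: One_nat_def)
      then have "f * w $ j * u $ j = (a $ 0 * b j $ 0 + a $ 1 * b j $ 1 + a $ 2 * b j $ 2) * u $ j" by simp
      then show "a $ 0 * (b j $ 0 * u $ j) + a $ 1 * (b j $ 1 * u $ j) + a $ 2 * (b j $ 2 * u $ j) =
          f * (w $ j * u $ j)" by (simp add: algebra_simps del: One_nat_def)
    qed
    also have "\<dots> = f * (w \<bullet> u)"
      using u by (auto simp: scalar_prod_def sum_distrib_left lessThan_atLeast0 intro!: sum.cong)
    finally show ?thesis .
  qed
  then obtain \<gamma> \<rho> where "\<rho> \<in> carrier_vec 3" "f = h * \<gamma> + a \<bullet> \<rho>"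
    using link.colon_subset[OF B] by blast
  moreover from this have "a \<bullet> \<rho> \<in> power_ideal q" unfolding power_ideal_iff a_def[symmetric] by blast
  ultimately show ?thesis by blast
qed

lemma h_nonzero: "h \<noteq> 0"
  using f_in_ideal f_not_in_power_ideal by auto

lemma even_m: "even m"
  using h_nonzero pf_odd[of "[0..<m]" \<phi>] \<phi> unfolding h_def pfaffian_eq_pf by auto

text \<open>The socle degree of the link and the lower bound for the degrees of the \<open>w\<^sub>j\<close>, which comes from
  compressedness, leave room only for linear entries in \<open>\<phi>\<close>.\<close>

lemma degrees:
  obtains as where "res_degrees as (3 * int q - int d)" and "h \<in> homog (int d)"
    and "\<exists>v. v \<noteq> 0 \<and> h = const v * f" and "m = 2 * d"
    and "\<And>j. j < 3 \<Longrightarrow> as ! j = int q" and "\<And>j. j < m \<Longrightarrow> 2 * as ! (3 + j) = 3 * int q - 1 - int d"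
proof -
  obtain as e where deg: "res_degrees as e"
    and min: "\<And>i j. i < 3 + m \<Longrightarrow> j < 3 + m \<Longrightarrow> Poly_Mapping.lookup (X $$ (i, j)) 0 = 0"
    using resolution by metis
  have gd: "gs ! j \<in> homog (as ! j)" if "j < 3 + m" for j using deg that by (simp add: res_degrees_def)
  have Xd: "X $$ (i, j) \<in> homog (e - as ! i - as ! j)" if "i < 3 + m" "j < 3 + m" for i j
    using deg that by (simp add: res_degrees_def)
  have as3: "as ! j = int q" if "j < 3" for j
    using gd[of j] a_homog[OF that] that homog_unique[of "a $ j"] by (simp add: gs_nth(1))
  obtain n where n: "m = 2 * n" using even_m by blast
  define D where "D = int n * e - (\<Sum>j<m. as ! (3 + j))"
  have D2: "2 * D = (\<Sum>j\<leftarrow>[0..<m]. e - 2 * as ! (3 + j))"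
    by (simp add: D_def sum_list_upt sum_subtractf sum_distrib_left n)
  have hD: "h \<in> homog D"
    unfolding h_def pfaffian_eq_pf
  proof (rule pf_homog[where d = "\<lambda>i. as ! (3 + i)" and e = e])
    show "2 * D = (\<Sum>i\<leftarrow>[0..<dim_row \<phi>]. e - 2 * as ! (3 + i))" using D2 \<phi> by simp
    show "\<phi> $$ (i, j) \<in> homog (e - as ! (3 + i) - as ! (3 + j))"
      if "i \<in> set [0..<dim_row \<phi>]" "j \<in> set [0..<dim_row \<phi>]" for i j
      using Xd[of "3 + i" "3 + j"] that \<phi> by (auto simp: X_entries)
  qed
  \<comment> \<open>The first entry of a is the Pfaffian on the indices 1, 2 and those of \<phi>.
    Its degree exceeds that of h by \<open>e - 2 * q\<close>, and this ties the last twist e to the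
    degree of h.\<close>
  have eD: "int q = e - 2 * int q + D"
  proof -
    have "a $ 0 = pf_del X {0}"
      using be gs_nth(1)[of 0] by (simp add: buchsbaum_eisenbud_resolution_def gs_def)
    moreover have "filter (\<lambda>i. i \<notin> {0}) [0..<3 + m] = [1, 2] @ map ((+) 3) [0..<m]"
    proof -
      have "[0..<3 + m] = 0 # 1 # 2 # [3..<3 + m]" by (simp add: upt_conv_Cons numeral_3_eq_3)
      moreover have "filter (\<lambda>i. i \<notin> {0}) [3..<3 + m] = [3..<3 + m]" by (intro filter_True) auto
      ultimately show ?thesis by (simp add: nth_upt_add[symmetric] del: upt_Suc)
    qed
    moreover have "pf X ([1, 2] @ map ((+) 3) [0..<m]) \<in> homog (e - 2 * int q + D)"
    proof (rule pf_homog[where d = "\<lambda>i. as ! i" and e = e])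
      show "X $$ (i, j) \<in> homog (e - as ! i - as ! j)"
        if "i \<in> set ([1, 2] @ map ((+) 3) [0..<m])" "j \<in> set ([1, 2] @ map ((+) 3) [0..<m])" for i j
        using that by (intro Xd) auto
      show "2 * (e - 2 * int q + D) = (\<Sum>i\<leftarrow>[1, 2] @ map ((+) 3) [0..<m]. e - 2 * as ! i)"
        using D2 as3[of 1] as3[of 2] by (simp add: o_def)
    qed
    ultimately have "a $ 0 \<in> homog (e - 2 * int q + D)" unfolding pf_del_def dim_X by simp
    then show ?thesis by (intro homog_unique[OF a_homog(2)[of 0] a_homog(1)[of 0]]) simp_all
  qed
  obtain \<gamma> x where fx: "x \<in> power_ideal q" "f = h * \<gamma> + x" using f_in_ideal by blast
  \<comment> \<open>Since \<open>d < q\<close>, the summand x from the ideal of powers has no part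
    in degree d. Taking components makes f an honest multiple of h.\<close>
  have "hcomp (int d) x = 0"
    using power_ideal_small_degree[OF hcomp_power_ideal[OF fx(1)] hcomp_homog] q_ge by simp
  moreover have "f = hcomp (int d) (\<gamma> * h + x)"
    using hcomp_id[OF f_homog] fx(2) by (simp add: mult.commute)
  ultimately have f\<gamma>: "f = hcomp (int d - D) \<gamma> * h"
    by (simp add: hcomp_add hcomp_mult[OF hD])
  then have "hcomp (int d - D) \<gamma> \<noteq> 0" using f_nonzero by auto
  then have "D \<le> int d" using homog_nonneg[OF _ hcomp_homog] by fastforce
  moreover have "int d \<le> D"
    by (rule annihilator_degree[OF f_homog hD h_nonzero _ h_annihilates])
      (use \<open>D \<le> int d\<close> q_ge in auto)
  ultimately have Dd: "D = int d" by simp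
  then have e: "e = 3 * int q - int d" using eD by simp
  have v: "\<exists>v. v \<noteq> 0 \<and> h = const v * f"
  proof -
    have "hcomp (int d - D) \<gamma> \<in> homog 0" using hcomp_homog[of "int d - D" \<gamma>] Dd by simp
    then obtain c where c: "hcomp (int d - D) \<gamma> = const c" using homog_0_const by blast
    have "c \<noteq> 0" using \<open>hcomp (int d - D) \<gamma> \<noteq> 0\<close> by (auto simp: c)
    then have "h = const (1 / c) * f"
      using f\<gamma> by (simp add: c const_mult const_one flip: mult.assoc)
    then show ?thesis using \<open>c \<noteq> 0\<close> by (intro exI[of _ "1 / c"]) auto
  qed
  have low: "2 * as ! (3 + j) \<ge> 3 * int q - 1 - int d" if j: "j < m" for j
  proof -
    have "w $ j \<in> homog (as ! (3 + j))" using gd[of "3 + j"] j by (simp add: gs_nth)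
    then have "\<not> 2 * as ! (3 + j) \<le> 3 * (int q - 1) - int d"
      using link_low_degrees[OF f_homog compressed _ _ w_link[OF j]] w_notin[OF j] q_ge by auto
    \<comment> \<open>Compressedness leaves \<open>3 * q - 2 - d\<close> as the smallest conceivable
      value of the doubled degree, and parity excludes it.\<close>
    moreover have "odd (3 * int q - 2 - int d)" using parity by auto
    then have "2 * as ! (3 + j) \<noteq> 3 * int q - 2 - int d" by (metis dvd_triv_left)
    ultimately show ?thesis by arith
  qed
  have high: "2 * as ! (3 + i) = 3 * int q - 1 - int d" if i: "i < m" for i
  proof -
    \<comment> \<open>A zero row of \<phi> would produce a zero diagonal entry in the product with
      its adjoint, which is h.\<close>
    have "\<exists>j<m. \<phi> $$ (i, j) \<noteq> 0"
    proof (rule ccontr)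
      assume "\<not> (\<exists>j<m. \<phi> $$ (i, j) \<noteq> 0)"
      then have "(\<phi> * \<phi>') $$ (i, i) = 0"
        using i \<phi> by (auto simp: scalar_prod_def intro!: sum.neutral)
      then show False using h_nonzero i by (simp add: link.\<phi>\<phi>')
    qed
    then obtain j where j: "j < m" "\<phi> $$ (i, j) \<noteq> 0" by blast
    \<comment> \<open>A nonzero entry without constant term has positive degree, so the degrees of
      \<open>w $ i\<close> and \<open>w $ j\<close> sum to at most \<open>3 * q - d - 1\<close>.
      That is the sum of their lower bounds, so equality holds in both.\<close>
    then have "1 \<le> e - as ! (3 + i) - as ! (3 + j)"
      using homog_lookup_0[OF Xd[of "3 + i" "3 + j"]] min[of "3 + i" "3 + j"] i by (simp add: X_entries)
    then show ?thesis using low[OF i] low[OF j(1)] e by linarith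
  qed
  have "2 * D = (\<Sum>j<m. 1)"
    unfolding D2 sum_list_upt by (rule sum.cong) (auto simp: high e)
  then have "m = 2 * d" using Dd by simp
  then show ?thesis using that[of as] deg hD v as3 high Dd e by simp
qed

end

section \<open>Uniqueness of the twists of a minimal graded resolution\<close>

definition graded_mat :: "int list \<Rightarrow> int list \<Rightarrow> 'k::field poly3 mat \<Rightarrow> bool" where
  "graded_mat rs cs A \<longleftrightarrow> A \<in> carrier_mat (length rs) (length cs) \<and>
     (\<forall>r<length rs. \<forall>c<length cs. A $$ (r, c) \<in> homog (cs ! c - rs ! r))"

lemma graded_matD:
  assumes "graded_mat rs cs A"
  shows "A \<in> carrier_mat (length rs) (length cs)"
    and "\<And>r c. r < length rs \<Longrightarrow> c < length cs \<Longrightarrow> A $$ (r, c) \<in> homog (cs ! c - rs ! r)"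
  using assms unfolding graded_mat_def by blast+

lemma mat_mult_nth:
  assumes "A \<in> carrier_mat nr n" and "B \<in> carrier_mat n nc" and "i < nr" and "j < nc"
  shows "(A * B) $$ (i, j) = (\<Sum>k<n. A $$ (i, k) * B $$ (k, j))"
  using assms by (auto simp: scalar_prod_def lessThan_atLeast0 intro!: sum.cong)

lemma graded_mat_mult:
  assumes A: "graded_mat as bs A" and B: "graded_mat bs cs B"
  shows "graded_mat as cs (A * B)"
  unfolding graded_mat_def
proof (intro conjI allI impI)
  fix r c assume rc: "r < length as" "c < length cs"
  have "A $$ (r, k) * B $$ (k, c) \<in> homog (cs ! c - as ! r)" if "k < length bs" for k
    using homog_mult[OF graded_matD(2)[OF A rc(1) that] graded_matD(2)[OF B that rc(2)]] by simp
  then show "(A * B) $$ (r, c) \<in> homog (cs ! c - as ! r)"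
    unfolding mat_mult_nth[OF graded_matD(1)[OF A] graded_matD(1)[OF B] rc] by (intro homog_sum) auto
qed (use graded_matD(1)[OF A] graded_matD(1)[OF B] in auto)

lemma mat_lift:
  fixes D M :: "'r::comm_ring_1 mat"
  assumes D: "D \<in> carrier_mat nr n" and M: "M \<in> carrier_mat nr nc"
    and im: "\<And>c. c < nc \<Longrightarrow> \<exists>u\<in>carrier_vec n. M *\<^sub>v unit_vec nc c = D *\<^sub>v u"
  shows "\<exists>N\<in>carrier_mat n nc. D * N = M"
proof -
  obtain u where u: "\<And>c. c < nc \<Longrightarrow> u c \<in> carrier_vec n \<and> M *\<^sub>v unit_vec nc c = D *\<^sub>v u c"
    using im by metis
  define N where "N = mat n nc (\<lambda>(i, c). u c $ i)"
  have N: "N \<in> carrier_mat n nc" by (simp add: N_def)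
  have "col (D * N) c = col M c" if "c < nc" for c
  proof -
    have "col N c = u c" using u[OF that] that by (intro eq_vecI) (auto simp: N_def)
    then show ?thesis
      using col_mult2[OF D N that] u[OF that] that by (simp add: col_eq_mult_unit[OF M that])
  qed
  then have "D * N = M"
    using D M N by (intro mat_col_eqI) auto
  then show ?thesis using N by blast
qed

text \<open>Any lift can be made graded by replacing each entry with its component of the required
  degree, because taking components commutes with multiplication by the homogeneous entries of
  D.\<close>

lemma graded_lift:
  assumes D: "graded_mat rs ks D" and M: "graded_mat rs cs M"
    and im: "\<And>c. c < length cs \<Longrightarrow> \<exists>u\<in>carrier_vec (length ks). M *\<^sub>v unit_vec (length cs) c = D *\<^sub>v u"
  shows "\<exists>N. graded_mat ks cs N \<and> D * N = M"
proof -
  obtain N where N: "N \<in> carrier_mat (length ks) (length cs)" and DN: "D * N = M"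
    using mat_lift[OF graded_matD(1)[OF D] graded_matD(1)[OF M] im] by blast
  define N' where "N' = mat (length ks) (length cs) (\<lambda>(k, c). hcomp (cs ! c - ks ! k) (N $$ (k, c)))"
  have N': "N' \<in> carrier_mat (length ks) (length cs)" by (simp add: N'_def)
  have "graded_mat ks cs N'" by (simp add: graded_mat_def N'_def)
  moreover have "D * N' = M"
  proof (rule eq_matI)
    fix r c assume "r < dim_row M" "c < dim_col M"
    then have rc: "r < length rs" "c < length cs" using graded_matD(1)[OF M] by auto
    have "(D * N') $$ (r, c) = (\<Sum>k<length ks. D $$ (r, k) * hcomp (cs ! c - ks ! k) (N $$ (k, c)))"
      using mat_mult_nth[OF graded_matD(1)[OF D] N' rc] rc by (simp add: N'_def)
    also have "\<dots> = (\<Sum>k<length ks. hcomp (cs ! c - rs ! r) (D $$ (r, k) * N $$ (k, c)))"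
    proof (rule sum.cong[OF refl])
      fix k assume "k \<in> {..<length ks}"
      then have "hcomp (cs ! c - rs ! r) (N $$ (k, c) * D $$ (r, k)) =
          hcomp (cs ! c - rs ! r - (ks ! k - rs ! r)) (N $$ (k, c)) * D $$ (r, k)"
        using graded_matD(2)[OF D rc(1)] by (intro hcomp_mult) auto
      then show "D $$ (r, k) * hcomp (cs ! c - ks ! k) (N $$ (k, c)) =
          hcomp (cs ! c - rs ! r) (D $$ (r, k) * N $$ (k, c))"
        by (simp add: mult.commute)
    qed
    also have "\<dots> = hcomp (cs ! c - rs ! r) ((D * N) $$ (r, c))"
      unfolding mat_mult_nth[OF graded_matD(1)[OF D] N rc] hcomp_sum ..
    also have "\<dots> = M $$ (r, c)"
      unfolding DN by (rule hcomp_id[OF graded_matD(2)[OF M rc]])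
    finally show "(D * N') $$ (r, c) = M $$ (r, c)" .
  qed (use graded_matD(1)[OF D] graded_matD(1)[OF M] N' in auto)
  ultimately show ?thesis by blast
qed

lemma mat_eq_zeroI:
  fixes A :: "'r::comm_ring_1 mat"
  assumes A: "A \<in> carrier_mat nr nc" and "\<And>u. u \<in> carrier_vec nc \<Longrightarrow> A *\<^sub>v u = 0\<^sub>v nr"
  shows "A = 0\<^sub>m nr nc"
proof (rule mat_col_eqI)
  fix j assume "j < dim_col (0\<^sub>m nr nc :: 'r mat)"
  then show "col A j = col (0\<^sub>m nr nc) j"
    using assms(2)[of "unit_vec nc j"] by (simp add: col_eq_mult_unit[OF A])
qed (use A in simp_all)

locale min_resolution =
  fixes I :: "'k::field poly3 set" and tw :: "nat \<Rightarrow> int list" and D :: "nat \<Rightarrow> 'k poly3 mat"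
  assumes res: "minimal_graded_resolution poly_ring homog I tw D"
begin

lemma D_graded: "graded_mat (tw i) (tw (Suc i)) (D i)"
  using conjunct1[OF res[unfolded minimal_graded_resolution_poly]]
    conjunct1[OF conjunct2[OF res[unfolded minimal_graded_resolution_poly]]]
  by (simp add: graded_mat_def)

lemma D_carrier: "D i \<in> carrier_mat (length (tw i)) (length (tw (Suc i)))"
  by (rule graded_matD(1)[OF D_graded])

lemma tw_0: "tw 0 = [0]"
  using res unfolding minimal_graded_resolution_poly by blast

lemma image_D0: "x \<in> I \<longleftrightarrow> (\<exists>v\<in>carrier_vec (length (tw 1)). x = (D 0 *\<^sub>v v) $ 0)"
proof -
  have "{(D 0 *\<^sub>v v) $ 0 | v. v \<in> carrier_vec (length (tw 1))} = I"
    using res unfolding minimal_graded_resolution_poly by blast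
  then show ?thesis by blast
qed

lemma exact: "v \<in> carrier_vec (length (tw (Suc i))) \<Longrightarrow> D i *\<^sub>v v = 0\<^sub>v (length (tw i)) \<longleftrightarrow>
    (\<exists>u\<in>carrier_vec (length (tw (Suc (Suc i)))). v = D (Suc i) *\<^sub>v u)"
  using res unfolding minimal_graded_resolution_poly by blast

lemma D_minimal: "r < length (tw i) \<Longrightarrow> c < length (tw (Suc i)) \<Longrightarrow> Poly_Mapping.lookup (D i $$ (r, c)) 0 = 0"
  using res unfolding minimal_graded_resolution_poly by blast

lemma D_D: "D i * D (Suc i) = 0\<^sub>m (length (tw i)) (length (tw (Suc (Suc i))))"
proof (rule mat_eq_zeroI)
  fix u :: "'k poly3 vec" assume u: "u \<in> carrier_vec (length (tw (Suc (Suc i))))"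
  have "D (Suc i) *\<^sub>v u \<in> carrier_vec (length (tw (Suc i)))"
    using mult_mat_vec_carrier[OF D_carrier u] .
  then have "D i *\<^sub>v (D (Suc i) *\<^sub>v u) = 0\<^sub>v (length (tw i))" using exact u by blast
  then show "D i * D (Suc i) *\<^sub>v u = 0\<^sub>v (length (tw i))"
    using assoc_mult_mat_vec[OF D_carrier D_carrier u] by simp
qed (use D_carrier[of i] D_carrier[of "Suc i"] in auto)

end

text \<open>The last clause says that \<open>h\<close> is one component of a homotopy between \<open>\<beta>\<alpha>\<close> and the identity: its
  other component vanishes on the image of \<open>D i\<close>.\<close>

definition comparison ::
  "(nat \<Rightarrow> int list) \<Rightarrow> (nat \<Rightarrow> 'k::field poly3 mat) \<Rightarrow> (nat \<Rightarrow> int list) \<Rightarrow> (nat \<Rightarrow> 'k poly3 mat) \<Rightarrow> nat \<Rightarrow>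
    'k poly3 mat \<Rightarrow> 'k poly3 mat \<Rightarrow> 'k poly3 mat \<Rightarrow> bool" where
  "comparison tw D tw' D' i \<alpha> \<beta> h \<longleftrightarrow>
     graded_mat (tw' i) (tw i) \<alpha> \<and> graded_mat (tw i) (tw' i) \<beta> \<and>
     h \<in> carrier_mat (length (tw (Suc i))) (length (tw i)) \<and>
     (\<forall>u\<in>carrier_vec (length (tw (Suc i))). \<exists>u'\<in>carrier_vec (length (tw' (Suc i))).
        \<alpha> *\<^sub>v (D i *\<^sub>v u) = D' i *\<^sub>v u') \<and>
     (\<forall>u\<in>carrier_vec (length (tw' (Suc i))). \<exists>u'\<in>carrier_vec (length (tw (Suc i))).
        \<beta> *\<^sub>v (D' i *\<^sub>v u) = D i *\<^sub>v u') \<and>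
     \<beta> * (\<alpha> * D i) = D i + D i * (h * D i)"

lemma comparison_0:
  fixes I :: "'k::field poly3 set"
  assumes "min_resolution I tw D" and "min_resolution I tw' D'"
  shows "comparison tw D tw' D' 0 (1\<^sub>m 1) (1\<^sub>m 1) (0\<^sub>m (length (tw 1)) 1)"
proof -
  interpret F: min_resolution I tw D by fact
  interpret G: min_resolution I tw' D' by fact
  have len: "length (tw 0) = 1" "length (tw' 0) = 1" by (simp_all add: F.tw_0 G.tw_0)
  have D: "D 0 \<in> carrier_mat 1 (length (tw 1))" "D' 0 \<in> carrier_mat 1 (length (tw' 1))"
    using F.D_carrier[of 0] G.D_carrier[of 0] by (simp_all add: len)
  have one: "1\<^sub>m 1 *\<^sub>v v = v" if "dim_vec v = 1" for v :: "'k poly3 vec"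
    by (rule one_mult_mat_vec[OF carrier_vecI[OF that]])
  have sing: "x = y" if "dim_vec x = 1" "dim_vec y = 1" "x $ 0 = y $ 0" for x y :: "'k poly3 vec"
    using that by (intro eq_vecI) auto
  have "\<exists>u'\<in>carrier_vec (length (tw' 1)). D 0 *\<^sub>v u = D' 0 *\<^sub>v u'" if "u \<in> carrier_vec (length (tw 1))" for u
  proof -
    have "(D 0 *\<^sub>v u) $ 0 \<in> I" using that F.image_D0 by blast
    then obtain u' where "u' \<in> carrier_vec (length (tw' 1))" "(D 0 *\<^sub>v u) $ 0 = (D' 0 *\<^sub>v u') $ 0"
      unfolding G.image_D0 by blast
    then show ?thesis using D by (intro bexI[of _ u'] sing) auto
  qed
  moreover have "\<exists>u'\<in>carrier_vec (length (tw 1)). D' 0 *\<^sub>v u = D 0 *\<^sub>v u'" if "u \<in> carrier_vec (length (tw' 1))" for u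
  proof -
    have "(D' 0 *\<^sub>v u) $ 0 \<in> I" using that G.image_D0 by blast
    then obtain u' where "u' \<in> carrier_vec (length (tw 1))" "(D' 0 *\<^sub>v u) $ 0 = (D 0 *\<^sub>v u') $ 0"
      unfolding F.image_D0 by blast
    then show ?thesis using D by (intro bexI[of _ u'] sing) auto
  qed
  moreover have "graded_mat [0] [0] (1\<^sub>m 1 :: 'k poly3 mat)" by (simp add: graded_mat_def)
  moreover have "1\<^sub>m 1 * (1\<^sub>m 1 * D 0) = D 0 + D 0 * (0\<^sub>m (length (tw 1)) 1 * D 0)"
    using D by simp
  ultimately show ?thesis
    using D by (simp add: comparison_def F.tw_0 G.tw_0 one)
qed

text \<open>New components are lifts of \<open>\<alpha> * D i\<close> and
  \<open>\<beta> * D' i\<close>. The homotopy equation says that D i annihilates \<beta>' \<alpha>'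
  - 1 - h D i, so exactness provides h'; the next homotopy equation follows because consecutive
  differentials compose to zero. The homotopy is left ungraded, since only constant terms are read
  off from it.\<close>

lemma comparison_Suc:
  fixes I :: "'k::field poly3 set"
  assumes "min_resolution I tw D" and "min_resolution I tw' D'"
    and comp: "comparison tw D tw' D' i \<alpha> \<beta> h"
  obtains \<alpha>' \<beta>' h' where "comparison tw D tw' D' (Suc i) \<alpha>' \<beta>' h'"
    and "\<beta>' * \<alpha>' = (1\<^sub>m (length (tw (Suc i))) + h * D i) + D (Suc i) * h'"
proof -
  interpret F: min_resolution I tw D by fact
  interpret G: min_resolution I tw' D' by fact
  let ?n = "\<lambda>i. length (tw i)" and ?n' = "\<lambda>i. length (tw' i)"
  have \<alpha>: "graded_mat (tw' i) (tw i) \<alpha>" and \<beta>: "graded_mat (tw i) (tw' i) \<beta>"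
    and h: "h \<in> carrier_mat (?n (Suc i)) (?n i)"
    and \<alpha>im: "\<And>u. u \<in> carrier_vec (?n (Suc i)) \<Longrightarrow> \<exists>u'\<in>carrier_vec (?n' (Suc i)). \<alpha> *\<^sub>v (D i *\<^sub>v u) = D' i *\<^sub>v u'"
    and \<beta>im: "\<And>u. u \<in> carrier_vec (?n' (Suc i)) \<Longrightarrow> \<exists>u'\<in>carrier_vec (?n (Suc i)). \<beta> *\<^sub>v (D' i *\<^sub>v u) = D i *\<^sub>v u'"
    and eq: "\<beta> * (\<alpha> * D i) = D i + D i * (h * D i)"
    using comp unfolding comparison_def by blast+
  note \<alpha>c = graded_matD(1)[OF \<alpha>] and \<beta>c = graded_matD(1)[OF \<beta>]
  note Dc = F.D_carrier[of i] and D1c = F.D_carrier[of "Suc i"]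
    and D'c = G.D_carrier[of i] and D1'c = G.D_carrier[of "Suc i"]
  obtain \<alpha>' where \<alpha>': "graded_mat (tw' (Suc i)) (tw (Suc i)) \<alpha>'" and D\<alpha>': "D' i * \<alpha>' = \<alpha> * D i"
    using graded_lift[OF G.D_graded[of i] graded_mat_mult[OF \<alpha> F.D_graded[of i]]] \<alpha>im
    by (auto simp: assoc_mult_mat_vec[OF \<alpha>c Dc])
  obtain \<beta>' where \<beta>': "graded_mat (tw (Suc i)) (tw' (Suc i)) \<beta>'" and D\<beta>': "D i * \<beta>' = \<beta> * D' i"
    using graded_lift[OF F.D_graded[of i] graded_mat_mult[OF \<beta> G.D_graded[of i]]] \<beta>im
    by (auto simp: assoc_mult_mat_vec[OF \<beta>c D'c])
  note \<alpha>'c = graded_matD(1)[OF \<alpha>'] and \<beta>'c = graded_matD(1)[OF \<beta>']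
  have hD: "h * D i \<in> carrier_mat (?n (Suc i)) (?n (Suc i))" using h Dc by simp
  have ba: "\<beta>' * \<alpha>' \<in> carrier_mat (?n (Suc i)) (?n (Suc i))" using \<alpha>'c \<beta>'c by simp
  have B: "1\<^sub>m (?n (Suc i)) + h * D i \<in> carrier_mat (?n (Suc i)) (?n (Suc i))" using hD by simp
  define N where "N = \<beta>' * \<alpha>' - (1\<^sub>m (?n (Suc i)) + h * D i)"
  have N: "N \<in> carrier_mat (?n (Suc i)) (?n (Suc i))" unfolding N_def by (rule minus_carrier_mat[OF B])
  have "D i * (\<beta>' * \<alpha>') = \<beta> * (\<alpha> * D i)"
    by (simp only: assoc_mult_mat[OF Dc \<beta>'c \<alpha>'c, symmetric] D\<beta>' assoc_mult_mat[OF \<beta>c D'c \<alpha>'c] D\<alpha>')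
  moreover have "D i * (1\<^sub>m (?n (Suc i)) + h * D i) = D i + D i * (h * D i)"
    using mult_add_distrib_mat[OF Dc one_carrier_mat hD] right_mult_one_mat[OF Dc] by simp
  ultimately have "D i * N = D i * (\<beta>' * \<alpha>') - D i * (\<beta>' * \<alpha>')"
    unfolding N_def mult_minus_distrib_mat[OF Dc ba B] eq by simp
  then have DN: "D i * N = 0\<^sub>m (?n i) (?n (Suc i))"
    using Dc ba by (simp add: minus_r_inv_mat[of _ "?n i" "?n (Suc i)"])
  have "\<exists>u\<in>carrier_vec (?n (Suc (Suc i))). N *\<^sub>v unit_vec (?n (Suc i)) c = D (Suc i) *\<^sub>v u" if "c < ?n (Suc i)" for c
  proof -
    let ?e = "unit_vec (?n (Suc i)) c :: 'k poly3 vec"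
    have "D i *\<^sub>v (N *\<^sub>v ?e) = 0\<^sub>m (?n i) (?n (Suc i)) *\<^sub>v ?e"
      using assoc_mult_mat_vec[OF Dc N, of ?e] DN by simp
    also have "\<dots> = 0\<^sub>v (?n i)" by (rule eq_vecI) auto
    finally show ?thesis
      using F.exact[of "N *\<^sub>v ?e" i] mult_mat_vec_carrier[OF N, of ?e] by simp
  qed
  then obtain h' where h': "h' \<in> carrier_mat (?n (Suc (Suc i))) (?n (Suc i))" and Nh: "D (Suc i) * h' = N"
    using mat_lift[OF D1c N] by blast
  have main: "\<beta>' * \<alpha>' = (1\<^sub>m (?n (Suc i)) + h * D i) + D (Suc i) * h'"
  proof -
    have "P = Q + (P - Q)" if "P \<in> carrier_mat n k" "Q \<in> carrier_mat n k" for P Q :: "'k poly3 mat" and n k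
      using that by (intro eq_matI) auto
    then show ?thesis unfolding Nh N_def using ba B by blast
  qed
  have "comparison tw D tw' D' (Suc i) \<alpha>' \<beta>' h'"
    unfolding comparison_def
  proof (intro conjI ballI)
    fix u :: "'k poly3 vec" assume u: "u \<in> carrier_vec (?n (Suc (Suc i)))"
    have D1u: "D (Suc i) *\<^sub>v u \<in> carrier_vec (?n (Suc i))" by (rule mult_mat_vec_carrier[OF D1c u])
    have "D i *\<^sub>v (D (Suc i) *\<^sub>v u) = 0\<^sub>v (?n i)" using F.exact[OF D1u] u by blast
    then have "D' i *\<^sub>v (\<alpha>' *\<^sub>v (D (Suc i) *\<^sub>v u)) = \<alpha> *\<^sub>v 0\<^sub>v (?n i)"
      using assoc_mult_mat_vec[OF D'c \<alpha>'c D1u] assoc_mult_mat_vec[OF \<alpha>c Dc D1u] D\<alpha>' by simp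
    also have "\<dots> = 0\<^sub>v (?n' i)" using \<alpha>c by (intro eq_vecI) auto
    finally show "\<exists>u'\<in>carrier_vec (?n' (Suc (Suc i))). \<alpha>' *\<^sub>v (D (Suc i) *\<^sub>v u) = D' (Suc i) *\<^sub>v u'"
      using G.exact[OF mult_mat_vec_carrier[OF \<alpha>'c D1u]] by blast
  next
    fix u :: "'k poly3 vec" assume u: "u \<in> carrier_vec (?n' (Suc (Suc i)))"
    have D1u: "D' (Suc i) *\<^sub>v u \<in> carrier_vec (?n' (Suc i))" by (rule mult_mat_vec_carrier[OF D1'c u])
    have "D' i *\<^sub>v (D' (Suc i) *\<^sub>v u) = 0\<^sub>v (?n' i)" using G.exact[OF D1u] u by blast
    then have "D i *\<^sub>v (\<beta>' *\<^sub>v (D' (Suc i) *\<^sub>v u)) = \<beta> *\<^sub>v 0\<^sub>v (?n' i)"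
      using assoc_mult_mat_vec[OF Dc \<beta>'c D1u] assoc_mult_mat_vec[OF \<beta>c D'c D1u] D\<beta>' by simp
    also have "\<dots> = 0\<^sub>v (?n i)" using \<beta>c by (intro eq_vecI) auto
    finally show "\<exists>u'\<in>carrier_vec (?n (Suc (Suc i))). \<beta>' *\<^sub>v (D' (Suc i) *\<^sub>v u) = D (Suc i) *\<^sub>v u'"
      using F.exact[OF mult_mat_vec_carrier[OF \<beta>'c D1u]] by blast
  next
    have "\<beta>' * (\<alpha>' * D (Suc i)) = ((1\<^sub>m (?n (Suc i)) + h * D i) + D (Suc i) * h') * D (Suc i)"
      unfolding main[symmetric] by (rule assoc_mult_mat[OF \<beta>'c \<alpha>'c D1c, symmetric])
    also have "\<dots> = (1\<^sub>m (?n (Suc i)) * D (Suc i) + (h * D i) * D (Suc i)) + (D (Suc i) * h') * D (Suc i)"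
      using add_mult_distrib_mat[OF B mult_carrier_mat[OF D1c h'] D1c]
        add_mult_distrib_mat[OF one_carrier_mat hD D1c] by simp
    also have "(h * D i) * D (Suc i) = 0\<^sub>m (?n (Suc i)) (?n (Suc (Suc i)))"
      unfolding assoc_mult_mat[OF h Dc D1c] F.D_D by (rule right_mult_zero_mat[OF h])
    also have "1\<^sub>m (?n (Suc i)) * D (Suc i) + 0\<^sub>m (?n (Suc i)) (?n (Suc (Suc i))) = D (Suc i)"
      using D1c by simp
    also have "(D (Suc i) * h') * D (Suc i) = D (Suc i) * (h' * D (Suc i))"
      by (rule assoc_mult_mat[OF D1c h' D1c])
    finally show "\<beta>' * (\<alpha>' * D (Suc i)) = D (Suc i) + D (Suc i) * (h' * D (Suc i))" .
  qed (use \<alpha>' \<beta>' h' in auto)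
  then show thesis using main by (rule that)
qed

text \<open>By minimality both homotopy terms have entries without constant term, so the diagonal
  entries of \<beta> \<alpha> have constant term 1. For each r this forces a nonzero constant term
  in some entry (s, r) of \<alpha>; an entry with a constant term has degree zero, so the two twists
  are equal.\<close>

lemma minimal_resolution_twists_subset:
  fixes I :: "'k::field poly3 set"
  assumes F: "min_resolution I tw D" and G: "min_resolution I tw' D'"
  shows "set (tw i) \<subseteq> set (tw' i)"
proof -
  interpret F: min_resolution I tw D by fact
  interpret G: min_resolution I tw' D' by fact
  have ex: "\<exists>\<alpha> \<beta> h. comparison tw D tw' D' i \<alpha> \<beta> h" for i
  proof (induction i)
    case 0
    show ?case using comparison_0[OF F G] by blast
  next
    case (Suc i)
    then show ?case using comparison_Suc[OF F G] by metis
  qed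
  show ?thesis
  proof (cases i)
    case 0
    then show ?thesis by (simp add: F.tw_0 G.tw_0)
  next
    case (Suc j)
    obtain \<alpha>0 \<beta>0 h where c0: "comparison tw D tw' D' j \<alpha>0 \<beta>0 h" using ex by blast
    obtain \<alpha> \<beta> h' where c: "comparison tw D tw' D' i \<alpha> \<beta> h'"
      and eq: "\<beta> * \<alpha> = (1\<^sub>m (length (tw i)) + h * D j) + D i * h'"
      using comparison_Suc[OF F G c0] Suc by metis
    have h: "h \<in> carrier_mat (length (tw i)) (length (tw j))" and
      h': "h' \<in> carrier_mat (length (tw (Suc i))) (length (tw i))" and
      \<alpha>: "graded_mat (tw' i) (tw i) \<alpha>" and \<beta>: "graded_mat (tw i) (tw' i) \<beta>"
      using c0 c Suc unfolding comparison_def by blast+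
    have Dj: "D j \<in> carrier_mat (length (tw j)) (length (tw i))" using F.D_carrier[of j] Suc by simp
    show ?thesis
    proof
      fix t assume "t \<in> set (tw i)"
      then obtain r where r: "r < length (tw i)" "t = tw i ! r" by (metis in_set_conv_nth)
      have z1: "Poly_Mapping.lookup ((h * D j) $$ (r, r)) 0 = 0"
        using F.D_minimal[of _ j r] r Suc
        by (simp add: mat_mult_nth[OF h Dj r(1) r(1)] lookup_sum lookup_mult_0)
      have z2: "Poly_Mapping.lookup ((D i * h') $$ (r, r)) 0 = 0"
        using F.D_minimal[of r i] r
        by (simp add: mat_mult_nth[OF F.D_carrier h' r(1) r(1)] lookup_sum lookup_mult_0 mult.commute[of "D i $$ _"])
      have "(\<beta> * \<alpha>) $$ (r, r) = 1 + (h * D j) $$ (r, r) + (D i * h') $$ (r, r)"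
        unfolding eq using r h h' Dj F.D_carrier[of i] by simp
      then have "Poly_Mapping.lookup ((\<beta> * \<alpha>) $$ (r, r)) 0 = 1"
        by (simp add: lookup_add z1 z2)
      then have "(\<Sum>s<length (tw' i). Poly_Mapping.lookup (\<beta> $$ (r, s) * \<alpha> $$ (s, r)) 0) \<noteq> 0"
        unfolding mat_mult_nth[OF graded_matD(1)[OF \<beta>] graded_matD(1)[OF \<alpha>] r(1) r(1)] lookup_sum by simp
      then obtain s where s: "s < length (tw' i)" "Poly_Mapping.lookup (\<beta> $$ (r, s) * \<alpha> $$ (s, r)) 0 \<noteq> 0"
        by (meson lessThan_iff sum.neutral)
      then have "0 \<in> Poly_Mapping.keys (\<alpha> $$ (s, r))" using lookup_mult_0 by (auto simp: in_keys_iff)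
      then have "0 = tw i ! r - tw' i ! s"
        using homogD[OF graded_matD(2)[OF \<alpha> s(1) r(1)]] by fastforce
      then show "t \<in> set (tw' i)" using r s by simp
    qed
  qed
qed

lemma minimal_resolution_twists_unique:
  assumes "minimal_graded_resolution poly_ring homog I tw D"
    and "minimal_graded_resolution poly_ring homog I tw' D'"
  shows "set (tw i) = set (tw' i)"
  using assms minimal_resolution_twists_subset[of I tw D tw' D' i]
    minimal_resolution_twists_subset[of I tw' D' tw D i]
  by (simp add: min_resolution_def)

text \<open>The maximum depends only on the sets of twists, so their uniqueness makes the definite
  description well defined.\<close>

lemma cm_regularity_eq:
  assumes "minimal_graded_resolution poly_ring homog I tw D"
  shows "cm_regularity I = Max {b - int i | i b. b \<in> set (tw i)}"
  unfolding cm_regularity_def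
proof (rule the_equality)
  show "\<exists>tw' D. minimal_graded_resolution poly_ring homog I tw' D \<and>
      Max {b - int i | i b. b \<in> set (tw i)} = Max {b - int i | i b. b \<in> set (tw' i)}"
    by (intro exI[of _ tw] exI[of _ D] conjI assms refl)
next
  fix r assume "\<exists>tw' D. minimal_graded_resolution poly_ring homog I tw' D \<and>
      r = Max {b - int i | i b. b \<in> set (tw' i)}"
  then obtain tw' D' where res': "minimal_graded_resolution poly_ring homog I tw' D'"
    and r: "r = Max {b - int i | i b. b \<in> set (tw' i)}" by blast
  have "set (tw' i) = set (tw i)" for i
    by (rule minimal_resolution_twists_unique[OF res' assms])
  then show "r = Max {b - int i | i b. b \<in> set (tw i)}" by (simp only: r)
qed

section \<open>Resolutions over the hypersurface ring\<close>

lemma ideal_PIdl: "ideal (PIdl\<^bsub>class_ring\<^esub> (f :: 'r::comm_ring_1)) class_ring"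
  using cring.cgenideal_ideal[OF class_cring.cring_axioms, of f] by simp

lemma reduce_eq_iff: "reduce f a = reduce f b \<longleftrightarrow> (\<exists>s. a = b + f * s)"
  unfolding reduce_def coset_eq_iff[OF ideal_PIdl] PIdl_iff
  by (auto simp: algebra_simps)

lemma hypersurface_ops:
  "carrier (hypersurface f) = range (reduce f)" "\<zero>\<^bsub>hypersurface f\<^esub> = reduce f 0"
  "reduce f a \<oplus>\<^bsub>hypersurface f\<^esub> reduce f b = reduce f (a + b)"
  "reduce f a \<otimes>\<^bsub>hypersurface f\<^esub> reduce f b = reduce f (a * b)"
  unfolding hypersurface_def reduce_def by (simp_all add: coset_ops[OF ideal_PIdl])

lemma ring_hypersurface: "ring (hypersurface f)"
  unfolding hypersurface_def by (rule ideal.quotient_is_ring[OF ideal_PIdl])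

lemma finsum_hypersurface:
  assumes "finite A"
  shows "finsum (hypersurface f) (\<lambda>x. reduce f (g x)) A = reduce f (\<Sum>x\<in>A. g x)"
proof -
  interpret ring "hypersurface f" by (rule ring_hypersurface)
  show ?thesis using assms
  proof induction
    case (insert x A)
    have "finsum (hypersurface f) (\<lambda>x. reduce f (g x)) (insert x A) =
        reduce f (g x) \<oplus>\<^bsub>hypersurface f\<^esub> finsum (hypersurface f) (\<lambda>x. reduce f (g x)) A"
      using insert by (intro finsum_insert) (auto simp: hypersurface_ops)
    with insert show ?case by (simp add: hypersurface_ops)
  qed (simp add: hypersurface_ops)
qed

lemma mat_app_hypersurface:
  assumes v: "dim_vec v = dim_col A"
  shows "mat_app (hypersurface f) (map_mat (reduce f) A) (map_vec (reduce f) v) = map_vec (reduce f) (A *\<^sub>v v)"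
proof (rule eq_vecI)
  fix i assume "i < dim_vec (map_vec (reduce f) (A *\<^sub>v v))"
  then have i: "i < dim_row A" by simp
  interpret ring "hypersurface f" by (rule ring_hypersurface)
  have "finsum (hypersurface f) (\<lambda>j. map_mat (reduce f) A $$ (i, j) \<otimes>\<^bsub>hypersurface f\<^esub> map_vec (reduce f) v $ j) {..<dim_col A} =
    finsum (hypersurface f) (\<lambda>j. reduce f (A $$ (i, j) * v $ j)) {..<dim_col A}"
    using i v by (intro finsum_cong'[OF refl]) (simp_all add: hypersurface_ops)
  also have "\<dots> = reduce f (\<Sum>j<dim_col A. A $$ (i, j) * v $ j)" by (rule finsum_hypersurface) simp
  also have "\<dots> = reduce f ((A *\<^sub>v v) $ i)"
    by (simp only: mult_mat_vec_nth[OF carrier_matI[OF refl refl] carrier_vecI[OF v] i])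
  finally show "mat_app (hypersurface f) (map_mat (reduce f) A) (map_vec (reduce f) v) $ i =
      map_vec (reduce f) (A *\<^sub>v v) $ i"
    using i by (simp add: mat_app_def)
qed (simp add: mat_app_def)

lemma free_vecs_hypersurface: "free_vecs (hypersurface f) n = map_vec (reduce f) ` carrier_vec n"
proof
  show "free_vecs (hypersurface f) n \<subseteq> map_vec (reduce f) ` carrier_vec n"
  proof
    fix v assume "v \<in> free_vecs (hypersurface f) n"
    then have v: "dim_vec v = n" "\<And>i. i < n \<Longrightarrow> v $ i \<in> range (reduce f)"
      by (simp_all add: free_vecs_def hypersurface_ops)
    then have "v = map_vec (reduce f) (vec n (\<lambda>i. inv_into UNIV (reduce f) (v $ i)))"
      by (intro eq_vecI) (simp_all add: f_inv_into_f)
    then show "v \<in> map_vec (reduce f) ` carrier_vec n" by (rule image_eqI) simp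
  qed
qed (auto simp: free_vecs_def hypersurface_ops)

lemma map_vec_reduce_eq_iff:
  assumes "v \<in> carrier_vec n" and "u \<in> carrier_vec n"
  shows "map_vec (reduce f) v = map_vec (reduce f) u \<longleftrightarrow> (\<exists>s\<in>carrier_vec n. v = u + f \<cdot>\<^sub>v s)"
proof
  assume eq: "map_vec (reduce f) v = map_vec (reduce f) u"
  have "\<exists>s. v $ i = u $ i + f * s" if "i < n" for i
  proof -
    have "reduce f (v $ i) = reduce f (u $ i)"
      using arg_cong[OF eq, of "\<lambda>x. vec_index x i"] that assms by simp
    then show ?thesis unfolding reduce_eq_iff .
  qed
  then obtain s where s: "\<And>i. i < n \<Longrightarrow> v $ i = u $ i + f * s i" by metis
  have "v = u + f \<cdot>\<^sub>v vec n s" using s assms by (intro eq_vecI) auto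
  then show "\<exists>s\<in>carrier_vec n. v = u + f \<cdot>\<^sub>v s" by (rule bexI) simp
next
  assume "\<exists>s\<in>carrier_vec n. v = u + f \<cdot>\<^sub>v s"
  then show "map_vec (reduce f) v = map_vec (reduce f) u"
    using assms by (intro eq_vecI) (auto simp: reduce_eq_iff)
qed

text \<open>The image of an ideal under the surjective reduction is an ideal, and so is the
  preimage; each fact gives one inclusion by minimality of the generated ideal.\<close>

lemma Idl_hypersurface: "Idl\<^bsub>hypersurface f\<^esub> (reduce f ` T) = reduce f ` (Idl\<^bsub>poly_ring\<^esub> T)"
proof
  interpret ring "hypersurface f" by (rule ring_hypersurface)
  have "ideal (reduce f ` (Idl\<^bsub>poly_ring\<^esub> T)) (hypersurface f)"
    unfolding hypersurface_def reduce_def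
    by (rule ring.ring_ideal_imp_quot_ideal[OF class_ring.ring_axioms ideal_PIdl ideal_Idl])
  then show "Idl\<^bsub>hypersurface f\<^esub> (reduce f ` T) \<subseteq> reduce f ` (Idl\<^bsub>poly_ring\<^esub> T)"
    by (rule genideal_minimal) (use Idl_superset in blast)
  have sub: "reduce f ` T \<subseteq> carrier (hypersurface f)" by (auto simp: hypersurface_ops)
  have id: "ideal (Idl\<^bsub>hypersurface f\<^esub> (reduce f ` T)) (hypersurface f)"
    by (rule genideal_ideal[OF sub])
  let ?K = "{x. reduce f x \<in> Idl\<^bsub>hypersurface f\<^esub> (reduce f ` T)}"
  have "ideal ?K poly_ring"
  proof (rule ideal_poly_ringI)
    show "0 \<in> ?K"
      using additive_subgroup.zero_closed[OF ideal.axioms(1)[OF id]] by (simp add: hypersurface_ops)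
    show "x + y \<in> ?K" if "x \<in> ?K" "y \<in> ?K" for x y
      using additive_subgroup.a_closed[OF ideal.axioms(1)[OF id], of "reduce f x" "reduce f y"] that
      by (simp add: hypersurface_ops)
    show "r * x \<in> ?K" if "x \<in> ?K" for x r
      using ideal.I_l_closed[OF id, of "reduce f x" "reduce f r"] that by (simp add: hypersurface_ops)
  qed
  moreover have "T \<subseteq> ?K" using genideal_self[OF sub] by blast
  ultimately have "Idl\<^bsub>poly_ring\<^esub> T \<subseteq> ?K" by (rule Idl_least)
  then show "reduce f ` (Idl\<^bsub>poly_ring\<^esub> T) \<subseteq> Idl\<^bsub>hypersurface f\<^esub> (reduce f ` T)" by blast
qed

text \<open>Exactness over the quotient is pulled back to P: a kernel becomes the vectors mapped to
  multiples of f, and an image is enlarged by multiples of f. Positive differences of twists put all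
  entries into the irrelevant ideal.\<close>

lemma hypersurface_resolutionI:
  fixes f :: "'k::field poly3" and M :: "nat \<Rightarrow> 'k poly3 mat"
  assumes C: "\<And>i. M i \<in> carrier_mat (length (tw i)) (length (tw (Suc i)))"
    and H: "\<And>i r c. r < length (tw i) \<Longrightarrow> c < length (tw (Suc i)) \<Longrightarrow>
      M i $$ (r, c) \<in> homog (tw (Suc i) ! c - tw i ! r)"
    and pos: "\<And>i r c. r < length (tw i) \<Longrightarrow> c < length (tw (Suc i)) \<Longrightarrow> 1 \<le> tw (Suc i) ! c - tw i ! r"
    and tw0: "tw 0 = [0]"
    and im: "\<And>x. x \<in> Idl\<^bsub>poly_ring\<^esub> T \<longleftrightarrow> (\<exists>v\<in>carrier_vec (length (tw 1)). x = (M 0 *\<^sub>v v) $ 0)"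
    and ex: "\<And>i v. v \<in> carrier_vec (length (tw (Suc i))) \<Longrightarrow>
      (\<exists>s\<in>carrier_vec (length (tw i)). M i *\<^sub>v v = f \<cdot>\<^sub>v s) \<longleftrightarrow>
      (\<exists>u\<in>carrier_vec (length (tw (Suc (Suc i)))). \<exists>s\<in>carrier_vec (length (tw (Suc i))).
         v = M (Suc i) *\<^sub>v u + f \<cdot>\<^sub>v s)"
  shows "minimal_graded_resolution (hypersurface f) (quot_homog (PIdl\<^bsub>poly_ring\<^esub> f))
    (Idl\<^bsub>hypersurface f\<^esub> (reduce f ` T)) tw (\<lambda>i. map_mat (reduce f) (M i))"
  unfolding minimal_graded_resolution_def
proof (intro conjI allI impI)
  let ?R = "hypersurface f" and ?\<pi> = "reduce f" and ?n = "\<lambda>i. length (tw i)"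
  have app: "mat_app ?R (map_mat ?\<pi> (M i)) (map_vec ?\<pi> v) = map_vec ?\<pi> (M i *\<^sub>v v)"
    if "v \<in> carrier_vec (?n (Suc i))" for i v
    using C[of i] that by (intro mat_app_hypersurface) auto
  show "map_mat ?\<pi> (M i) \<in> carrier_mat (?n i) (?n (Suc i))" for i using C by simp
  show hom: "map_mat ?\<pi> (M i) $$ (r, c) \<in> quot_homog (PIdl\<^bsub>poly_ring\<^esub> f) (tw (Suc i) ! c - tw i ! r)"
    if "r < ?n i" "c < ?n (Suc i)" for i r c
    using H[OF that] C[of i] that by (auto simp: quot_homog_def reduce_def)
  show "tw 0 = [0]" by fact
  show "{mat_app ?R (map_mat ?\<pi> (M 0)) v $ 0 |v. v \<in> free_vecs ?R (?n 1)} = Idl\<^bsub>?R\<^esub> (?\<pi> ` T)"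
  proof -
    have "mat_app ?R (map_mat ?\<pi> (M 0)) (map_vec ?\<pi> v) $ 0 = ?\<pi> ((M 0 *\<^sub>v v) $ 0)"
      if "v \<in> carrier_vec (?n 1)" for v
      using app[of v 0] that C[of 0] tw0 by simp
    then have "{mat_app ?R (map_mat ?\<pi> (M 0)) v $ 0 |v. v \<in> free_vecs ?R (?n 1)} =
        {?\<pi> ((M 0 *\<^sub>v v) $ 0) |v. v \<in> carrier_vec (?n 1)}"
      unfolding free_vecs_hypersurface by (auto simp: image_iff)
    also have "\<dots> = ?\<pi> ` (Idl\<^bsub>poly_ring\<^esub> T)" using im by auto
    finally show ?thesis unfolding Idl_hypersurface .
  qed
  show "{v \<in> free_vecs ?R (?n (Suc i)). mat_app ?R (map_mat ?\<pi> (M i)) v = vec (?n i) (\<lambda>_. \<zero>\<^bsub>?R\<^esub>)} =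
      mat_app ?R (map_mat ?\<pi> (M (Suc i))) ` free_vecs ?R (?n (Suc (Suc i)))" (is "?L = ?Q") for i
  proof -
    have zero: "vec (?n i) (\<lambda>_. \<zero>\<^bsub>?R\<^esub>) = map_vec ?\<pi> (0\<^sub>v (?n i))"
      by (rule eq_vecI) (simp_all add: hypersurface_ops)
    have Mi: "M i *\<^sub>v v \<in> carrier_vec (?n i)" if "v \<in> carrier_vec (?n (Suc i))" for i v
      using mult_mat_vec_carrier[OF C that] .
    have ker: "mat_app ?R (map_mat ?\<pi> (M i)) (map_vec ?\<pi> v) = vec (?n i) (\<lambda>_. \<zero>\<^bsub>?R\<^esub>) \<longleftrightarrow>
        (\<exists>s\<in>carrier_vec (?n i). M i *\<^sub>v v = f \<cdot>\<^sub>v s)" if v: "v \<in> carrier_vec (?n (Suc i))" for v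
      unfolding app[OF v] zero map_vec_reduce_eq_iff[OF Mi[OF v] zero_carrier_vec]
      by (intro bex_cong refl) auto
    have "?Q = map_vec ?\<pi> ` {M (Suc i) *\<^sub>v u | u. u \<in> carrier_vec (?n (Suc (Suc i)))}"
      unfolding free_vecs_hypersurface image_image
      using app[of _ "Suc i"] by (auto simp: image_iff)
    also have "\<dots> = map_vec ?\<pi> ` {v \<in> carrier_vec (?n (Suc i)). \<exists>s\<in>carrier_vec (?n i). M i *\<^sub>v v = f \<cdot>\<^sub>v s}"
      (is "_ ` ?A = _ ` ?B")
    proof
      show "map_vec ?\<pi> ` ?A \<subseteq> map_vec ?\<pi> ` ?B"
      proof (rule image_mono, rule subsetI)
        fix x assume "x \<in> ?A"
        then obtain u where u: "u \<in> carrier_vec (?n (Suc (Suc i)))" "x = M (Suc i) *\<^sub>v u" by blast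
        have x: "x \<in> carrier_vec (?n (Suc i))" using Mi[OF u(1)] u(2) by simp
        have "x = M (Suc i) *\<^sub>v u + f \<cdot>\<^sub>v 0\<^sub>v (?n (Suc i))"
          using x u(2) C[of "Suc i"] by (intro eq_vecI) auto
        then have "\<exists>s\<in>carrier_vec (?n i). M i *\<^sub>v x = f \<cdot>\<^sub>v s"
          using u(1) by (intro iffD2[OF ex[OF x]] bexI[of _ u] bexI[of _ "0\<^sub>v (?n (Suc i))"]) simp_all
        then show "x \<in> ?B" using x by simp
      qed
      show "map_vec ?\<pi> ` ?B \<subseteq> map_vec ?\<pi> ` ?A"
      proof
        fix y assume "y \<in> map_vec ?\<pi> ` ?B"
        then obtain v where v: "v \<in> carrier_vec (?n (Suc i))" "y = map_vec ?\<pi> v"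
          "\<exists>s\<in>carrier_vec (?n i). M i *\<^sub>v v = f \<cdot>\<^sub>v s" by blast
        then obtain u s where us: "u \<in> carrier_vec (?n (Suc (Suc i)))" "s \<in> carrier_vec (?n (Suc i))"
          "v = M (Suc i) *\<^sub>v u + f \<cdot>\<^sub>v s" using ex[OF v(1)] by blast
        then have "y = map_vec ?\<pi> (M (Suc i) *\<^sub>v u)"
          unfolding v(2) map_vec_reduce_eq_iff[OF v(1) Mi[OF us(1)]] by blast
        then show "y \<in> map_vec ?\<pi> ` ?A" using us(1) by blast
      qed
    qed
    also have "\<dots> = ?L"
      unfolding free_vecs_hypersurface using ker by auto
    finally show ?thesis by simp
  qed
  show "elements_mat (map_mat ?\<pi> (M i)) \<subseteq> irrelevant_ideal ?R (quot_homog (PIdl\<^bsub>poly_ring\<^esub> f))" for i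
  proof
    fix x assume "x \<in> elements_mat (map_mat ?\<pi> (M i))"
    then obtain r c where rc: "r < ?n i" "c < ?n (Suc i)" "x = map_mat ?\<pi> (M i) $$ (r, c)"
      using C[of i] elements_matD[of x "map_mat ?\<pi> (M i)"] by auto
    have "quot_homog (PIdl\<^bsub>poly_ring\<^esub> f) j \<subseteq> carrier ?R" for j
      by (auto simp: quot_homog_def hypersurface_ops reduce_def)
    then have "(\<Union>j\<in>{1..}. quot_homog (PIdl\<^bsub>poly_ring\<^esub> f) j) \<subseteq> irrelevant_ideal ?R (quot_homog (PIdl\<^bsub>poly_ring\<^esub> f))"
      unfolding irrelevant_ideal_def by (intro ring.genideal_self[OF ring_hypersurface]) auto
    moreover have "x \<in> (\<Union>j\<in>{1..}. quot_homog (PIdl\<^bsub>poly_ring\<^esub> f) j)"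
      using hom[OF rc(1,2)] pos[OF rc(1,2)] rc(3) by auto
    ultimately show "x \<in> irrelevant_ideal ?R (quot_homog (PIdl\<^bsub>poly_ring\<^esub> f))" by blast
  qed
qed

section \<open>The two resolutions\<close>

lemma finite_resolution3I:
  fixes D1 D2 D3 :: "'k::field poly3 mat"
  assumes D: "D1 \<in> carrier_mat 1 (length t1)" "D2 \<in> carrier_mat (length t1) (length t2)"
      "D3 \<in> carrier_mat (length t2) (length t3)"
    and H1: "\<And>c. c < length t1 \<Longrightarrow> D1 $$ (0, c) \<in> homog (t1 ! c) \<and> 1 \<le> t1 ! c"
    and H2: "\<And>r c. r < length t1 \<Longrightarrow> c < length t2 \<Longrightarrow> D2 $$ (r, c) \<in> homog (t2 ! c - t1 ! r) \<and> 1 \<le> t2 ! c - t1 ! r"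
    and H3: "\<And>r c. r < length t2 \<Longrightarrow> c < length t3 \<Longrightarrow> D3 $$ (r, c) \<in> homog (t3 ! c - t2 ! r) \<and> 1 \<le> t3 ! c - t2 ! r"
    and im: "\<And>x. x \<in> I \<longleftrightarrow> (\<exists>v\<in>carrier_vec (length t1). x = (D1 *\<^sub>v v) $ 0)"
    and E1: "\<And>v. v \<in> carrier_vec (length t1) \<Longrightarrow> D1 *\<^sub>v v = 0\<^sub>v 1 \<longleftrightarrow> (\<exists>u\<in>carrier_vec (length t2). v = D2 *\<^sub>v u)"
    and E2: "\<And>v. v \<in> carrier_vec (length t2) \<Longrightarrow> D2 *\<^sub>v v = 0\<^sub>v (length t1) \<longleftrightarrow> (\<exists>u\<in>carrier_vec (length t3). v = D3 *\<^sub>v u)"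
    and E3: "\<And>v. v \<in> carrier_vec (length t3) \<Longrightarrow> D3 *\<^sub>v v = 0\<^sub>v (length t2) \<Longrightarrow> v = 0\<^sub>v (length t3)"
  shows "finite_minimal_graded_resolution poly_ring homog I [[0], t1, t2, t3] [D1, D2, D3]"
proof -
  let ?ts = "[[0], t1, t2, t3]"
  define tw where "tw = fin_twists ?ts"
  define M where "M = fin_maps poly_ring ?ts [D1, D2, D3]"
  have tw: "tw 0 = [0]" "tw (Suc 0) = t1" "tw (Suc (Suc 0)) = t2" "tw (Suc (Suc (Suc 0))) = t3"
    "tw (Suc (Suc (Suc (Suc i)))) = []" for i
    by (simp_all add: tw_def fin_twists_def)
  have M: "M 0 = D1" "M (Suc 0) = D2" "M (Suc (Suc 0)) = D3"
    by (simp_all add: M_def fin_maps_def)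
  have M3: "M (Suc (Suc (Suc i))) = 0\<^sub>m (length (tw (Suc (Suc (Suc i))))) (length (tw (Suc (Suc (Suc (Suc i))))))" for i
    by (simp add: M_def fin_maps_def zero_mat_def tw_def)
  have cases: "i = 0 \<or> i = Suc 0 \<or> i = Suc (Suc 0) \<or> (\<exists>j. i = Suc (Suc (Suc j)))" for i :: nat
    by (metis nat.exhaust)
  have H: "M i $$ (r, c) \<in> homog (tw (Suc i) ! c - tw i ! r) \<and> 1 \<le> tw (Suc i) ! c - tw i ! r"
    if rc: "r < length (tw i)" "c < length (tw (Suc i))" for i r c
    using cases[of i] H1[of c] H2[of r c] H3[of r c] rc by (elim disjE exE) (simp_all add: tw M)
  have "minimal_graded_resolution poly_ring homog I tw M"
    unfolding minimal_graded_resolution_poly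
  proof (intro conjI allI impI ballI)
    show "M i \<in> carrier_mat (length (tw i)) (length (tw (Suc i)))" for i
      using cases[of i] D by (elim disjE exE) (simp_all add: tw M M3)
    show "M i $$ (r, c) \<in> homog (tw (Suc i) ! c - tw i ! r)"
      if "r < length (tw i)" "c < length (tw (Suc i))" for i r c
      using H[OF that] by blast
    show "Poly_Mapping.lookup (M i $$ (r, c)) 0 = 0"
      if "r < length (tw i)" "c < length (tw (Suc i))" for i r c
    proof (rule ccontr)
      assume "Poly_Mapping.lookup (M i $$ (r, c)) 0 \<noteq> 0"
      then have "0 \<in> Poly_Mapping.keys (M i $$ (r, c))" by (simp add: in_keys_iff)
      then show False using H[OF that] homogD[of "M i $$ (r, c)"] by fastforce
    qed
    show "tw 0 = [0]" by (rule tw)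
    show "{(M 0 *\<^sub>v v) $ 0 |v. v \<in> carrier_vec (length (tw 1))} = I"
      using im by (auto simp: M tw)
    show "M i *\<^sub>v v = 0\<^sub>v (length (tw i)) \<longleftrightarrow> (\<exists>u\<in>carrier_vec (length (tw (Suc (Suc i)))). v = M (Suc i) *\<^sub>v u)"
      if v: "v \<in> carrier_vec (length (tw (Suc i)))" for i v
      using cases[of i]
    proof (elim disjE exE)
      assume i: "i = 0"
      then show ?thesis using E1[of v] v by (simp add: M tw)
    next
      assume i: "i = Suc 0"
      then show ?thesis using E2[of v] v by (simp add: M tw)
    next
      \<comment> \<open>The next map has no columns, so its image is zero and exactness at the last
        module amounts to injectivity of D3.\<close>
      assume i: "i = Suc (Suc 0)"
      have "M (Suc i) *\<^sub>v u = 0\<^sub>v (length t3)" if "dim_vec u = 0" for u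
        unfolding i M3 using that by (intro eq_vecI) (auto simp: tw scalar_prod_def)
      moreover have "D3 *\<^sub>v 0\<^sub>v (length t3) = 0\<^sub>v (length t2)" using D by (intro eq_vecI) auto
      moreover have "v = 0\<^sub>v (length t3)" if "D3 *\<^sub>v v = 0\<^sub>v (length t2)"
        using E3[OF _ that] v by (simp add: i tw)
      ultimately have "D3 *\<^sub>v v = 0\<^sub>v (length t2) \<longleftrightarrow> (\<exists>u\<in>carrier_vec 0. v = M (Suc i) *\<^sub>v u)"
        by (metis carrier_vecD zero_carrier_vec)
      then show ?thesis by (simp add: i M tw)
    next
      fix j assume i: "i = Suc (Suc (Suc j))"
      have "v = 0\<^sub>v 0" using v unfolding i by (intro eq_vecI) (auto simp: tw)
      moreover have "M i *\<^sub>v v = 0\<^sub>v (length (tw i))"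
        unfolding i M3 using v by (intro eq_vecI) (auto simp: tw i scalar_prod_def)
      moreover have "M (Suc i) *\<^sub>v 0\<^sub>v 0 = 0\<^sub>v 0"
        unfolding i M3 by (intro eq_vecI) (auto simp: tw)
      ultimately have "M i *\<^sub>v v = 0\<^sub>v (length (tw i)) \<longleftrightarrow> (\<exists>u\<in>carrier_vec 0. v = M (Suc i) *\<^sub>v u)"
        by (metis zero_carrier_vec)
      then show ?thesis by (simp add: i tw)
    qed
  qed
  then show ?thesis
    by (simp add: finite_minimal_graded_resolution_def tw_def M_def)
qed

text \<open>If A x is f s, applying B gives v f x = f B s; cancelling f and the unit v puts x into
  the image of B. The converse is AB = v f.\<close>

lemma matrix_factorization_exact:
  fixes A B :: "'r::idom mat"
  assumes A: "A \<in> carrier_mat n n" and B: "B \<in> carrier_mat n n"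
    and AB: "\<And>x. x \<in> carrier_vec n \<Longrightarrow> A *\<^sub>v (B *\<^sub>v x) = h \<cdot>\<^sub>v x"
    and BA: "\<And>x. x \<in> carrier_vec n \<Longrightarrow> B *\<^sub>v (A *\<^sub>v x) = h \<cdot>\<^sub>v x"
    and h: "h = v * f" "v * v' = 1" "f \<noteq> 0" and x: "x \<in> carrier_vec n"
  shows "(\<exists>s\<in>carrier_vec n. A *\<^sub>v x = f \<cdot>\<^sub>v s) \<longleftrightarrow>
    (\<exists>u\<in>carrier_vec n. \<exists>s\<in>carrier_vec n. x = B *\<^sub>v u + f \<cdot>\<^sub>v s)"
proof
  assume "\<exists>s\<in>carrier_vec n. A *\<^sub>v x = f \<cdot>\<^sub>v s"
  then obtain s where s: "s \<in> carrier_vec n" "A *\<^sub>v x = f \<cdot>\<^sub>v s" by blast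
  have Bs: "B *\<^sub>v s \<in> carrier_vec n" by (rule mult_mat_vec_carrier[OF B s(1)])
  have "h \<cdot>\<^sub>v x = f \<cdot>\<^sub>v (B *\<^sub>v s)"
    unfolding BA[OF x, symmetric] s(2) by (rule mult_mat_smult_vec[OF B s(1)])
  have "v * x $ i = (B *\<^sub>v s) $ i" if "i < n" for i
  proof -
    have "f * (v * x $ i) = f * (B *\<^sub>v s) $ i"
      using arg_cong[OF \<open>h \<cdot>\<^sub>v x = f \<cdot>\<^sub>v (B *\<^sub>v s)\<close>, of "\<lambda>y. vec_index y i"] that x h(1)
      by (simp add: carrier_vecD[OF Bs] carrier_matD[OF B] mult.commute mult.left_commute del: index_mult_mat_vec)
    then show ?thesis using h(3) by simp
  qed
  then have "v' * (v * x $ i) = v' * (B *\<^sub>v s) $ i" if "i < n" for i using that by simp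
  moreover have "v' * (v * y) = y" for y using h(2) by (simp add: mult.commute flip: mult.assoc)
  ultimately have "x $ i = v' * (B *\<^sub>v s) $ i" if "i < n" for i using that by simp
  then have "x = B *\<^sub>v (v' \<cdot>\<^sub>v s) + f \<cdot>\<^sub>v 0\<^sub>v n"
    unfolding mult_mat_smult_vec[OF B s(1)] using x B s by (intro eq_vecI) (auto simp del: index_mult_mat_vec)
  then show "\<exists>u\<in>carrier_vec n. \<exists>s\<in>carrier_vec n. x = B *\<^sub>v u + f \<cdot>\<^sub>v s"
    using s(1) by (intro bexI[of _ "v' \<cdot>\<^sub>v s"] bexI[of _ "0\<^sub>v n"]) auto
next
  assume "\<exists>u\<in>carrier_vec n. \<exists>s\<in>carrier_vec n. x = B *\<^sub>v u + f \<cdot>\<^sub>v s"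
  then obtain u s where us: "u \<in> carrier_vec n" "s \<in> carrier_vec n" "x = B *\<^sub>v u + f \<cdot>\<^sub>v s" by blast
  have Bu: "B *\<^sub>v u \<in> carrier_vec n" by (rule mult_mat_vec_carrier[OF B us(1)])
  have As: "A *\<^sub>v s \<in> carrier_vec n" by (rule mult_mat_vec_carrier[OF A us(2)])
  have "A *\<^sub>v x = h \<cdot>\<^sub>v u + f \<cdot>\<^sub>v (A *\<^sub>v s)"
    unfolding us(3) using us mult_add_distrib_mat_vec[OF A Bu, of "f \<cdot>\<^sub>v s"] AB[OF us(1)] mult_mat_smult_vec[OF A us(2)]
    by simp
  also have "\<dots> = f \<cdot>\<^sub>v (v \<cdot>\<^sub>v u + A *\<^sub>v s)"
    using carrier_vecD[OF us(1)] carrier_vecD[OF us(2)] carrier_matD[OF A] h(1)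
    by (intro eq_vecI) (auto simp: algebra_simps simp del: index_mult_mat_vec)
  finally show "\<exists>s\<in>carrier_vec n. A *\<^sub>v x = f \<cdot>\<^sub>v s" using us As by (intro bexI[of _ "v \<cdot>\<^sub>v u + A *\<^sub>v s"]) auto
qed

lemma map_mat_periodic_maps:
  "map_mat g (periodic_maps E C A B i) = periodic_maps (map_mat g E) (map_mat g C) (map_mat g A) (map_mat g B) i"
proof (cases i)
  case (Suc j)
  then show ?thesis by (cases j) auto
qed simp

locale frobenius_link_hypersurface = frobenius_link +
  assumes d_ge_2: "d \<ge> 2"
begin

text \<open>\<open>b - int d\<close> is the common degree of the entries of w, and c is that of the
  entries of \<psi>. Both divisions are exact because \<open>q + d\<close> is odd.\<close>

definition b :: int where "b = (3 * int q + int d - 1) div 2"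
definition c :: int where "c = (int q - int d + 1) div 2"

lemma b_c: "2 * b = 3 * int q + int d - 1" "2 * c = int q - int d + 1"
proof -
  have "even (3 * int q + int d - 1)" "even (int q - int d + 1)" using parity by auto
  then show "2 * b = 3 * int q + int d - 1" "2 * c = int q - int d + 1"
    unfolding b_def c_def by (simp_all only: dvd_mult_div_cancel)
qed

lemma b_c_bounds: "b - int q = c + (int d - 1)" "1 \<le> c" "b + 1 - (int q + int d) = c" "1 \<le> b - int d" "2 \<le> int d"
  using b_c q_ge d_ge_2 by auto

lemma m: "m = 2 * d"
  using degrees by metis

lemma entries:
  "i < m \<Longrightarrow> j < m \<Longrightarrow> \<phi> $$ (i, j) \<in> homog 1"
  "i < m \<Longrightarrow> j < 3 \<Longrightarrow> \<psi> $$ (i, j) \<in> homog c"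
  "i < m \<Longrightarrow> w $ i \<in> homog (b - int d)"
proof -
  obtain as where deg: "res_degrees as (3 * int q - int d)" and as3: "\<And>j. j < 3 \<Longrightarrow> as ! j = int q"
    and asw: "\<And>j. j < m \<Longrightarrow> 2 * as ! (3 + j) = 3 * int q - 1 - int d"
    using degrees by metis
  have asb: "as ! (3 + j) = b - int d" if "j < m" for j using asw[OF that] b_c(1) by linarith
  have X: "X $$ (i, j) \<in> homog (3 * int q - int d - as ! i - as ! j)" if "i < 3 + m" "j < 3 + m" for i j
    using deg that by (simp add: res_degrees_def)
  show "\<phi> $$ (i, j) \<in> homog 1" if ij: "i < m" "j < m" for i j
  proof -
    have "3 * int q - int d - as ! (3 + i) - as ! (3 + j) = 1" using asb ij b_c(1) by simp
    then show ?thesis using X[of "3 + i" "3 + j"] ij by (simp add: X_entries)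
  qed
  show "\<psi> $$ (i, j) \<in> homog c" if ij: "i < m" "j < 3" for i j
  proof -
    have "3 * int q - int d - as ! (3 + i) - as ! j = c" using asb as3 ij b_c by simp
    then show ?thesis using X[of "3 + i" j] ij by (simp add: X_entries)
  qed
  show "w $ i \<in> homog (b - int d)" if "i < m" for i
    using deg asb[OF that] gs_nth(2)[OF that] that unfolding res_degrees_def by (metis nat_add_left_cancel_less)
qed

lemma \<phi>'_entries: "i < m \<Longrightarrow> j < m \<Longrightarrow> \<phi>' $$ (i, j) \<in> homog (int d - 1)"
proof -
  assume ij: "i < m" "j < m"
  have "pf_minor \<phi> [0..<m] i j \<in> homog (int d - 1)"
    by (rule pf_minor_homog) (use entries(1) ij m in auto)
  then show ?thesis using ij \<phi> by (simp add: \<phi>'_def pf_adjoint_nth)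
qed

lemma \<psi>\<phi>'_entries: "i < 3 \<Longrightarrow> j < m \<Longrightarrow> (transpose_mat \<psi> * \<phi>') $$ (i, j) \<in> homog (b - int q)"
proof -
  assume ij: "i < 3" "j < m"
  have "transpose_mat \<psi> $$ (i, k) * \<phi>' $$ (k, j) \<in> homog (c + (int d - 1))" if "k < m" for k
    using that ij \<psi> by (intro homog_mult) (auto simp: entries \<phi>'_entries)
  then show ?thesis
    unfolding mat_mult_nth[OF link.\<psi>t link.\<phi>' ij] b_c_bounds(1) by (intro homog_sum) auto
qed

definition v where "v = (SOME v. v \<noteq> 0 \<and> h = const v * f)"

lemma v: "v \<noteq> 0" "h = const v * f"
proof -
  have "\<exists>v. v \<noteq> 0 \<and> h = const v * f" using degrees by metis
  from someI_ex[OF this] show "v \<noteq> 0" "h = const v * f" unfolding v_def by auto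
qed

sublocale hyp: pfaffian_hypersurface m a w S \<psi> \<phi> \<phi>' h f "const v" "const (1 / v)"
proof
  show "h = const v * f" by (rule v)
  show "const v * const (1 / v) = 1" using v(1) by (simp add: const_mult const_one)
  show "f \<noteq> 0" by (rule f_nonzero)
  show "\<exists>s\<in>carrier_vec 3. \<exists>u\<in>carrier_vec m. t = a \<bullet> s + w \<bullet> u"
    if "r \<in> carrier_vec 3" "f * t = a \<bullet> r" for t r
  proof -
    have "t * f \<in> power_ideal q"
      unfolding power_ideal_iff a_def[symmetric] using that by (metis mult.commute)
    then show ?thesis using link_iff[of t] by (simp add: link_ideal_iff)
  qed
qed

abbreviation "E \<equiv> row_mat (power_gens q) :: 'a poly3 mat"
abbreviation "\<psi>\<phi>' \<equiv> transpose_mat \<psi> * \<phi>'"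

lemma E: "E \<in> carrier_mat 1 3"
  using row_mat_carrier[of "power_gens q :: 'a poly3 list"] by simp

lemma E_mult: "x \<in> carrier_vec 3 \<Longrightarrow> E *\<^sub>v x = vec 1 (\<lambda>_. a \<bullet> x)"
  using row_mat_mult[of x "power_gens q"] E by (intro eq_vecI) (auto simp: a_def)

lemma \<psi>\<phi>': "\<psi>\<phi>' \<in> carrier_mat 3 m"
  using link.\<psi>t link.\<phi>' by (rule mult_carrier_mat)

lemma \<psi>\<phi>'_mult: "u \<in> carrier_vec m \<Longrightarrow> \<psi>\<phi>' *\<^sub>v u = transpose_mat \<psi> *\<^sub>v (\<phi>' *\<^sub>v u)"
  by (rule assoc_mult_mat_vec[OF link.\<psi>t link.\<phi>'])

text \<open>\<open>exact_F1\<close> with its last coordinate forgotten: that coordinate is the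
  multiplier of f, over which the congruence quantifies.\<close>

lemma exact_0:
  assumes x: "x \<in> carrier_vec 3"
  shows "(\<exists>s\<in>carrier_vec 1. E *\<^sub>v x = f \<cdot>\<^sub>v s) \<longleftrightarrow>
    (\<exists>u\<in>carrier_vec m. \<exists>s\<in>carrier_vec 3. x = \<psi>\<phi>' *\<^sub>v u + f \<cdot>\<^sub>v s)"
proof
  assume "\<exists>s\<in>carrier_vec 1. E *\<^sub>v x = f \<cdot>\<^sub>v s"
  then obtain s where s: "s \<in> carrier_vec 1" "E *\<^sub>v x = f \<cdot>\<^sub>v s" by blast
  have "a \<bullet> x = f * s $ 0"
    using arg_cong[OF s(2), of "\<lambda>y. vec_index y 0"] s(1) by (simp add: E_mult[OF x])
  then have "a \<bullet> x + f * (- s $ 0) = 0" by simp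
  from hyp.exact_F1[OF x this] show "\<exists>u\<in>carrier_vec m. \<exists>s\<in>carrier_vec 3. x = \<psi>\<phi>' *\<^sub>v u + f \<cdot>\<^sub>v s"
    using \<psi>\<phi>'_mult by metis
next
  assume "\<exists>u\<in>carrier_vec m. \<exists>s\<in>carrier_vec 3. x = \<psi>\<phi>' *\<^sub>v u + f \<cdot>\<^sub>v s"
  then obtain u s where us: "u \<in> carrier_vec m" "s \<in> carrier_vec 3" "x = \<psi>\<phi>' *\<^sub>v u + f \<cdot>\<^sub>v s" by blast
  have "a \<bullet> x = h * (w \<bullet> u) + f * (a \<bullet> s)"
    using us by (simp add: \<psi>\<phi>'_mult scalar_prod_add_distrib[of _ 3] link.a_\<psi>t_\<phi>' carrier_vecD[OF us(2)])
  also have "\<dots> = f * (const v * (w \<bullet> u) + a \<bullet> s)" by (simp add: v(2) algebra_simps)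
  finally have "E *\<^sub>v x = f \<cdot>\<^sub>v vec 1 (\<lambda>_. const v * (w \<bullet> u) + a \<bullet> s)"
    by (intro eq_vecI) (auto simp: E_mult[OF x])
  then show "\<exists>s\<in>carrier_vec 1. E *\<^sub>v x = f \<cdot>\<^sub>v s" by (intro bexI) auto
qed

text \<open>\<open>exact_F2\<close> also asks for an equation in the last coordinate. Pairing the
  given congruence with a, and using that a times \<psi>t \<phi>' is h w, yields f times this
  equation, so it follows by cancelling f.\<close>

lemma exact_1:
  assumes u: "u \<in> carrier_vec m"
  shows "(\<exists>s\<in>carrier_vec 3. \<psi>\<phi>' *\<^sub>v u = f \<cdot>\<^sub>v s) \<longleftrightarrow>
    (\<exists>t\<in>carrier_vec m. \<exists>s\<in>carrier_vec m. u = \<phi> *\<^sub>v t + f \<cdot>\<^sub>v s)"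
proof
  assume "\<exists>s\<in>carrier_vec 3. \<psi>\<phi>' *\<^sub>v u = f \<cdot>\<^sub>v s"
  then obtain s where s: "s \<in> carrier_vec 3" "transpose_mat \<psi> *\<^sub>v (\<phi>' *\<^sub>v u) = f \<cdot>\<^sub>v s"
    using \<psi>\<phi>'_mult[OF u] by metis
  have s': "- s \<in> carrier_vec 3" using s by simp
  have "f * (const v * (w \<bullet> u)) = h * (w \<bullet> u)" by (simp add: v(2) algebra_simps)
  also have "\<dots> = a \<bullet> (f \<cdot>\<^sub>v s)" using link.a_\<psi>t_\<phi>'[OF u] s(2) by simp
  also have "\<dots> = f * (a \<bullet> s)" using s(1) by (simp add: carrier_vecD[OF s(1)])
  finally have "const v * (w \<bullet> u) = a \<bullet> s" using f_nonzero by simp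
  then have eq2: "const v * (w \<bullet> u) + a \<bullet> (- s) = 0"
    using s(1) by (simp add: carrier_vecD[OF s(1)])
  have "transpose_mat \<psi> *\<^sub>v (\<phi>' *\<^sub>v u) + f \<cdot>\<^sub>v (- s) = 0\<^sub>v 3"
    unfolding s(2) using s(1) by (intro eq_vecI) auto
  from hyp.exact_F2[OF u s' this eq2] obtain t where t: "t \<in> carrier_vec m" "u = \<phi> *\<^sub>v t" by blast
  then have "u = \<phi> *\<^sub>v t + f \<cdot>\<^sub>v 0\<^sub>v m" using u by (intro eq_vecI) auto
  then show "\<exists>t\<in>carrier_vec m. \<exists>s\<in>carrier_vec m. u = \<phi> *\<^sub>v t + f \<cdot>\<^sub>v s"
    using t(1) by (intro bexI[of _ t] bexI[of _ "0\<^sub>v m"]) auto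
next
  assume "\<exists>t\<in>carrier_vec m. \<exists>s\<in>carrier_vec m. u = \<phi> *\<^sub>v t + f \<cdot>\<^sub>v s"
  then obtain t s where ts: "t \<in> carrier_vec m" "s \<in> carrier_vec m" "u = \<phi> *\<^sub>v t + f \<cdot>\<^sub>v s" by blast
  have "\<psi>\<phi>' *\<^sub>v u = h \<cdot>\<^sub>v (transpose_mat \<psi> *\<^sub>v t) + f \<cdot>\<^sub>v (transpose_mat \<psi> *\<^sub>v (\<phi>' *\<^sub>v s))"
    using ts u by (simp add: \<psi>\<phi>'_mult link.lin)
  also have "\<dots> = f \<cdot>\<^sub>v (const v \<cdot>\<^sub>v (transpose_mat \<psi> *\<^sub>v t) + transpose_mat \<psi> *\<^sub>v (\<phi>' *\<^sub>v s))"
    by (rule eq_vecI) (auto simp: v(2) algebra_simps simp del: index_mult_mat_vec)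
  finally show "\<exists>s\<in>carrier_vec 3. \<psi>\<phi>' *\<^sub>v u = f \<cdot>\<^sub>v s" using ts by (intro bexI) auto
qed

lemma hypersurface_resolution:
  "minimal_graded_resolution (hypersurface f) (quot_homog (PIdl\<^bsub>poly_ring\<^esub> f)) (frobenius_power f q)
     (periodic_twists q d b)
     (periodic_maps (map_mat (reduce f) E) (map_mat (reduce f) \<psi>\<phi>') (map_mat (reduce f) \<phi>) (map_mat (reduce f) \<phi>'))"
proof -
  let ?M = "periodic_maps E \<psi>\<phi>' \<phi> \<phi>'" and ?tw = "periodic_twists q d b"
  have cases: "i = 0 \<or> i = Suc 0 \<or> (\<exists>n. i = Suc (Suc n))" for i :: nat by (metis nat.exhaust)
  have C: "?M i \<in> carrier_mat (length (?tw i)) (length (?tw (Suc i)))" for i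
    using cases[of i] E \<psi>\<phi>' link.\<phi> link.\<phi>' by (elim disjE exE) (simp_all add: m)
  have H: "?M i $$ (r, k) \<in> homog (?tw (Suc i) ! k - ?tw i ! r) \<and> 1 \<le> ?tw (Suc i) ! k - ?tw i ! r"
    if rk: "r < length (?tw i)" "k < length (?tw (Suc i))" for i r k
    using cases[of i]
  proof (elim disjE exE)
    assume i: "i = 0"
    then have "E $$ (0, k) = a $ k" using rk gs_nth(1)[of k] by (simp add: a_def vec_of_list_index)
    then show ?thesis using rk i a_homog(1)[of k] q_ge by simp
  next
    assume i: "i = Suc 0"
    have "1 \<le> b - int q" using b_c_bounds by linarith
    then show ?thesis using rk i \<psi>\<phi>'_entries[of r k] by (simp add: m del: index_mult_mat)
  next
    fix n assume i: "i = Suc (Suc n)"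
    show ?thesis
    proof (cases "even n")
      case True
      then have "n mod 2 = 0" "Suc n mod 2 = 1" "Suc n div 2 = n div 2" by presburger+
      then show ?thesis using True rk i entries(1)[of r k] by (simp add: m)
    next
      case False
      \<comment> \<open>From odd n to n + 1 the period count rises by one, adding d, while the
        remainder drops from 1 to 0; the twist grows by \<open>d - 1\<close>, the degree of the
        adjoint.\<close>
      then have "int (Suc n div 2) * int d - int (n div 2) * int d = int d"
        by (auto elim!: oddE simp: algebra_simps)
      moreover have "n mod 2 = 1" "Suc n mod 2 = 0" using False by presburger+
      ultimately show ?thesis using False rk i \<phi>'_entries[of r k] b_c_bounds(5)
        by (simp add: m algebra_simps)
    qed
  qed
  have "minimal_graded_resolution (hypersurface f) (quot_homog (PIdl\<^bsub>poly_ring\<^esub> f))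
    (Idl\<^bsub>hypersurface f\<^esub> (reduce f ` set (power_gens q))) ?tw (\<lambda>i. map_mat (reduce f) (?M i))"
  proof (rule hypersurface_resolutionI)
    show "?tw 0 = [0]" by simp
    show "x \<in> power_ideal q \<longleftrightarrow> (\<exists>v\<in>carrier_vec (length (?tw 1)). x = (?M 0 *\<^sub>v v) $ 0)" for x
      unfolding power_ideal_iff a_def[symmetric] by (auto simp: E_mult)
    show "(\<exists>s\<in>carrier_vec (length (?tw i)). ?M i *\<^sub>v x = f \<cdot>\<^sub>v s) \<longleftrightarrow>
      (\<exists>u\<in>carrier_vec (length (?tw (Suc (Suc i)))). \<exists>s\<in>carrier_vec (length (?tw (Suc i))).
         x = ?M (Suc i) *\<^sub>v u + f \<cdot>\<^sub>v s)" if x: "x \<in> carrier_vec (length (?tw (Suc i)))" for i x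
      using cases[of i]
    proof (elim disjE exE)
      assume "i = 0"
      then show ?thesis using exact_0[of x] x by (simp add: m)
    next
      assume "i = Suc 0"
      then show ?thesis using exact_1[of x] x by (simp add: m)
    next
      fix n assume i: "i = Suc (Suc n)"
      have x': "x \<in> carrier_vec m" using x by (simp add: i m)
      note mf = v(2) hyp.unit f_nonzero x'
      show ?thesis
        using matrix_factorization_exact[OF link.\<phi> link.\<phi>' link.\<phi>\<phi>'_vec link.\<phi>'\<phi>_vec mf]
          matrix_factorization_exact[OF link.\<phi>' link.\<phi> link.\<phi>'\<phi>_vec link.\<phi>\<phi>'_vec mf]
        by (simp add: i m)
    qed
  qed (use C H in auto)
  then show ?thesis unfolding map_mat_periodic_maps frobenius_power_def .
qed

end

section \<open>The resolution of the ideal generated by the powers and f over P, and its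
  regularity\<close>

lemma Idl_list_row_mat:
  fixes gs :: "'r::comm_ring_1 list"
  shows "x \<in> Idl\<^bsub>class_ring\<^esub> (set gs) \<longleftrightarrow> (\<exists>v\<in>carrier_vec (length gs). x = (row_mat gs *\<^sub>v v) $ 0)"
proof -
  have row: "(row_mat gs *\<^sub>v v) $ 0 = (\<Sum>i<length gs. v $ i * gs ! i)" if "v \<in> carrier_vec (length gs)" for v
    using that by (simp add: row_mat_mult scalar_prod_def vec_of_list_index lessThan_atLeast0 mult.commute)
  show ?thesis
  proof
    assume "x \<in> Idl\<^bsub>class_ring\<^esub> (set gs)"
    then obtain r where "x = (\<Sum>i<length gs. r i * gs ! i)" unfolding Idl_list by blast
    then have "x = (row_mat gs *\<^sub>v vec (length gs) r) $ 0" by (simp add: row)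
    then show "\<exists>v\<in>carrier_vec (length gs). x = (row_mat gs *\<^sub>v v) $ 0" by (rule bexI) simp
  next
    assume "\<exists>v\<in>carrier_vec (length gs). x = (row_mat gs *\<^sub>v v) $ 0"
    then obtain v where "v \<in> carrier_vec (length gs)" "x = (row_mat gs *\<^sub>v v) $ 0" by blast
    then have "x = (\<Sum>i<length gs. v $ i * gs ! i)" by (simp only: row)
    then show "x \<in> Idl\<^bsub>class_ring\<^esub> (set gs)" unfolding Idl_list by (intro CollectI exI conjI TrueI)
  qed
qed

lemma split_vec:
  assumes "x \<in> carrier_vec (n + k)"
  obtains y z where "y \<in> carrier_vec n" and "z \<in> carrier_vec k" and "x = y @\<^sub>v z"
  using assms by (intro that[of "vec_first x n" "vec_last x k"]) auto

lemma append_vec_zero: "0\<^sub>v (n + k) = 0\<^sub>v n @\<^sub>v 0\<^sub>v k"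
  by (rule eq_vecI) auto

context frobenius_link_hypersurface
begin

definition D1 where "D1 = row_mat (power_gens q @ [f])"
text \<open>The columns are syzygies of the row (a, f): the first block because a times \<psi>t
  \<phi>' equals h w = v f w, the second because f and the entries of a commute. D3 then records the
  solutions found in \<open>exact_F2\<close>.\<close>

definition D2 where "D2 = four_block_mat \<psi>\<phi>' (f \<cdot>\<^sub>m 1\<^sub>m 3) (- mat_of_row (const v \<cdot>\<^sub>v w)) (- mat_of_row a)"
definition D3 where "D3 = \<phi> @\<^sub>r (- (const v \<cdot>\<^sub>m transpose_mat \<psi>))"

lemma D_carriers: "D1 \<in> carrier_mat 1 (3 + 1)" "D2 \<in> carrier_mat (3 + 1) (m + 3)" "D3 \<in> carrier_mat (m + 3) m"
proof -
  show "D1 \<in> carrier_mat 1 (3 + 1)" unfolding D1_def using row_mat_carrier[of "power_gens q @ [f]"] by simp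
  show "D2 \<in> carrier_mat (3 + 1) (m + 3)" unfolding D2_def
    by (rule four_block_carrier_mat[OF \<psi>\<phi>']) (simp add: mat_of_row_def)
  show "D3 \<in> carrier_mat (m + 3) m" unfolding D3_def
    by (rule carrier_append_rows[OF link.\<phi>]) simp
qed

lemma D1_mult:
  assumes r: "r \<in> carrier_vec 3" and y: "y \<in> carrier_vec 1"
  shows "D1 *\<^sub>v (r @\<^sub>v y) = vec 1 (\<lambda>_. a \<bullet> r + f * y $ 0)"
proof (rule eq_vecI)
  have f: "vec_of_list [f] \<in> carrier_vec 1" by (rule carrier_vecI) simp
  have fy: "vec_of_list [f] \<bullet> y = f * y $ 0"
    using y by (simp add: scalar_prod_def vec_of_list_index)
  have "(D1 *\<^sub>v (r @\<^sub>v y)) $ 0 = vec_of_list (power_gens q @ [f]) \<bullet> (r @\<^sub>v y)"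
    unfolding D1_def using append_carrier_vec[OF r y] by (intro row_mat_mult) simp
  also have "\<dots> = a \<bullet> r + vec_of_list [f] \<bullet> y"
    unfolding vec_of_list_append a_def[symmetric] by (rule scalar_prod_append[OF a_carrier f r y])
  finally have "(D1 *\<^sub>v (r @\<^sub>v y)) $ 0 = a \<bullet> r + f * y $ 0" by (simp only: fy)
  then show "(D1 *\<^sub>v (r @\<^sub>v y)) $ i = vec 1 (\<lambda>_. a \<bullet> r + f * y $ 0) $ i"
    if "i < dim_vec (vec 1 (\<lambda>_. a \<bullet> r + f * y $ 0))" for i using that by simp
qed (use D_carriers in auto)

lemma D2_mult:
  assumes u: "u \<in> carrier_vec m" and s: "s \<in> carrier_vec 3"
  shows "D2 *\<^sub>v (u @\<^sub>v s) = (transpose_mat \<psi> *\<^sub>v (\<phi>' *\<^sub>v u) + f \<cdot>\<^sub>v s) @\<^sub>v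
    vec 1 (\<lambda>_. - (const v * (w \<bullet> u)) - a \<bullet> s)"
proof -
  have c: "f \<cdot>\<^sub>m 1\<^sub>m 3 \<in> carrier_mat 3 3" "- mat_of_row (const v \<cdot>\<^sub>v w) \<in> carrier_mat 1 m"
    "- mat_of_row a \<in> carrier_mat 1 3"
    by (simp_all add: mat_of_row_def)
  have "(f \<cdot>\<^sub>m 1\<^sub>m 3) *\<^sub>v s = f \<cdot>\<^sub>v s"
    using smult_mat_mult_vec[OF one_carrier_mat s] s by simp
  moreover have "- mat_of_row (const v \<cdot>\<^sub>v w) *\<^sub>v u + - mat_of_row a *\<^sub>v s =
      vec 1 (\<lambda>_. - (const v * (w \<bullet> u)) - a \<bullet> s)"
    using c carrier_vecD[OF u] carrier_vecD[OF s] by (intro eq_vecI) auto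
  ultimately show ?thesis
    unfolding D2_def four_block_mat_mult_vec[OF \<psi>\<phi>' c u s] by (simp only: \<psi>\<phi>'_mult[OF u])
qed

lemma D3_mult:
  assumes t: "t \<in> carrier_vec m"
  shows "D3 *\<^sub>v t = (\<phi> *\<^sub>v t) @\<^sub>v (- (const v \<cdot>\<^sub>v (transpose_mat \<psi> *\<^sub>v t)))"
proof -
  have c: "- (const v \<cdot>\<^sub>m transpose_mat \<psi>) \<in> carrier_mat 3 m" by simp
  have "- (const v \<cdot>\<^sub>m transpose_mat \<psi>) *\<^sub>v t = - ((const v \<cdot>\<^sub>m transpose_mat \<psi>) *\<^sub>v t)"
    using t by (intro uminus_mult_mat_vec) simp
  then show ?thesis
    unfolding D3_def mat_mult_append[OF link.\<phi> c t] smult_mat_mult_vec[OF link.\<psi>t t] by simp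
qed

lemma exact_D1:
  assumes x: "x \<in> carrier_vec (3 + 1)"
  shows "D1 *\<^sub>v x = 0\<^sub>v 1 \<longleftrightarrow> (\<exists>z\<in>carrier_vec (m + 3). x = D2 *\<^sub>v z)"
proof
  obtain r y where r: "r \<in> carrier_vec 3" and y: "y \<in> carrier_vec 1" and xr: "x = r @\<^sub>v y"
    using split_vec[OF x] by metis
  assume "D1 *\<^sub>v x = 0\<^sub>v 1"
  then have "vec 1 (\<lambda>_. a \<bullet> r + f * y $ 0) = 0\<^sub>v 1" unfolding xr D1_mult[OF r y] .
  from arg_cong[OF this, of "\<lambda>y. vec_index y 0"] have "a \<bullet> r + f * y $ 0 = 0" by simp
  from hyp.exact_F1[OF r this] obtain u s where us: "u \<in> carrier_vec m" "s \<in> carrier_vec 3"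
    "r = transpose_mat \<psi> *\<^sub>v (\<phi>' *\<^sub>v u) + f \<cdot>\<^sub>v s" "y $ 0 = - (const v * (w \<bullet> u)) - a \<bullet> s" by blast
  have "y = vec 1 (\<lambda>_. - (const v * (w \<bullet> u)) - a \<bullet> s)"
    using y us(4) by (intro eq_vecI) auto
  then have "x = D2 *\<^sub>v (u @\<^sub>v s)" by (simp only: xr D2_mult[OF us(1,2)] us(3))
  then show "\<exists>z\<in>carrier_vec (m + 3). x = D2 *\<^sub>v z" by (rule bexI) (rule append_carrier_vec[OF us(1,2)])
next
  assume "\<exists>z\<in>carrier_vec (m + 3). x = D2 *\<^sub>v z"
  then obtain z where z: "z \<in> carrier_vec (m + 3)" "x = D2 *\<^sub>v z" by blast
  obtain u s where us: "u \<in> carrier_vec m" "s \<in> carrier_vec 3" "z = u @\<^sub>v s"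
    using split_vec[OF z(1)] by metis
  let ?r = "transpose_mat \<psi> *\<^sub>v (\<phi>' *\<^sub>v u) + f \<cdot>\<^sub>v s"
  have r: "?r \<in> carrier_vec 3" using us by simp
  have "a \<bullet> ?r = h * (w \<bullet> u) + f * (a \<bullet> s)"
    using us by (simp add: scalar_prod_add_distrib[of _ 3] link.a_\<psi>t_\<phi>' carrier_vecD[OF us(2)])
  then have "a \<bullet> ?r + f * (- (const v * (w \<bullet> u)) - a \<bullet> s) = 0"
    by (simp add: v(2) algebra_simps)
  then show "D1 *\<^sub>v x = 0\<^sub>v 1"
    unfolding z(2) us(3) D2_mult[OF us(1,2)] D1_mult[OF r vec_carrier] by (intro eq_vecI) auto
qed

lemma exact_D2:
  assumes z: "z \<in> carrier_vec (m + 3)"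
  shows "D2 *\<^sub>v z = 0\<^sub>v (3 + 1) \<longleftrightarrow> (\<exists>t\<in>carrier_vec m. z = D3 *\<^sub>v t)"
proof
  obtain u s where us: "u \<in> carrier_vec m" "s \<in> carrier_vec 3" "z = u @\<^sub>v s"
    using split_vec[OF z] by metis
  let ?r = "transpose_mat \<psi> *\<^sub>v (\<phi>' *\<^sub>v u) + f \<cdot>\<^sub>v s"
  have r: "?r \<in> carrier_vec 3" using us by simp
  assume "D2 *\<^sub>v z = 0\<^sub>v (3 + 1)"
  then have "?r @\<^sub>v vec 1 (\<lambda>_. - (const v * (w \<bullet> u)) - a \<bullet> s) = 0\<^sub>v 3 @\<^sub>v 0\<^sub>v 1"
    unfolding us(3) D2_mult[OF us(1,2)] append_vec_zero .
  from iffD1[OF append_vec_eq[OF r zero_carrier_vec] this]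
  have 1: "?r = 0\<^sub>v 3" and 2: "vec 1 (\<lambda>_. - (const v * (w \<bullet> u)) - a \<bullet> s) = 0\<^sub>v 1" by blast+
  have "- (const v * (w \<bullet> u)) - a \<bullet> s = 0"
    using arg_cong[OF 2, of "\<lambda>y. vec_index y 0"] by simp
  then have "- (- (const v * (w \<bullet> u)) - a \<bullet> s) = 0" by (simp only: minus_zero)
  then have "const v * (w \<bullet> u) + a \<bullet> s = 0" by (simp add: add.commute)
  from hyp.exact_F2[OF us(1,2) 1 this] obtain t where "t \<in> carrier_vec m" "u = \<phi> *\<^sub>v t"
    "s = - (const v \<cdot>\<^sub>v (transpose_mat \<psi> *\<^sub>v t))" by blast
  then show "\<exists>t\<in>carrier_vec m. z = D3 *\<^sub>v t" using us(3) D3_mult by metis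
next
  assume "\<exists>t\<in>carrier_vec m. z = D3 *\<^sub>v t"
  then obtain t where t: "t \<in> carrier_vec m" "z = D3 *\<^sub>v t" by blast
  define s where "s = - (const v \<cdot>\<^sub>v (transpose_mat \<psi> *\<^sub>v t))"
  have \<psi>t: "transpose_mat \<psi> *\<^sub>v t \<in> carrier_vec 3" using t by simp
  have us: "\<phi> *\<^sub>v t \<in> carrier_vec m" "s \<in> carrier_vec 3" using t \<psi>t by (simp_all add: s_def)
  have "transpose_mat \<psi> *\<^sub>v (\<phi>' *\<^sub>v (\<phi> *\<^sub>v t)) + f \<cdot>\<^sub>v s = 0\<^sub>v 3"
    unfolding s_def using t carrier_vecD[OF \<psi>t]
    by (simp add: link.lin) (rule eq_vecI, auto simp: v(2) simp del: index_mult_mat_vec)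
  moreover have "- (const v * (w \<bullet> (\<phi> *\<^sub>v t))) - a \<bullet> s = 0"
    using t carrier_vecD[OF \<psi>t] by (simp add: s_def link.w_\<phi>)
  ultimately show "D2 *\<^sub>v z = 0\<^sub>v (3 + 1)"
    unfolding t(2) D3_mult[OF t(1)] s_def[symmetric] D2_mult[OF us] append_vec_zero
    by (simp add: zero_vec_def)
qed

lemma exact_D3:
  assumes t: "t \<in> carrier_vec m" and zero: "D3 *\<^sub>v t = 0\<^sub>v (m + 3)"
  shows "t = 0\<^sub>v m"
proof -
  have "\<phi> *\<^sub>v t \<in> carrier_vec m" using t by simp
  from iffD1[OF append_vec_eq[OF this zero_carrier_vec] zero[unfolded D3_mult[OF t] append_vec_zero]]
  have "\<phi> *\<^sub>v t = 0\<^sub>v m" by blast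
  then show ?thesis using link.\<phi>_inj[OF t h_nonzero] by blast
qed

lemma const_mult_homog: "x \<in> homog i \<Longrightarrow> const k * x \<in> homog i"
  using homog_mult[OF homog_const] by fastforce

lemma poly_resolution:
  "finite_minimal_graded_resolution poly_ring homog (Idl\<^bsub>poly_ring\<^esub> (set (power_gens q @ [f])))
    [[0], replicate 3 (int q) @ [int d], replicate (2 * d) b @ replicate 3 (int q + int d),
     replicate (2 * d) (b + 1)] [D1, D2, D3]"
proof (rule finite_resolution3I)
  let ?t1 = "replicate 3 (int q) @ [int d]" and ?t2 = "replicate (2 * d) b @ replicate 3 (int q + int d)"
    and ?t3 = "replicate (2 * d) (b + 1)"
  have len: "length ?t1 = 3 + 1" "length ?t2 = m + 3" "length ?t3 = m" by (simp_all add: m)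
  show "D1 \<in> carrier_mat 1 (length ?t1)" "D2 \<in> carrier_mat (length ?t1) (length ?t2)"
    "D3 \<in> carrier_mat (length ?t2) (length ?t3)" unfolding len by (rule D_carriers)+
  show "D1 *\<^sub>v x = 0\<^sub>v 1 \<longleftrightarrow> (\<exists>z\<in>carrier_vec (length ?t2). x = D2 *\<^sub>v z)" if "x \<in> carrier_vec (length ?t1)" for x
    using exact_D1 that unfolding len .
  show "D2 *\<^sub>v z = 0\<^sub>v (length ?t1) \<longleftrightarrow> (\<exists>t\<in>carrier_vec (length ?t3). z = D3 *\<^sub>v t)"
    if "z \<in> carrier_vec (length ?t2)" for z
    using exact_D2 that unfolding len .
  show "t = 0\<^sub>v (length ?t3)" if "t \<in> carrier_vec (length ?t3)" "D3 *\<^sub>v t = 0\<^sub>v (length ?t2)" for t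
    using exact_D3 that unfolding len .
  show "x \<in> Idl\<^bsub>poly_ring\<^esub> (set (power_gens q @ [f])) \<longleftrightarrow> (\<exists>z\<in>carrier_vec (length ?t1). x = (D1 *\<^sub>v z) $ 0)" for x
    unfolding Idl_list_row_mat D1_def by simp
  show "D1 $$ (0, k) \<in> homog (?t1 ! k) \<and> 1 \<le> ?t1 ! k" if k: "k < length ?t1" for k
  proof -
    have D1k: "D1 $$ (0, k) = (power_gens q @ [f]) ! k" using k unfolding D1_def by (intro row_mat_nth) simp
    show ?thesis
    proof (cases "k < 3")
      case True
      then have "(power_gens q @ [f]) ! k = a $ k" by (simp add: nth_append a_def vec_of_list_index)
      then show ?thesis using True a_homog(1)[OF True] q_ge by (simp add: D1k nth_append)
    next
      case False
      then have "k = 3" using k by simp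
      then show ?thesis unfolding D1k using f_homog d_ge_2 by (simp add: nth_append)
    qed
  qed
  show "D2 $$ (r, k) \<in> homog (?t2 ! k - ?t1 ! r) \<and> 1 \<le> ?t2 ! k - ?t1 ! r"
    if rk: "r < length ?t1" "k < length ?t2" for r k
  proof -
    have dims: "dim_row \<psi>\<phi>' = 3" "dim_col \<psi>\<phi>' = m" using \<psi>\<phi>' by auto
    have D2: "D2 $$ (r, k) = (if r < 3 then if k < m then \<psi>\<phi>' $$ (r, k) else (f \<cdot>\<^sub>m 1\<^sub>m 3) $$ (r, k - m)
       else if k < m then - (const v * w $ k) else - a $ (k - m))"
      using rk unfolding len D2_def by (auto simp: dims mat_of_row_def simp del: index_mult_mat)
    have t1: "?t1 ! r = (if r < 3 then int q else int d)" and t2: "?t2 ! k = (if k < m then b else int q + int d)"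
      using rk by (auto simp: nth_append m)
    have "1 \<le> b - int q" using b_c_bounds by linarith
    moreover have "(f \<cdot>\<^sub>m 1\<^sub>m 3) $$ (r, k - m) \<in> homog (int d)" if "r < 3" "\<not> k < m"
      using that rk f_homog unfolding len by auto
    moreover have "a $ (k - m) \<in> homog (int q)" if "\<not> k < m"
      using that rk unfolding len by (intro a_homog) auto
    ultimately show ?thesis
      unfolding D2 t1 t2 using \<psi>\<phi>'_entries[of r k] const_mult_homog[OF entries(3), of k v] b_c_bounds(2,3,4,5) q_ge
      by (auto simp del: index_mult_mat index_smult_mat)
  qed
  show "D3 $$ (r, k) \<in> homog (?t3 ! k - ?t2 ! r) \<and> 1 \<le> ?t3 ! k - ?t2 ! r"
    if rk: "r < length ?t2" "k < length ?t3" for r k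
  proof -
    have D3: "D3 $$ (r, k) = (if r < m then \<phi> $$ (r, k) else - (const v * \<psi> $$ (k, r - m)))"
      using rk unfolding len D3_def append_rows_def by auto
    have t2: "?t2 ! r = (if r < m then b else int q + int d)" and t3: "?t3 ! k = b + 1"
      using rk by (auto simp: nth_append m)
    show ?thesis
      unfolding D3 t2 t3 using rk unfolding len
      using entries(1)[of r k] const_mult_homog[OF entries(2), of k "r - m" v] b_c_bounds
      by auto
  qed
qed

lemma regularity: "2 * cm_regularity (Idl\<^bsub>poly_ring\<^esub> (set (power_gens q @ [f]))) = 3 * int q + int d - 5"
proof -
  let ?ts = "[[0], replicate 3 (int q) @ [int d], replicate (2 * d) b @ replicate 3 (int q + int d),
     replicate (2 * d) (b + 1)]"
  let ?Z = "{x - int i | i x. x \<in> set (fin_twists ?ts i)}"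
  have res: "minimal_graded_resolution poly_ring homog (Idl\<^bsub>poly_ring\<^esub> (set (power_gens q @ [f])))
      (fin_twists ?ts) (fin_maps poly_ring ?ts [D1, D2, D3])"
    using poly_resolution by (simp add: finite_minimal_graded_resolution_def)
  have tw: "set (fin_twists ?ts i) \<subseteq> (if i = 0 then {0} else if i = 1 then {int q, int d}
      else if i = 2 then {b, int q + int d} else if i = 3 then {b + 1} else {})" for i
    by (auto simp: fin_twists_def nth_Cons split: nat.splits if_splits)
  have sub: "?Z \<subseteq> {0, int q - 1, int d - 1, b - 2, int q + int d - 2}"
  proof
    fix y assume "y \<in> ?Z"
    then obtain i x where "y = x - int i" "x \<in> set (fin_twists ?ts i)" by blast
    then show "y \<in> {0, int q - 1, int d - 1, b - 2, int q + int d - 2}"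
      using subsetD[OF tw, of x i] by (auto split: if_splits)
  qed
  \<comment> \<open>The maximum is attained both at index 2 by b and at index 3 by b + 1. The other
    twist at index 2 is smaller, as \<open>q \<ge> d + 3\<close> gives
    \<open>q + d < b\<close>.\<close>
  have "Max ?Z = b - 2"
  proof (rule Max_eqI)
    show "finite ?Z" by (rule finite_subset[OF sub]) simp
    show "y \<le> b - 2" if "y \<in> ?Z" for y
      using subsetD[OF sub that] b_c q_ge d_ge_2 by auto
    have "b \<in> set (fin_twists ?ts 2)" using d_ge_2 by (simp add: fin_twists_def)
    then show "b - 2 \<in> ?Z" by (intro CollectI exI[of _ 2] exI[of _ b]) simp
  qed
  then show ?thesis using cm_regularity_eq[OF res] b_c(1) by simp
qed

end

section \<open>The initial degree of f and the final assembly\<close>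

lemma max_ideal_lookup_0: "x \<in> max_ideal \<Longrightarrow> Poly_Mapping.lookup (x :: 'k::field poly3) 0 = 0"
proof -
  have "ideal {x :: 'k poly3. Poly_Mapping.lookup x 0 = 0} poly_ring"
    by (rule ideal_poly_ringI) (auto simp: lookup_add lookup_mult_0)
  moreover have "Poly_Mapping.lookup (Var v :: 'k poly3) 0 = 0" for v
    by (simp add: Var_def lookup_single when_def) (metis One_nat_def lookup_single_eq lookup_zero one_neq_zero)
  ultimately have "max_ideal \<subseteq> {x :: 'k poly3. Poly_Mapping.lookup x 0 = 0}"
    unfolding max_ideal_def by (intro Idl_least) auto
  then show "x \<in> max_ideal \<Longrightarrow> Poly_Mapping.lookup x 0 = 0" by blast
qed

text \<open>Yields \<open>d \<ge> 2\<close>, which makes the degree \<open>d - 1\<close> of the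
  adjoint positive, as minimality of the periodic resolution requires.\<close>

lemma max_ideal_square_degree:
  assumes "x \<in> max_ideal \<cdot>\<^bsub>poly_ring\<^esub> max_ideal" and "m \<in> Poly_Mapping.keys (x :: 'k::field poly3)"
  shows "2 \<le> mon_degree m"
  using assms
proof (induction arbitrary: m rule: ideal_prod.induct)
  case (prod i j)
  then obtain n n' where n: "m = n + n'" "n \<in> Poly_Mapping.keys i" "n' \<in> Poly_Mapping.keys j"
    using subsetD[OF keys_mult, of m i j] by auto
  have "n \<noteq> 0" "n' \<noteq> 0"
    using n prod(1,2) max_ideal_lookup_0 by (auto simp: in_keys_iff)
  then have "mon_degree n \<noteq> 0" "mon_degree n' \<noteq> 0" using mon_degree_eq_0 by auto
  then show ?case by (simp add: n(1) mon_degree_add)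
next
  case (sum s1 s2)
  then show ?case using subsetD[OF keys_add, of m s1 s2] by auto
qed

theorem theorem5p10:
  fixes f :: "'k::field poly3"
    and p q d m :: nat
    and ws :: "'k poly3 list"
    and X S \<psi> \<phi> :: "'k poly3 mat"
  assumes "CHAR('k) = p" and "p > 0"
    and "f \<noteq> 0" and "f \<in> homog (int d)" and "f \<in> max_ideal \<cdot>\<^bsub>poly_ring\<^esub> max_ideal"
    and "even p \<noteq> even d"
    and "\<exists>e. q = p ^ e" and "q \<ge> d + 3"
    and "link_compressed q f"
    and "length ws = m"
    and "minimal_homogeneous_generators (power_gens q @ ws) (link_ideal q f)"
    and "buchsbaum_eisenbud_resolution (link_ideal q f) (power_gens q @ ws) X"
    and "S \<in> carrier_mat 3 3" and "\<psi> \<in> carrier_mat m 3" and "\<phi> \<in> carrier_mat m m"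
    and "X = four_block_mat S (- transpose_mat \<psi>) \<psi> \<phi>"
  shows
    "\<exists>b c :: int. 2 * b = 3 * int q + int d - 1 \<and> 2 * c = int q - int d + 1 \<and>
      \<comment> \<open>(a)\<close>
      \<phi> \<in> carrier_mat (2 * d) (2 * d) \<and> elements_mat \<phi> \<subseteq> homog 1 \<and>
      (\<exists>v. v \<noteq> 0 \<and> pfaffian \<phi> = const v * f \<and>
           \<phi> * pf_adjoint \<phi> = (const v * f) \<cdot>\<^sub>m 1\<^sub>m (2 * d) \<and>
           pf_adjoint \<phi> * \<phi> = (const v * f) \<cdot>\<^sub>m 1\<^sub>m (2 * d)) \<and>
      pf_adjoint \<phi> \<in> carrier_mat (2 * d) (2 * d) \<and>
      elements_mat (pf_adjoint \<phi>) \<subseteq> homog (int d - 1) \<and>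
      \<psi> \<in> carrier_mat (2 * d) 3 \<and> elements_mat \<psi> \<subseteq> homog c \<and>
      minimal_graded_resolution (hypersurface f) (quot_homog (PIdl\<^bsub>poly_ring\<^esub> f))
        (frobenius_power f q)
        (periodic_twists q d b)
        (periodic_maps
          (map_mat (reduce f) (row_mat (power_gens q)))
          (map_mat (reduce f) (transpose_mat \<psi> * pf_adjoint \<phi>))
          (map_mat (reduce f) \<phi>)
          (map_mat (reduce f) (pf_adjoint \<phi>))) \<and>
      \<comment> \<open>(b)\<close>
      (\<exists>D1 D2 D3. finite_minimal_graded_resolution poly_ring homog
        (Idl\<^bsub>poly_ring\<^esub> (set (power_gens q @ [f])))
        [[0],
         replicate 3 (int q) @ [int d],
         replicate (2 * d) b @ replicate 3 (int q + int d),
         replicate (2 * d) (b + 1)]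
        [D1, D2, D3]) \<and>
      2 * cm_regularity (Idl\<^bsub>poly_ring\<^esub> (set (power_gens q @ [f])))
        = 3 * int q + int d - 5"
proof -
  obtain n where n: "n \<in> Poly_Mapping.keys f" using \<open>f \<noteq> 0\<close> keys_eq_empty[of f] by blast
  have d: "d \<ge> 2"
    using max_ideal_square_degree[OF \<open>f \<in> max_ideal \<cdot>\<^bsub>poly_ring\<^esub> max_ideal\<close> n]
      homogD[OF \<open>f \<in> homog (int d)\<close> n] by simp
  obtain e where e: "q = p ^ e" using \<open>\<exists>e. q = p ^ e\<close> by blast
  \<comment> \<open>A zero exponent would mean \<open>q = 1\<close>. Hence q is a positive power of
    p and has the parity of p.\<close>
  then have "e \<noteq> 0" using \<open>q \<ge> d + 3\<close> by (intro notI) simp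
  then have "odd (q + d)" using \<open>even p \<noteq> even d\<close> by (auto simp: e)
  then interpret L: frobenius_link_hypersurface f q d m ws X S \<psi> \<phi>
    using assms d by unfold_locales
  have m: "m = 2 * d" by (rule L.m)
  have "elements_mat \<phi> \<subseteq> homog 1"
    using L.entries(1) assms(15) by (auto dest!: elements_matD)
  moreover have "elements_mat (pf_adjoint \<phi>) \<subseteq> homog (int d - 1)"
    using L.\<phi>'_entries assms(15) by (auto dest!: elements_matD simp: L.\<phi>'_def)
  moreover have "elements_mat \<psi> \<subseteq> homog L.c"
    using L.entries(2) assms(14) by (auto dest!: elements_matD)
  moreover have "pfaffian \<phi> = const L.v * f" using L.v(2) by (simp add: L.h_def)
  moreover have "pf_adjoint \<phi> \<in> carrier_mat (2 * d) (2 * d)"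
    using L.link.\<phi>' by (simp add: L.\<phi>'_def m)
  ultimately show ?thesis
    using L.b_c L.v(1) mult_pf_adjoint[OF assms(15) L.skew_\<phi>] pf_adjoint_mult[OF assms(15) L.skew_\<phi>]
      assms(14,15) L.hypersurface_resolution L.poly_resolution L.regularity
    unfolding m L.\<phi>'_def
    by (intro exI[of _ L.b] exI[of _ L.c] conjI exI[of _ L.v] exI[of _ L.D1] exI[of _ L.D2] exI[of _ L.D3]) simp_all
qed

end
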